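(* Consider a sequence $(\delta_i)_{i\in\mathbb{N}}$ in $(0,1]$ that converges sufficiently fast to zero when $i\to\infty$ (meaning: fast enough that the Borel–Cantelli lemma can be applied, as for $\delta_i=2^{-i}$; see the context). Then we have the following convergences $$\lim_{i\to\infty}\omega_{\delta_i}=\omega\ \text{ in } C^\beta([-T,T],\mathbb{R}^m),\qquad \lim_{i\to\infty}\mathbb{W}_{\delta_i}=\mathbb{W}\ \text{ in } C^{2\beta}(\Delta[-T,T],\mathbb{R}^{m\times m})$$ for every $T>0$, for all $\omega\in\Omega$ and $\beta<1/2$ (with the version of $(\omega,\mathbb{W})$ described in the context).
   Context: $\Delta[-T,T]=\{(s,t):-T\le s\le t\le T\}$. $C^\beta([-T,T],\mathbb{R}^m)$ carries the Hölder seminorm $\sup_{s<t}|X(t)-X(s)|/(t-s)^\beta$, and $C^{2\beta}(\Delta[-T,T],\mathbb{R}^{m\times m})$ consists of maps $\mathbb{X}$ with $\sup_{s<t}|\mathbb{X}(s,t)|/(t-s)^{2\beta}<\infty$; convergence is with respect to these. Canonical Brownian motion: $\Omega\subset C_0(\mathbb{R},\mathbb{R}^m)$ is a set of full Wiener measure of continuous paths $\omega$ with $\omega(0)=0$ that are $\beta$-Hölder on every $[-T,T]$ for every $\beta<1/2$, invariant under the Wiener shift $\theta_t\omega(\cdot)=\omega(\cdot+t)-\omega(t)$; $\mathcal{F}$ is the trace of the Borel $\sigma$-algebra and $\mathbb{P}_{1/2}$ is the two-sided Wiener measure (independent components). For $\delta\in(0,1]$, $\omega_\delta(t)=\frac1\delta\int_0^t(\omega(\delta+r)-\omega(r))\,dr$,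 $t\in\mathbb{R}$, and $\mathbb{W}_\delta(s,t)=\int_s^t(\omega_\delta(r)-\omega_\delta(s))\otimes\omega_\delta'(r)\,dr$, $s\le t$. $\mathbb{W}$ is the (Lévy) area of $\omega$: for $i<j$, $\mathbb{W}^{i,j}(s,t)=\int_s^t(\omega^i(r)-\omega^i(s))\,d\omega^j(r)$ as the $L_2$-limit of Stieltjes sums along partitions of $[s,t]$ with mesh tending to zero, $\mathbb{W}^{i,i}(s,t)=\frac12(\omega^i(t)-\omega^i(s))^2$, $\mathbb{W}^{j,i}(s,t)=-\mathbb{W}^{i,j}(s,t)+(\omega^i(t)-\omega^i(s))(\omega^j(t)-\omega^j(s))$; for $s<0<t$ it is extended by $\mathbb{W}^{i,j}(s,t)=\mathbb{W}^{i,j}(s,0)+\mathbb{W}^{i,j}(0,t)-\omega^i(s)\omega^j(t)$. These random variables are defined up to null sets. "Sufficiently fast": no explicit rate is prescribed in the hypothesis. It means that the Borel–Cantelli lemma can be applied to deduce almost sure convergence to zero, for every $n\in\mathbb{N}$, of the rough path distance $\sup_{-n\le s<t\le n}\big(\frac{|\omega_{\delta_i}(t)-\omega_{\delta_i}(s)-\omega(t)+\omega(s)|}{(t-s)^\beta}+\frac{|\mathbb{W}_{\delta_i}(s,t)-\mathbb{W}(s,t)|}{(t-s)^{2\beta}}\big)$ from moment bounds on it; the proof is carried out for $\delta_i=2^{-i}$. Version: there is a $\theta$-invariant measurable set $\Omega'\subset\Omega$ with $\mathbb{P}_{1/2}(\Omega')=1$ on which the sequence $(\omega_{\delta_i},\mathbb{W}_{\delta_i})$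 converges on every $[-n,n]$; on $\Omega'$ the area $\mathbb{W}$ is taken to be the limit, which is an indistinguishable version of the area of $\omega$, and on the null set $\Omega\setminus\Omega'$ one sets $\omega\equiv0$ and $\mathbb{W}\equiv0$. The assertion "for all $\omega\in\Omega$" refers to this version. *)

theory Defs
  imports "HOL-Probability.Probability"
begin

type_synonym 'm path = "real \<Rightarrow> (real, 'm) vec"
type_synonym 'm area = "real \<Rightarrow> real \<Rightarrow> ((real, 'm) vec, 'm) vec"

section \<open>Hoelder spaces\<close>

text \<open>The suprema are taken in \<^typ>\<open>ennreal\<close>, so they are infinite when they ought to be.\<close>

definition hoelder_seminorm :: "real \<Rightarrow> real \<Rightarrow> (real \<Rightarrow> 'a::real_normed_vector) \<Rightarrow> ennreal" where
  "hoelder_seminorm \<beta> T X =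
     (\<Squnion>(s, t) \<in> {(s, t). -T \<le> s \<and> s < t \<and> t \<le> T}. ennreal (norm (X t - X s) / (t - s) powr \<beta>))"

definition hoelder_space :: "real \<Rightarrow> real \<Rightarrow> (real \<Rightarrow> 'a::real_normed_vector) set" where
  "hoelder_space \<beta> T = {X. continuous_on {-T..T} X \<and> hoelder_seminorm \<beta> T X < \<infinity>}"

definition hoelder_seminorm2 :: "real \<Rightarrow> real \<Rightarrow> (real \<Rightarrow> real \<Rightarrow> 'a::real_normed_vector) \<Rightarrow> ennreal" where
  "hoelder_seminorm2 \<gamma> T X =
     (\<Squnion>(s, t) \<in> {(s, t). -T \<le> s \<and> s < t \<and> t \<le> T}. ennreal (norm (X s t) / (t - s) powr \<gamma>))"

definition hoelder_space2 :: "real \<Rightarrow> real \<Rightarrow> (real \<Rightarrow> real \<Rightarrow> 'a::real_normed_vector) set" where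
  "hoelder_space2 \<gamma> T = {X. hoelder_seminorm2 \<gamma> T X < \<infinity>}"

definition hoelder_tendsto ::
    "real \<Rightarrow> real \<Rightarrow> (nat \<Rightarrow> real \<Rightarrow> 'a::real_normed_vector) \<Rightarrow> (real \<Rightarrow> 'a) \<Rightarrow> bool" where
  "hoelder_tendsto \<beta> T X x \<longleftrightarrow>
     (\<forall>i. X i \<in> hoelder_space \<beta> T) \<and> x \<in> hoelder_space \<beta> T \<and>
     (\<lambda>i. hoelder_seminorm \<beta> T (\<lambda>t. X i t - x t)) \<longlonglongrightarrow> 0"

definition hoelder_tendsto2 ::
    "real \<Rightarrow> real \<Rightarrow> (nat \<Rightarrow> real \<Rightarrow> real \<Rightarrow> 'a::real_normed_vector) \<Rightarrow> (real \<Rightarrow> real \<Rightarrow> 'a) \<Rightarrow> bool" where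
  "hoelder_tendsto2 \<gamma> T X x \<longleftrightarrow>
     (\<forall>i. X i \<in> hoelder_space2 \<gamma> T) \<and> x \<in> hoelder_space2 \<gamma> T \<and>
     (\<lambda>i. hoelder_seminorm2 \<gamma> T (\<lambda>s t. X i s t - x s t)) \<longlonglongrightarrow> 0"

section \<open>Two-sided Wiener measure and canonical Brownian motion\<close>

definition C0_paths :: "'m::finite path set" where
  "C0_paths = {\<omega>. continuous_on UNIV \<omega> \<and> \<omega> 0 = 0}"

text \<open>The Borel sigma-algebra of the topology of locally uniform convergence; the generator is
  the family of all open sets of that topology.\<close>

definition path_borel :: "'m::finite path measure" where
  "path_borel = sigma C0_paths
     {U. U \<subseteq> C0_paths \<and>
         (\<forall>\<omega>\<in>U. \<exists>T>0. \<exists>\<epsilon>>0. {\<eta> \<in> C0_paths. \<forall>t\<in>{-T..T}. dist (\<eta> t) (\<omega> t) < \<epsilon>} \<subseteq> U)}"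

text \<open>The times are arbitrary reals, so together with \<open>\<omega> 0 = 0\<close> the condition makes
  the coordinate process a two-sided Brownian motion with independent components.\<close>

definition two_sided_wiener_measure :: "'m::finite path measure \<Rightarrow> bool" where
  "two_sided_wiener_measure W \<longleftrightarrow>
     prob_space W \<and> space W = C0_paths \<and> sets W = sets path_borel \<and>
     (\<forall>s t i. s < t \<longrightarrow>
        distributed W lborel (\<lambda>\<omega>. (\<omega> t - \<omega> s) $ i) (normal_density 0 (sqrt (t - s)))) \<and>
     (\<forall>(\<tau> :: nat \<Rightarrow> real) n. strict_mono_on {..n} \<tau> \<longrightarrow>
        prob_space.indep_vars W (\<lambda>_. borel)
          (\<lambda>(k, i) \<omega>. (\<omega> (\<tau> (Suc k)) - \<omega> (\<tau> k)) $ i) ({..<n} \<times> UNIV))"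

definition wiener_shift :: "real \<Rightarrow> 'm::finite path \<Rightarrow> 'm path" where
  "wiener_shift \<tau> \<omega> = (\<lambda>t. \<omega> (t + \<tau>) - \<omega> \<tau>)"

definition shift_invariant :: "'m::finite path set \<Rightarrow> bool" where
  "shift_invariant A \<longleftrightarrow> (\<forall>\<tau>. wiener_shift \<tau> ` A = A)"

definition canonical_path_set :: "'m::finite path measure \<Rightarrow> 'm path set \<Rightarrow> bool" where
  "canonical_path_set W \<Omega> \<longleftrightarrow>
     \<Omega> \<subseteq> C0_paths \<and> \<Omega> \<in> sets W \<and> measure W \<Omega> = 1 \<and>
     (\<forall>\<omega>\<in>\<Omega>. \<forall>T>0. \<forall>\<beta>. 0 < \<beta> \<and> \<beta> < 1/2 \<longrightarrow> \<omega> \<in> hoelder_space \<beta> T) \<and>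
     shift_invariant \<Omega>"

section \<open>Smooth approximations\<close>

definition approx_path :: "real \<Rightarrow> 'm::finite path \<Rightarrow> 'm path" where
  "approx_path \<delta> \<omega> t = (1 / \<delta>) *\<^sub>R (LBINT r=0..t. \<omega> (\<delta> + r) - \<omega> r)"

definition tensor :: "real ^ 'm \<Rightarrow> real ^ 'm \<Rightarrow> real ^ 'm ^ 'm" where
  "tensor u v = (\<chi> i j. u $ i * v $ j)"

definition approx_area :: "real \<Rightarrow> 'm::finite path \<Rightarrow> 'm area" where
  "approx_area \<delta> \<omega> s t =
     (LBINT r=s..t. tensor (approx_path \<delta> \<omega> r - approx_path \<delta> \<omega> s)
                           (vector_derivative (approx_path \<delta> \<omega>) (at r)))"

section \<open>The Levy area\<close>

definition partition_of :: "real \<Rightarrow> real \<Rightarrow> nat \<Rightarrow> (nat \<Rightarrow> real) \<Rightarrow> bool" where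
  "partition_of s t n \<pi> \<longleftrightarrow> \<pi> 0 = s \<and> \<pi> n = t \<and> (\<forall>k<n. \<pi> k \<le> \<pi> (Suc k))"

definition stieltjes_sum :: "nat \<Rightarrow> (nat \<Rightarrow> real) \<Rightarrow> (real \<Rightarrow> real) \<Rightarrow> (real \<Rightarrow> real) \<Rightarrow> real" where
  "stieltjes_sum n \<pi> x y = (\<Sum>k<n. (x (\<pi> k) - x (\<pi> 0)) * (y (\<pi> (Suc k)) - y (\<pi> k)))"

text \<open>\<open>X\<close> is the limit in \<open>L\<^sub>2\<close> of the Stieltjes sums for \<open>\<integral>(\<omega>\<^sup>i(r) - \<omega>\<^sup>i(s)) d\<omega>\<^sup>j(r)\<close> over \<open>[s, t]\<close>
  as the mesh of the partition tends to zero.\<close>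

definition L2_stieltjes_limit ::
    "'m::finite path measure \<Rightarrow> real \<Rightarrow> real \<Rightarrow> 'm \<Rightarrow> 'm \<Rightarrow> ('m path \<Rightarrow> real) \<Rightarrow> bool" where
  "L2_stieltjes_limit P s t i j X \<longleftrightarrow>
     (\<forall>\<epsilon>>0. \<exists>\<eta>>0. \<forall>n \<pi>. partition_of s t n \<pi> \<and> (\<forall>k<n. \<pi> (Suc k) - \<pi> k < \<eta>) \<longrightarrow>
        (\<integral>\<^sup>+\<omega>. ennreal ((stieltjes_sum n \<pi> (\<lambda>r. \<omega> r $ i) (\<lambda>r. \<omega> r $ j) - X \<omega>)\<^sup>2) \<partial>P) < ennreal \<epsilon>)"

text \<open>A family of random variables \<open>A \<omega> s t\<close> representing the area, each of which is determined
  up to a null set depending on \<open>s\<close> and \<open>t\<close>.\<close>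

definition levy_area ::
    "('m::{finite,linorder}) path measure \<Rightarrow> ('m path \<Rightarrow> 'm area) \<Rightarrow> bool" where
  "levy_area P A \<longleftrightarrow>
     (\<forall>s t. s \<le> t \<longrightarrow> (\<lambda>\<omega>. A \<omega> s t) \<in> borel_measurable P) \<and>
     (\<forall>s t. s \<le> t \<and> (0 \<le> s \<or> t \<le> 0) \<longrightarrow>
        (\<forall>i j. i < j \<longrightarrow> L2_stieltjes_limit P s t i j (\<lambda>\<omega>. A \<omega> s t $ i $ j)) \<and>
        (\<forall>i. AE \<omega> in P. A \<omega> s t $ i $ i = 1/2 * (\<omega> t $ i - \<omega> s $ i)\<^sup>2) \<and>
        (\<forall>i j. i < j \<longrightarrow> (AE \<omega> in P.
           A \<omega> s t $ j $ i = - A \<omega> s t $ i $ j + (\<omega> t $ i - \<omega> s $ i) * (\<omega> t $ j - \<omega> s $ j)))) \<and>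
     (\<forall>s t. s < 0 \<and> 0 < t \<longrightarrow> (\<forall>i j. AE \<omega> in P.
        A \<omega> s t $ i $ j = A \<omega> s 0 $ i $ j + A \<omega> 0 t $ i $ j - \<omega> s $ i * \<omega> t $ j))"

text \<open>Indistinguishability is required with respect to every version of the area with almost surely
  continuous sample paths.\<close>

definition indistinguishable_area ::
    "('m::{finite,linorder}) path measure \<Rightarrow> ('m path \<Rightarrow> 'm area) \<Rightarrow> bool" where
  "indistinguishable_area P V \<longleftrightarrow>
     levy_area P V \<and>
     (\<forall>A. levy_area P A \<and>
          (AE \<omega> in P. continuous_on {(s, t). s \<le> t} (\<lambda>(s, t). A \<omega> s t)) \<longrightarrow>
          (AE \<omega> in P. \<forall>s t. s \<le> t \<longrightarrow> V \<omega> s t = A \<omega> s t))"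

section \<open>The version of path and area\<close>

definition path_version :: "'m::finite path set \<Rightarrow> 'm path \<Rightarrow> 'm path" where
  "path_version \<Omega>' \<omega> = (if \<omega> \<in> \<Omega>' then \<omega> else (\<lambda>_. 0))"

definition area_version ::
    "(nat \<Rightarrow> real) \<Rightarrow> 'm::finite path set \<Rightarrow> 'm path \<Rightarrow> 'm area" where
  "area_version \<delta> \<Omega>' \<omega> s t = (if \<omega> \<in> \<Omega>' then lim (\<lambda>i. approx_area (\<delta> i) \<omega> s t) else 0)"

text \<open>Let \<open>D\<^sub>\<delta>\<close> be the rough path distance between \<open>(\<omega>\<^sub>\<delta>, \<bbbW>\<^sub>\<delta>)\<close> and \<open>(\<omega>, \<bbbW>)\<close> on \<open>[-n, n]\<close>. Its moments
  satisfy \<open>c\<^sub>p \<delta>\<^bsup>p/2\<^esup> \<le> E D\<^sub>\<delta>\<^bsup>p\<^esup> \<le> C\<^sub>p \<delta>\<^bsup>\<kappa>p\<^esup>\<close> for all large \<open>p\<close>, where \<open>\<kappa> > 0\<close> depends on \<open>\<beta>\<close> only. Hence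
  \<open>\<Sum>\<^sub>i E D\<^bsub>\<delta> i\<^esub>\<^bsup>p\<^esup> < \<infinity>\<close> for some \<open>p\<close>, which is what the Borel-Cantelli argument based on Chebyshev's
  inequality needs, if and only if some power of \<open>\<delta>\<close> is summable.\<close>

definition sufficiently_fast :: "(nat \<Rightarrow> real) \<Rightarrow> bool" where
  "sufficiently_fast \<delta> \<longleftrightarrow> \<delta> \<longlonglongrightarrow> 0 \<and> (\<exists>q>0. summable (\<lambda>i. \<delta> i powr q))"

lemma sufficiently_fast_dyadic: "sufficiently_fast (\<lambda>i. 1 / 2 ^ i)"
proof -
  have 1: "summable (\<lambda>i. (1 / 2 :: real) ^ i)" by (rule summable_geometric) simp
  then have "summable (\<lambda>i. (1 / 2 ^ i :: real) powr 1)" by (simp add: power_one_over)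
  moreover have "(\<lambda>i. 1 / 2 ^ i :: real) \<longlonglongrightarrow> 0"
    using summable_LIMSEQ_zero[OF 1] by (simp add: power_one_over)
  ultimately show ?thesis unfolding sufficiently_fast_def by (intro conjI exI[of _ 1]) auto
qed

end

theory Submission
  imports Defs
begin

text \<open>
  The paths converge by interpolation: \<open>\<omega>\<^sub>\<delta> - \<omega>\<close> is of order \<open>\<delta>\<^sup>\<gamma>\<close> in the supremum norm and bounded in
  \<open>C\<^sup>\<gamma>\<close> for \<open>\<gamma> < 1/2\<close>. The symmetric part of the area is a function of the increments. Off the diagonal,
  \<open>\<omega>\<^sup>i\<close> and \<open>\<omega>\<^sup>j\<close> are independent: on the event that \<open>\<omega>\<^sup>i\<close> is \<open>\<gamma>\<close>-Hoelder with constant \<open>K\<close>, the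
  difference between \<open>\<bbbW>\<^sub>\<delta>(s, t)\<close> and a Stieltjes sum of mesh \<open>\<delta> \<le> t - s\<close> is, given \<open>\<omega>\<^sup>i\<close>, Gaussian with
  variance at most \<open>80 K\<^sup>2 \<delta>\<^bsup>2\<gamma>\<^esup> (t - s)\<close>. So all its moments are small, and a union bound over a grid whose
  mesh is a power of \<open>\<delta>\<close> bounds the distance between the areas at two comparable scales with
  probability \<open>1 - O(\<delta>\<^sup>q)\<close> for every \<open>q\<close>; between points of the grid the areas are controlled
  deterministically by Hoelder continuity. Borel-Cantelli along the dyadic scales, and along the given
  scales compared with the nearest dyadic ones, gives the Cauchy property almost surely. The same
  variance bound identifies the limit with the \<open>L\<^sub>2\<close> limit of the Stieltjes sums.
\<close>

section \<open>Means, areas and Stieltjes sums of bounded paths\<close>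

text \<open>The obstacle is to use the conditional Gaussian law of an area without a stochastic
  integral. Sampling the paths on a grid of mesh \<open>1 / N\<close> turns every area and every
  Stieltjes sum into a finite bilinear form in independent Gaussian increments. Its coefficients
  come from inserting the unit jump \<open>step u\<close> for the second path, so the conditional
  variance is a Riemann sum of squared responses to a jump, and bounding it is a question about one
  Hoelder path. The bound is uniform in \<open>N\<close> once \<open>1 / N \<le> \<delta>\<close>,
  and Fatou's lemma returns to the continuous paths. Continuous and sampled paths thus pass through
  the same integrals, which is why the class \<open>loc_bdd_meas\<close> is used. The truncation to
  Hoelder paths must leave the second component Gaussian, so it is expressed by the grid increments
  of the first one alone. Exponents stay at least 1/4 for two reasons: over a time
  \<open>\<delta> ^ 8\<close> a path then moves by at most the order \<open>\<delta> ^ 2\<close>,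
  and \<open>1 - 4 * \<beta> \<le> 0\<close> makes pairs of times at distance
  \<open>\<delta>\<close> the worst case of the tail bound.\<close>

definition loc_bdd_meas :: "(real \<Rightarrow> real) \<Rightarrow> bool" where
  "loc_bdd_meas f \<longleftrightarrow> f \<in> borel_measurable borel \<and> (\<forall>R. \<exists>B. \<forall>r. \<bar>r\<bar> \<le> R \<longrightarrow> \<bar>f r\<bar> \<le> B)"

text \<open>The jump is taken on the right: the path already has the value 1 at \<open>u\<close>.
  This fixes which half-open intervals occur below.\<close>

definition step :: "real \<Rightarrow> real \<Rightarrow> real" where
  "step u r = (if u \<le> r then 1 else 0)"

definition mean :: "real \<Rightarrow> (real \<Rightarrow> real) \<Rightarrow> real \<Rightarrow> real" where
  "mean \<delta> x r = (LBINT v:{0..\<delta>}. x (r + v)) / \<delta>"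

text \<open>An off-diagonal or diagonal entry of \<open>approx_area\<close>, with the derivative of
  the second mean already inserted. It depends linearly on each of the two paths.\<close>

definition smooth_area :: "real \<Rightarrow> (real \<Rightarrow> real) \<Rightarrow> (real \<Rightarrow> real) \<Rightarrow> real \<Rightarrow> real \<Rightarrow> real" where
  "smooth_area \<delta> x y s t = (LBINT r:{s..t}. (mean \<delta> x r - mean \<delta> x s) * ((y (r + \<delta>) - y r) / \<delta>))"

lemma loc_bdd_measD[measurable_dest]: "loc_bdd_meas f \<Longrightarrow> f \<in> borel_measurable borel"
  by (simp add: loc_bdd_meas_def)

lemma loc_bdd_meas_bound:
  assumes "loc_bdd_meas f" obtains B where "0 \<le> B" "\<And>r. \<bar>r\<bar> \<le> R \<Longrightarrow> \<bar>f r\<bar> \<le> B"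
proof -
  obtain B where "\<forall>r. \<bar>r\<bar> \<le> R \<longrightarrow> \<bar>f r\<bar> \<le> B"
    using assms unfolding loc_bdd_meas_def by blast
  then show ?thesis by (intro that[of "max 0 B"]) fastforce+
qed

lemma loc_bdd_measI:
  assumes "f \<in> borel_measurable borel" "\<And>R. \<exists>B. \<forall>r. \<bar>r\<bar> \<le> R \<longrightarrow> \<bar>f r\<bar> \<le> B"
  shows "loc_bdd_meas f"
  using assms unfolding loc_bdd_meas_def by blast

lemma loc_bdd_meas_const[simp, intro]: "loc_bdd_meas (\<lambda>_. c)"
  by (rule loc_bdd_measI) auto

lemma loc_bdd_meas_step[simp, intro]: "loc_bdd_meas (step u)"
proof (rule loc_bdd_measI)
  show "step u \<in> borel_measurable borel" unfolding step_def by measurable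
  show "\<exists>B. \<forall>r. \<bar>r\<bar> \<le> R \<longrightarrow> \<bar>step u r\<bar> \<le> B" for R
    by (rule exI[of _ 1]) (auto simp: step_def)
qed

lemma loc_bdd_meas_add[intro]:
  assumes "loc_bdd_meas f" "loc_bdd_meas g" shows "loc_bdd_meas (\<lambda>r. f r + g r)"
proof (rule loc_bdd_measI)
  show "(\<lambda>r. f r + g r) \<in> borel_measurable borel" using assms by measurable
  fix R
  obtain A B where "\<And>r. \<bar>r\<bar> \<le> R \<Longrightarrow> \<bar>f r\<bar> \<le> A" "\<And>r. \<bar>r\<bar> \<le> R \<Longrightarrow> \<bar>g r\<bar> \<le> B"
    using loc_bdd_meas_bound assms by metis
  then show "\<exists>B. \<forall>r. \<bar>r\<bar> \<le> R \<longrightarrow> \<bar>f r + g r\<bar> \<le> B"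
    by (intro exI[of _ "A + B"]) (meson abs_triangle_ineq add_mono order_trans)
qed

lemma loc_bdd_meas_mult[intro]:
  assumes "loc_bdd_meas f" "loc_bdd_meas g" shows "loc_bdd_meas (\<lambda>r. f r * g r)"
proof (rule loc_bdd_measI)
  show "(\<lambda>r. f r * g r) \<in> borel_measurable borel" using assms by measurable
  fix R
  obtain A B where "\<And>r. \<bar>r\<bar> \<le> R \<Longrightarrow> \<bar>f r\<bar> \<le> A" "\<And>r. \<bar>r\<bar> \<le> R \<Longrightarrow> \<bar>g r\<bar> \<le> B" "0 \<le> A"
    using loc_bdd_meas_bound assms by metis
  then show "\<exists>B. \<forall>r. \<bar>r\<bar> \<le> R \<longrightarrow> \<bar>f r * g r\<bar> \<le> B"
    by (intro exI[of _ "A * B"]) (auto simp: abs_mult intro!: mult_mono)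
qed

lemma loc_bdd_meas_diff[intro]: "loc_bdd_meas f \<Longrightarrow> loc_bdd_meas g \<Longrightarrow> loc_bdd_meas (\<lambda>r. f r - g r)"
  using loc_bdd_meas_add[of f "\<lambda>r. -1 * g r"] loc_bdd_meas_mult[of "\<lambda>_. -1" g] by simp

lemma loc_bdd_meas_divide[intro]: "loc_bdd_meas f \<Longrightarrow> loc_bdd_meas (\<lambda>r. f r / c)"
  using loc_bdd_meas_mult[of f "\<lambda>r. 1 / c"] by auto

lemma loc_bdd_meas_sum[intro]: "(\<And>k. k \<in> A \<Longrightarrow> loc_bdd_meas (f k)) \<Longrightarrow> loc_bdd_meas (\<lambda>r. \<Sum>k\<in>A. f k r)"
  by (induction A rule: infinite_finite_induct) auto

lemma loc_bdd_meas_shift: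
  assumes "loc_bdd_meas f" shows "loc_bdd_meas (\<lambda>r. f (r + c))"
proof (rule loc_bdd_measI)
  have [measurable]: "f \<in> borel_measurable borel" using assms by (rule loc_bdd_measD)
  show "(\<lambda>r. f (r + c)) \<in> borel_measurable borel" by measurable
  fix R
  obtain B where "\<And>r. \<bar>r\<bar> \<le> R + \<bar>c\<bar> \<Longrightarrow> \<bar>f r\<bar> \<le> B"
    using loc_bdd_meas_bound assms by metis
  then show "\<exists>B. \<forall>r. \<bar>r\<bar> \<le> R \<longrightarrow> \<bar>f (r + c)\<bar> \<le> B"
    by (intro exI[of _ B]) (auto intro: order_trans[OF abs_triangle_ineq])
qed

lemma loc_bdd_meas_shift': "loc_bdd_meas f \<Longrightarrow> loc_bdd_meas (\<lambda>r. f (c + r))"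
  using loc_bdd_meas_shift[of f c] by (simp add: add.commute)

lemma loc_bdd_meas_continuous:
  assumes "continuous_on UNIV f" shows "loc_bdd_meas f"
proof (rule loc_bdd_measI)
  show "f \<in> borel_measurable borel" using assms by (rule borel_measurable_continuous_onI)
  fix R :: real
  have "bounded (f ` {-R..R})"
    by (intro compact_imp_bounded compact_continuous_image continuous_on_subset[OF assms]) auto
  then obtain B where "\<forall>r\<in>{-R..R}. \<bar>f r\<bar> \<le> B" by (auto simp: bounded_iff)
  then show "\<exists>B. \<forall>r. \<bar>r\<bar> \<le> R \<longrightarrow> \<bar>f r\<bar> \<le> B" by (intro exI[of _ B]) (simp add: abs_le_iff)
qed

lemma loc_bdd_meas_integrable[intro]:
  assumes "loc_bdd_meas f" shows "set_integrable lborel {a..b} f"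
proof -
  obtain B where B: "\<And>r. \<bar>r\<bar> \<le> \<bar>a\<bar> + \<bar>b\<bar> \<Longrightarrow> \<bar>f r\<bar> \<le> B" using loc_bdd_meas_bound assms by metis
  have "integrable lborel (\<lambda>r. indicator {a..b} r *\<^sub>R f r)"
  proof (rule integrableI_bounded_set_indicator[where B=B])
    show "emeasure lborel {a..b} < \<infinity>" by (simp add: emeasure_lborel_Icc_eq)
    show "AE x in lborel. x \<in> {a..b} \<longrightarrow> norm (f x) \<le> B"
      using B by (intro AE_I2 impI) (force intro!: B)
  qed (use assms in measurable)
  then show ?thesis by (simp add: set_integrable_def)
qed

text \<open>The window \<open>{c..d}\<close> may protrude from \<open>{a..b}\<close>; the bound uses
  only its length. This suits integrands supported on the window of a jump near an end of the
  interval.\<close>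

lemma integral_bound_sub:
  fixes f :: "real \<Rightarrow> real"
  assumes f: "loc_bdd_meas f" and cd: "c \<le> d"
    and B: "\<And>r. r \<in> {a..b} \<Longrightarrow> \<bar>f r\<bar> \<le> B * indicator {c..d} r" and "0 \<le> B"
  shows "\<bar>LBINT r:{a..b}. f r\<bar> \<le> B * (d - c)"
proof -
  have "\<bar>LBINT r:{a..b}. f r\<bar> \<le> (LBINT r. B * indicator {c..d} r)"
    unfolding set_lebesgue_integral_def
  proof (rule integral_abs_bound_integral)
    show "integrable lborel (\<lambda>r. indicator {a..b} r *\<^sub>R f r)"
      using loc_bdd_meas_integrable[OF f] by (simp add: set_integrable_def)
    show "integrable lborel (\<lambda>r. B * indicator {c..d} r)"
      by (intro integrable_mult_right integrable_real_indicator) (simp_all add: emeasure_lborel_Icc_eq)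
    show "\<bar>indicator {a..b} r *\<^sub>R f r\<bar> \<le> B * indicator {c..d} r" for r
      using B[of r] \<open>0 \<le> B\<close> by (auto split: split_indicator)
  qed
  also have "\<dots> = B * (d - c)" using cd by simp
  finally show ?thesis .
qed

lemma integral_bound:
  fixes f :: "real \<Rightarrow> real"
  assumes "loc_bdd_meas f" "a \<le> b" "\<And>r. r \<in> {a..b} \<Longrightarrow> \<bar>f r\<bar> \<le> B"
  shows "\<bar>LBINT r:{a..b}. f r\<bar> \<le> B * (b - a)"
proof (rule integral_bound_sub)
  show "0 \<le> B" using assms(3)[of a] assms(2) by force
qed (use assms in auto)

lemma loc_bdd_meas_mean[intro]:
  assumes x: "loc_bdd_meas x" shows "loc_bdd_meas (mean \<delta> x)"
proof (rule loc_bdd_measI)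
  have [measurable]: "x \<in> borel_measurable borel" using x by (rule loc_bdd_measD)
  have [measurable]: "(\<lambda>z. x (fst z + snd z)) \<in> borel_measurable (borel \<Otimes>\<^sub>M borel)" by measurable
  show "mean \<delta> x \<in> borel_measurable borel"
    unfolding mean_def[abs_def] set_lebesgue_integral_def by measurable
  fix R
  obtain B where B: "0 \<le> B" "\<And>r. \<bar>r\<bar> \<le> \<bar>R\<bar> + \<bar>\<delta>\<bar> \<Longrightarrow> \<bar>x r\<bar> \<le> B" using loc_bdd_meas_bound x by metis
  have "\<bar>mean \<delta> x r\<bar> \<le> B" if r: "\<bar>r\<bar> \<le> R" for r
  proof (cases "0 < \<delta>")
    case True
    have "\<bar>LBINT v:{0..\<delta>}. x (r + v)\<bar> \<le> B * (\<delta> - 0)"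
      by (rule integral_bound) (use r True in \<open>auto intro!: B loc_bdd_meas_shift'[OF x]\<close>)
    then show ?thesis using True by (simp add: mean_def field_simps)
  next
    case False
    \<comment> \<open>For negative \<open>\<delta>\<close> the interval is empty, and for
      \<open>\<delta> = 0\<close> the division by zero yields \<open>0\<close>, so the bound holds
      for every \<open>\<delta>\<close>.\<close>
    then have "(LBINT v:{0..\<delta>}. x (r + v)) / \<delta> = 0"
    proof (cases "\<delta> = 0")
      case False
      with \<open>\<not> 0 < \<delta>\<close> have "{0..\<delta>} = {}" by auto
      then show ?thesis by (simp add: set_lebesgue_integral_def)
    qed simp
    then show ?thesis unfolding mean_def using B(1) by (metis abs_zero)
  qed
  then show "\<exists>B. \<forall>r. \<bar>r\<bar> \<le> R \<longrightarrow> \<bar>mean \<delta> x r\<bar> \<le> B" by blast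
qed

lemma set_integral_sum:
  fixes f :: "'k \<Rightarrow> real \<Rightarrow> real"
  assumes "\<And>k. k \<in> A \<Longrightarrow> set_integrable lborel S (f k)"
  shows "(LBINT r:S. (\<Sum>k\<in>A. f k r)) = (\<Sum>k\<in>A. LBINT r:S. f k r)"
  using assms unfolding set_lebesgue_integral_def set_integrable_def
  by (simp add: sum_distrib_left)

lemma mean_add_const:
  assumes "loc_bdd_meas x" "0 < \<delta>" shows "mean \<delta> (\<lambda>r. c + x r) r = c + mean \<delta> x r"
proof -
  have "(LBINT v:{0..\<delta>}. c + x (r + v)) = (LBINT v:{0..\<delta>}. c) + (LBINT v:{0..\<delta>}. x (r + v))"
    by (intro set_integral_add loc_bdd_meas_integrable loc_bdd_meas_const loc_bdd_meas_shift'[OF assms(1)])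
  also have "(LBINT v:{0..\<delta>}. c) = c * \<delta>" using assms by (simp add: set_lebesgue_integral_def)
  finally show ?thesis using assms by (simp add: mean_def add_divide_distrib)
qed

lemma mean_sum:
  assumes "\<And>k. k \<in> A \<Longrightarrow> loc_bdd_meas (x k)"
  shows "mean \<delta> (\<lambda>r. \<Sum>k\<in>A. b k * x k r) r = (\<Sum>k\<in>A. b k * mean \<delta> (x k) r)"
proof -
  have "(LBINT v:{0..\<delta>}. (\<Sum>k\<in>A. b k * x k (r + v))) = (\<Sum>k\<in>A. LBINT v:{0..\<delta>}. b k * x k (r + v))"
    by (intro set_integral_sum loc_bdd_meas_integrable loc_bdd_meas_mult loc_bdd_meas_const loc_bdd_meas_shift'[OF assms])
  then show ?thesis by (simp add: mean_def sum_divide_distrib)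
qed

lemma loc_bdd_meas_smooth_area_integrand[intro]:
  assumes "loc_bdd_meas x" "loc_bdd_meas y"
  shows "loc_bdd_meas (\<lambda>r. (mean \<delta> x r - mean \<delta> x s) * ((y (r + \<delta>) - y r) / \<delta>))"
  by (intro loc_bdd_meas_mult loc_bdd_meas_diff loc_bdd_meas_divide loc_bdd_meas_mean loc_bdd_meas_const loc_bdd_meas_shift[OF assms(2)] assms)

text \<open>Sampled paths are a constant plus a combination of jumps. The constant disappears
  because only increments of the second path enter.\<close>

lemma smooth_area_sum_right:
  assumes "loc_bdd_meas x" "\<And>k. k \<in> A \<Longrightarrow> loc_bdd_meas (y k)"
  shows "smooth_area \<delta> x (\<lambda>r. c + (\<Sum>k\<in>A. b k * y k r)) s t = (\<Sum>k\<in>A. b k * smooth_area \<delta> x (y k) s t)"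
proof -
  have "smooth_area \<delta> x (\<lambda>r. c + (\<Sum>k\<in>A. b k * y k r)) s t =
     (LBINT r:{s..t}. (\<Sum>k\<in>A. b k * ((mean \<delta> x r - mean \<delta> x s) * ((y k (r + \<delta>) - y k r) / \<delta>))))"
    unfolding smooth_area_def
    by (intro set_lebesgue_integral_cong)
       (auto simp: sum_distrib_left sum_divide_distrib sum_subtractf[symmetric] algebra_simps diff_divide_distrib)
  also have "\<dots> = (\<Sum>k\<in>A. LBINT r:{s..t}. b k * ((mean \<delta> x r - mean \<delta> x s) * ((y k (r + \<delta>) - y k r) / \<delta>)))"
    by (intro set_integral_sum loc_bdd_meas_integrable loc_bdd_meas_mult loc_bdd_meas_smooth_area_integrand) (use assms in auto)
  finally show ?thesis by (simp add: smooth_area_def)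
qed

text \<open>The constant now disappears through
  \<open>mean \<delta> x r - mean \<delta> x s\<close>; for this the mean of a constant must be that
  constant, whence \<open>0 < \<delta>\<close>.\<close>

lemma smooth_area_sum_left:
  assumes "loc_bdd_meas y" "\<And>k. k \<in> A \<Longrightarrow> loc_bdd_meas (x k)" "0 < \<delta>"
  shows "smooth_area \<delta> (\<lambda>r. c + (\<Sum>k\<in>A. b k * x k r)) y s t = (\<Sum>k\<in>A. b k * smooth_area \<delta> (x k) y s t)"
proof -
  have m: "mean \<delta> (\<lambda>r. c + (\<Sum>k\<in>A. b k * x k r)) r = c + (\<Sum>k\<in>A. b k * mean \<delta> (x k) r)" for r
    by (subst mean_add_const) (use assms in \<open>auto simp: mean_sum intro!: loc_bdd_meas_sum\<close>)
  have d: "(c + (\<Sum>k\<in>A. b k * mean \<delta> (x k) r) - (c + (\<Sum>k\<in>A. b k * mean \<delta> (x k) s))) * z =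
      (\<Sum>k\<in>A. b k * ((mean \<delta> (x k) r - mean \<delta> (x k) s) * z))" for r z
    by (simp add: sum_distrib_right right_diff_distrib left_diff_distrib mult.assoc sum_subtractf)
  have "smooth_area \<delta> (\<lambda>r. c + (\<Sum>k\<in>A. b k * x k r)) y s t =
     (LBINT r:{s..t}. (\<Sum>k\<in>A. b k * ((mean \<delta> (x k) r - mean \<delta> (x k) s) * ((y (r + \<delta>) - y r) / \<delta>))))"
    unfolding smooth_area_def m d ..
  also have "\<dots> = (\<Sum>k\<in>A. LBINT r:{s..t}. b k * ((mean \<delta> (x k) r - mean \<delta> (x k) s) * ((y (r + \<delta>) - y r) / \<delta>)))"
    by (intro set_integral_sum loc_bdd_meas_integrable loc_bdd_meas_mult loc_bdd_meas_smooth_area_integrand) (use assms in auto)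
  finally show ?thesis by (simp add: smooth_area_def)
qed


text \<open>The slack \<open>\<eta>\<close> admits step paths, which are Hoelder continuous only above the mesh of their grid.\<close>

definition hoelder_up_to :: "real \<Rightarrow> real \<Rightarrow> real \<Rightarrow> real \<Rightarrow> (real \<Rightarrow> real) \<Rightarrow> bool" where
  "hoelder_up_to \<eta> R \<gamma> K x \<longleftrightarrow>
     (\<forall>a b. \<bar>a\<bar> \<le> R \<longrightarrow> \<bar>b\<bar> \<le> R \<longrightarrow> \<bar>x a - x b\<bar> \<le> K * (\<bar>a - b\<bar> + \<eta>) powr \<gamma>)"

lemma hoelder_up_toD:
  assumes "hoelder_up_to \<eta> R \<gamma> K x" "\<bar>a\<bar> \<le> R" "\<bar>b\<bar> \<le> R" "\<bar>a - b\<bar> + \<eta> \<le> e" "0 \<le> \<eta>" "0 \<le> K" "0 \<le> \<gamma>"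
  shows "\<bar>x a - x b\<bar> \<le> K * e powr \<gamma>"
proof -
  have "\<bar>x a - x b\<bar> \<le> K * (\<bar>a - b\<bar> + \<eta>) powr \<gamma>" using assms unfolding hoelder_up_to_def by blast
  also have "\<dots> \<le> K * e powr \<gamma>" using assms by (intro mult_left_mono powr_mono2) auto
  finally show ?thesis .
qed

section \<open>Hoelder estimates for means and the response of the area to a unit jump\<close>

lemma mean_diff_le:
  assumes "loc_bdd_meas x" "loc_bdd_meas y" "0 < \<delta>"
    and "\<And>v. 0 \<le> v \<Longrightarrow> v \<le> \<delta> \<Longrightarrow> \<bar>x (r + v) - y (s + v)\<bar> \<le> B"
  shows "\<bar>mean \<delta> x r - mean \<delta> y s\<bar> \<le> B"
proof -
  have "mean \<delta> x r - mean \<delta> y s = (LBINT v:{0..\<delta>}. x (r + v) - y (s + v)) / \<delta>"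
    unfolding mean_def diff_divide_distrib[symmetric]
    by (subst set_integral_diff) (auto intro!: loc_bdd_meas_integrable loc_bdd_meas_shift'[OF assms(1)] loc_bdd_meas_shift'[OF assms(2)])
  moreover have "\<bar>LBINT v:{0..\<delta>}. x (r + v) - y (s + v)\<bar> \<le> B * (\<delta> - 0)"
    by (rule integral_bound[OF loc_bdd_meas_diff[OF loc_bdd_meas_shift'[OF assms(1)] loc_bdd_meas_shift'[OF assms(2)]]]) (use assms in auto)
  ultimately show ?thesis using assms(3) by (simp add: pos_divide_le_eq)
qed

lemma mean_const: "0 < \<delta> \<Longrightarrow> mean \<delta> (\<lambda>_. c) r = c"
  by (simp add: mean_def set_lebesgue_integral_def)

lemma mean_minus_le:
  assumes "loc_bdd_meas x" "0 < \<delta>" "\<And>v. 0 \<le> v \<Longrightarrow> v \<le> \<delta> \<Longrightarrow> \<bar>x (r + v) - c\<bar> \<le> B"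
  shows "\<bar>mean \<delta> x r - c\<bar> \<le> B"
  using mean_diff_le[of x "\<lambda>_. c" \<delta> r 0 B] assms mean_const[of \<delta> c 0] by auto

lemma mean_incr_le:
  assumes "loc_bdd_meas x" "0 < \<delta>" "hoelder_up_to \<eta> R \<gamma> K x" "0 \<le> \<eta>" "0 \<le> K" "0 \<le> \<gamma>"
    and "\<bar>r\<bar> + \<delta> \<le> R" "\<bar>s\<bar> + \<delta> \<le> R" "\<bar>r - s\<bar> + \<eta> \<le> e"
  shows "\<bar>mean \<delta> x r - mean \<delta> x s\<bar> \<le> K * e powr \<gamma>"
  by (rule mean_diff_le) (use assms in \<open>auto intro!: hoelder_up_toD[OF assms(3)]\<close>)

text \<open>The averaging window \<open>[r, r + \<delta>]\<close> contains \<open>u\<close>, so all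
  averaged values lie within time \<open>\<delta>\<close> of it.\<close>

lemma mean_near_le:
  assumes "loc_bdd_meas x" "0 < \<delta>" "hoelder_up_to \<eta> R \<gamma> K x" "0 \<le> \<eta>" "0 \<le> K" "0 \<le> \<gamma>"
    and "\<bar>r\<bar> + \<delta> \<le> R" "\<bar>u\<bar> \<le> R" "u - \<delta> \<le> r" "r \<le> u" "\<delta> + \<eta> \<le> e"
  shows "\<bar>mean \<delta> x r - x u\<bar> \<le> K * e powr \<gamma>"
  by (rule mean_minus_le) (use assms in \<open>auto intro!: hoelder_up_toD[OF assms(3)]\<close>)

lemma step_diff: "0 \<le> \<delta> \<Longrightarrow> step u (r + \<delta>) - step u r = (if u - \<delta> \<le> r \<and> r < u then 1 else 0)"
  by (auto simp: step_def)

lemma kernel_zero: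
  assumes "0 < \<delta>" "u \<le> s \<or> t + \<delta> < u"
  shows "smooth_area \<delta> x (step u) s t = 0"
proof -
  have "smooth_area \<delta> x (step u) s t = (LBINT r:{s..t}. 0)"
    unfolding smooth_area_def by (intro set_lebesgue_integral_cong) (use assms in \<open>auto simp: step_diff\<close>)
  then show ?thesis by simp
qed

text \<open>Against a jump at \<open>u\<close> the area is \<open>1 / \<delta>\<close> times the
  integral of the mean increments over the part of the window \<open>[u - \<delta>, u)\<close>
  inside \<open>[s, t]\<close>; the total weight is at most 1.\<close>

lemma kernel_bound:
  assumes "loc_bdd_meas x" "0 < \<delta>" "0 \<le> B"
    and "\<And>r. s \<le> r \<Longrightarrow> r \<le> t \<Longrightarrow> u - \<delta> \<le> r \<Longrightarrow> r < u \<Longrightarrow> \<bar>mean \<delta> x r - mean \<delta> x s\<bar> \<le> B"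
  shows "\<bar>smooth_area \<delta> x (step u) s t\<bar> \<le> B"
proof -
  have "\<bar>smooth_area \<delta> x (step u) s t\<bar> \<le> (B / \<delta>) * (u - (u - \<delta>))"
    unfolding smooth_area_def
  proof (rule integral_bound_sub)
    fix r assume r: "r \<in> {s..t}"
    show "\<bar>(mean \<delta> x r - mean \<delta> x s) * ((step u (r + \<delta>) - step u r) / \<delta>)\<bar> \<le> B / \<delta> * indicator {u - \<delta>..u} r"
      using r assms by (auto simp: step_diff abs_mult divide_right_mono split: split_indicator)
  next
    show "loc_bdd_meas (\<lambda>r. (mean \<delta> x r - mean \<delta> x s) * ((step u (r + \<delta>) - step u r) / \<delta>))"
      by (intro loc_bdd_meas_smooth_area_integrand loc_bdd_meas_step assms)
  qed (use assms in simp_all)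
  then show ?thesis using assms by simp
qed

text \<open>A jump at \<open>u\<close> ought to be weighted by \<open>x u - x s\<close>, as in a
  Stieltjes integral. The smoothing replaces both values by averages over times at most
  \<open>\<delta>\<close> away, and the slack \<open>\<eta> \<le> \<delta>\<close> enlarges this
  distance to \<open>2 * \<delta>\<close>. Two such errors with
  \<open>2 powr \<gamma> \<le> 2\<close> give the factor 4.\<close>

lemma kernel_near:
  assumes "loc_bdd_meas x" "0 < \<delta>" "\<delta> \<le> 1" "hoelder_up_to \<eta> R \<gamma> K x" "0 \<le> \<eta>" "\<eta> \<le> \<delta>" "0 \<le> K"
    and g: "0 \<le> \<gamma>" "\<gamma> \<le> 1" and sT: "\<bar>s\<bar> \<le> T" "\<bar>t\<bar> \<le> T" "T + 2 \<le> R" and u: "s < u" "u \<le> t"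
  shows "\<bar>smooth_area \<delta> x (step u) s t - (x u - x s)\<bar> \<le> 4 * K * \<delta> powr \<gamma>"
proof -
  have T: "\<bar>r\<bar> \<le> T" if "s \<le> r" "r \<le> t" for r using that sT by linarith
  have R: "\<bar>r\<bar> + \<delta> \<le> R" if "\<bar>r\<bar> \<le> T" for r using that sT assms(3) by linarith
  have "\<bar>u\<bar> \<le> T" using u T by simp
  then have uR: "\<bar>u\<bar> \<le> R" "\<bar>s\<bar> \<le> R" using sT by linarith+
  have "(2 * \<delta>) powr \<gamma> = 2 powr \<gamma> * \<delta> powr \<gamma>" using assms by (simp add: powr_mult)
  also have "\<dots> \<le> 2 powr 1 * \<delta> powr \<gamma>" using g by (intro mult_right_mono powr_mono) auto
  finally have two: "(2 * \<delta>) powr \<gamma> \<le> 2 * \<delta> powr \<gamma>" by simp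
  have "\<bar>smooth_area \<delta> x (step u) s t - (x u - x s)\<bar> \<le> K * (2 * \<delta>) powr \<gamma> + K * (2 * \<delta>) powr \<gamma>"
  \<comment> \<open>If \<open>s + \<delta> \<le> u\<close>, the window of the jump lies inside
    \<open>[s, t]\<close> and the kernel is a full average. Otherwise the window is cut at
    \<open>s\<close>, but then \<open>u - s < \<delta>\<close> and the kernel and
    \<open>x u - x s\<close> are each small.\<close>
  proof (cases "s + \<delta> \<le> u")
    case True
    define c where "c = x u - x s"
    have 1: "\<bar>(mean \<delta> x r - mean \<delta> x s) - c\<bar> \<le> K * (2 * \<delta>) powr \<gamma> + K * (2 * \<delta>) powr \<gamma>"
      if "u - \<delta> \<le> r" "r < u" for r
    proof -
      have "\<bar>mean \<delta> x r - x u\<bar> \<le> K * (2 * \<delta>) powr \<gamma>"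
        using that True u assms(2,6) by (intro mean_near_le[OF assms(1,2,4,5,7) g(1)] R T uR) linarith+
      moreover have "\<bar>mean \<delta> x s - x s\<bar> \<le> K * (2 * \<delta>) powr \<gamma>"
        using assms(2,6) by (intro mean_near_le[OF assms(1,2,4,5,7) g(1)] R sT uR) linarith+
      ultimately show ?thesis unfolding c_def by linarith
    qed
    \<comment> \<open>The number \<open>c\<close> is written as an integral over the same window, so
      that the difference can be estimated under the integral.\<close>
    have "(LBINT r:{s..t}. indicator {u - \<delta>..<u} r * (c / \<delta>)) = (LBINT r. indicator {u - \<delta>..<u} r * (c / \<delta>))"
      unfolding set_lebesgue_integral_def
      by (intro Bochner_Integration.integral_cong) (use True u in \<open>auto split: split_indicator\<close>)
    also have "\<dots> = c" using assms(2) by simp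
    finally have ic: "(LBINT r:{s..t}. indicator {u - \<delta>..<u} r * (c / \<delta>)) = c" .
    have lb: "loc_bdd_meas (\<lambda>r. indicator {u - \<delta>..<u} r * (c / \<delta>))"
      by (intro loc_bdd_measI exI[of _ "\<bar>c / \<delta>\<bar>"]) (auto split: split_indicator)
    have "smooth_area \<delta> x (step u) s t - c =
      smooth_area \<delta> x (step u) s t - (LBINT r:{s..t}. indicator {u - \<delta>..<u} r * (c / \<delta>))" using ic by simp
    also have "\<dots> = (LBINT r:{s..t}. (mean \<delta> x r - mean \<delta> x s) * ((step u (r + \<delta>) - step u r) / \<delta>) -
       indicator {u - \<delta>..<u} r * (c / \<delta>))"
      unfolding smooth_area_def
      by (rule set_integral_diff(2)[symmetric]; intro loc_bdd_meas_integrable loc_bdd_meas_smooth_area_integrand loc_bdd_meas_step lb assms)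
    also have "\<bar>\<dots>\<bar> \<le> ((K * (2 * \<delta>) powr \<gamma> + K * (2 * \<delta>) powr \<gamma>) / \<delta>) * (u - (u - \<delta>))"
    proof (rule integral_bound_sub)
      fix r assume r: "r \<in> {s..t}"
      have e: "(mean \<delta> x r - mean \<delta> x s) * ((step u (r + \<delta>) - step u r) / \<delta>) - indicator {u - \<delta>..<u} r * (c / \<delta>)
         = indicator {u - \<delta>..<u} r * (((mean \<delta> x r - mean \<delta> x s) - c) / \<delta>)"
        using assms(2) by (subst step_diff) (auto split: split_indicator simp: diff_divide_distrib)
      show "\<bar>(mean \<delta> x r - mean \<delta> x s) * ((step u (r + \<delta>) - step u r) / \<delta>) - indicator {u - \<delta>..<u} r * (c / \<delta>)\<bar>
        \<le> (K * (2 * \<delta>) powr \<gamma> + K * (2 * \<delta>) powr \<gamma>) / \<delta> * indicator {u - \<delta>..u} r"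
        unfolding e using 1[of r] assms(2,7)
        by (auto split: split_indicator simp: abs_mult divide_right_mono)
    next
      show "loc_bdd_meas (\<lambda>r. (mean \<delta> x r - mean \<delta> x s) * ((step u (r + \<delta>) - step u r) / \<delta>) -
       indicator {u - \<delta>..<u} r * (c / \<delta>))"
        by (intro loc_bdd_meas_diff loc_bdd_meas_smooth_area_integrand lb loc_bdd_meas_step assms)
    qed (use assms in auto)
    finally show ?thesis using assms(2) by (simp add: c_def)
  next
    case False
    have "\<bar>smooth_area \<delta> x (step u) s t\<bar> \<le> K * (2 * \<delta>) powr \<gamma>"
    proof (rule kernel_bound[OF assms(1,2)])
      fix r assume r: "s \<le> r" "r \<le> t" "u - \<delta> \<le> r" "r < u"
      have "\<bar>r - s\<bar> + \<eta> \<le> 2 * \<delta>" using r False assms(6) by simp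
      then show "\<bar>mean \<delta> x r - mean \<delta> x s\<bar> \<le> K * (2 * \<delta>) powr \<gamma>"
        by (intro mean_incr_le[OF assms(1,2,4,5,7) g(1)] R T r sT)
    qed (use assms(7) in simp)
    moreover have "\<bar>x u - x s\<bar> \<le> K * (2 * \<delta>) powr \<gamma>"
      using u False assms(5-8) by (intro hoelder_up_toD[OF assms(4)] uR) simp_all
    ultimately show ?thesis by linarith
  qed
  also have "\<dots> \<le> 4 * K * \<delta> powr \<gamma>" using mult_left_mono[OF two assms(7)] by simp
  finally show ?thesis .
qed


section \<open>Stieltjes sums against a unit jump and comparison with the area\<close>

lemma partition_mono:
  assumes "partition_of s t n \<pi>" "k \<le> l" "l \<le> n" shows "\<pi> k \<le> \<pi> l"
  using assms(2,3)
proof (induction l rule: dec_induct)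
  case (step m)
  then show ?case using assms(1) unfolding partition_of_def by (meson Suc_le_lessD less_imp_le order_trans)
qed simp

lemma partition_mem:
  assumes "partition_of s t n \<pi>" "k \<le> n" shows "s \<le> \<pi> k" "\<pi> k \<le> t"
  using partition_mono[OF assms(1), of 0 k] partition_mono[OF assms(1), of k n] assms
  by (auto simp: partition_of_def)

lemma partition_cell:
  assumes p: "partition_of s t n \<pi>" and u: "s < u" "u \<le> t"
  obtains k where "k < n" "\<pi> k < u" "u \<le> \<pi> (Suc k)"
proof -
  define k where "k = (LEAST k. u \<le> \<pi> k)"
  have n: "u \<le> \<pi> n" "\<pi> 0 < u" using p u by (auto simp: partition_of_def)
  have 1: "u \<le> \<pi> k" "k \<le> n" unfolding k_def by (rule LeastI, rule n, rule Least_le, rule n)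
  have k0: "k \<noteq> 0" using 1(1) n by (intro notI) auto
  then have "\<not> u \<le> \<pi> (k - 1)" unfolding k_def by (intro not_less_Least) auto
  with 1 k0 show ?thesis by (intro that[of "k - 1"]) auto
qed

text \<open>Only the cell containing \<open>u\<close> sees the jump. Cells are open on the left
  because \<open>step u\<close> equals 1 at \<open>u\<close> itself.\<close>

lemma stieltjes_step:
  assumes p: "partition_of s t n \<pi>" and k: "k < n" "\<pi> k < u" "u \<le> \<pi> (Suc k)"
  shows "stieltjes_sum n \<pi> x (step u) = x (\<pi> k) - x s"
proof -
  have "stieltjes_sum n \<pi> x (step u) = (\<Sum>l<n. if l = k then x (\<pi> k) - x s else 0)"
    unfolding stieltjes_sum_def
  proof (intro sum.cong refl)
    fix l assume l: "l \<in> {..<n}"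
    consider "l = k" | "Suc l \<le> k" | "Suc k \<le> l" by linarith
    then show "(x (\<pi> l) - x (\<pi> 0)) * (step u (\<pi> (Suc l)) - step u (\<pi> l)) = (if l = k then x (\<pi> k) - x s else 0)"
    proof cases
      case 1
      then show ?thesis using k p by (auto simp: step_def partition_of_def)
    next
      case 2
      then show ?thesis using k l partition_mono[OF p, of "Suc l" k] partition_mono[OF p, of l k]
        by (auto simp: step_def)
    next
      case 3
      then show ?thesis using k l partition_mono[OF p, of "Suc k" l] partition_mono[OF p, of "Suc k" "Suc l"]
        by (auto simp: step_def)
    qed
  qed
  then show ?thesis using k by simp
qed

lemma stieltjes_step_zero:
  assumes p: "partition_of s t n \<pi>" and u: "u \<le> s \<or> t < u"
  shows "stieltjes_sum n \<pi> x (step u) = 0"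
  unfolding stieltjes_sum_def
proof (intro sum.neutral ballI)
  fix l assume l: "l \<in> {..<n}"
  then show "(x (\<pi> l) - x (\<pi> 0)) * (step u (\<pi> (Suc l)) - step u (\<pi> l)) = 0"
    using u partition_mem[OF p, of l] partition_mem[OF p, of "Suc l"] by (auto simp: step_def)
qed

lemma stieltjes_sum_right:
  "stieltjes_sum n \<pi> x (\<lambda>r. c + (\<Sum>k\<in>A. b k * y k r)) = (\<Sum>k\<in>A. b k * stieltjes_sum n \<pi> x (y k))"
  unfolding stieltjes_sum_def sum_distrib_left
  by (subst sum.swap) (simp add: sum_distrib_left sum_subtractf[symmetric] algebra_simps)

lemma stieltjes_sum_left:
  "stieltjes_sum n \<pi> (\<lambda>r. c + (\<Sum>k\<in>A. b k * x k r)) y = (\<Sum>k\<in>A. b k * stieltjes_sum n \<pi> (x k) y)"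
  unfolding stieltjes_sum_def sum_distrib_left
  by (subst sum.swap) (simp add: sum_distrib_left sum_distrib_right sum_subtractf[symmetric] algebra_simps)

text \<open>Inside \<open>(s, t]\<close> the error 4 of \<open>kernel_near\<close> is joined by the
  distance from \<open>u\<close> to the left end of its cell, which costs another 2, and 6 squared
  is 36. On \<open>(t, t + \<delta>]\<close> the Stieltjes sum vanishes while the window of the jump
  still meets \<open>[s, t]\<close>; there the kernel is only bounded by the size of the path
  increments over \<open>[s, t]\<close>, on a set of length \<open>\<delta>\<close>.\<close>

lemma kernel_difference:
  assumes x: "loc_bdd_meas x" and d: "0 < \<delta>" "\<delta> \<le> 1" and h: "hoelder_up_to \<eta> R \<gamma> K x"
    and e: "0 \<le> \<eta>" "\<eta> \<le> \<delta>" "0 \<le> K" and g: "0 \<le> \<gamma>" "\<gamma> \<le> 1"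
    and sT: "\<bar>s\<bar> \<le> T" "\<bar>t\<bar> \<le> T" "T + 2 \<le> R" and st: "\<delta> \<le> t - s"
    and p: "partition_of s t n \<pi>" and mesh: "\<And>k. k < n \<Longrightarrow> \<pi> (Suc k) - \<pi> k \<le> \<delta>"
  defines "D \<equiv> \<lambda>u. smooth_area \<delta> x (step u) s t - stieltjes_sum n \<pi> x (step u)"
  shows "(D u)\<^sup>2 \<le> 36 * K\<^sup>2 * \<delta> powr (2 * \<gamma>) * indicator {s<..t} u + 4 * K\<^sup>2 * (t - s) powr (2 * \<gamma>) * indicator {t<..t + \<delta>} u"
proof -
  have two: "(2 * z) powr \<gamma> \<le> 2 * z powr \<gamma>" if "0 \<le> z" for z :: real
  proof -
    have "(2 * z) powr \<gamma> = 2 powr \<gamma> * z powr \<gamma>" using that by (simp add: powr_mult)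
    also have "\<dots> \<le> 2 powr 1 * z powr \<gamma>" using g by (intro mult_right_mono powr_mono) auto
    finally show ?thesis by simp
  qed
  have sq: "(z powr \<gamma>)\<^sup>2 = z powr (2 * \<gamma>)" for z :: real
    by (simp add: power2_eq_square powr_add[symmetric])
  consider "u \<le> s \<or> t + \<delta> < u" | "s < u" "u \<le> t" | "t < u" "u \<le> t + \<delta>" by linarith
  then show ?thesis
  proof cases
    case 1
    then have "smooth_area \<delta> x (step u) s t = 0" "stieltjes_sum n \<pi> x (step u) = 0"
      using d st by (intro kernel_zero stieltjes_step_zero[OF p]; force)+
    then have "D u = 0" unfolding D_def by simp
    then show ?thesis by simp
  next
    case 2
    obtain k where k: "k < n" "\<pi> k < u" "u \<le> \<pi> (Suc k)" using partition_cell[OF p 2] .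
    have m: "s \<le> \<pi> k" "\<pi> k \<le> t" using partition_mem[OF p, of k] k by auto
    have "D u = (smooth_area \<delta> x (step u) s t - (x u - x s)) + (x u - x (\<pi> k))"
      unfolding D_def stieltjes_step[OF p k] by simp
    moreover have "\<bar>smooth_area \<delta> x (step u) s t - (x u - x s)\<bar> \<le> 4 * K * \<delta> powr \<gamma>"
      by (rule kernel_near[OF x d h e g sT 2])
    moreover have "\<bar>x u - x (\<pi> k)\<bar> \<le> K * (2 * \<delta>) powr \<gamma>"
    proof (intro hoelder_up_toD[OF h _ _ _ e(1,3) g(1)])
      have "\<bar>u\<bar> \<le> T" "\<bar>\<pi> k\<bar> \<le> T" using m 2 sT by linarith+
      then show "\<bar>u\<bar> \<le> R" "\<bar>\<pi> k\<bar> \<le> R" using sT(3) by linarith+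
      show "\<bar>u - \<pi> k\<bar> + \<eta> \<le> 2 * \<delta>" using mesh[of k] k e(2) by simp
    qed
    ultimately have "\<bar>D u\<bar> \<le> 6 * K * \<delta> powr \<gamma>" using mult_left_mono[OF two[of \<delta>] e(3)] d by linarith
    then have "(D u)\<^sup>2 \<le> (6 * K * \<delta> powr \<gamma>)\<^sup>2" by (metis abs_ge_zero power2_abs power_mono)
    then show ?thesis using 2 by (simp add: power_mult_distrib sq)
  next
    case 3
    have "D u = smooth_area \<delta> x (step u) s t"
      unfolding D_def using stieltjes_step_zero[OF p, of u x] 3 by simp
    moreover have "\<bar>smooth_area \<delta> x (step u) s t\<bar> \<le> K * (2 * (t - s)) powr \<gamma>"
    proof (rule kernel_bound[OF x d(1)])
      fix r assume r: "s \<le> r" "r \<le> t"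
      have "\<bar>r\<bar> \<le> T" using r sT by linarith
      then have "\<bar>r\<bar> + \<delta> \<le> R" "\<bar>s\<bar> + \<delta> \<le> R"
        using sT d(2) by linarith+
      moreover have "\<bar>r - s\<bar> + \<eta> \<le> 2 * (t - s)"
        using st e(2) r by simp
      ultimately show "\<bar>mean \<delta> x r - mean \<delta> x s\<bar> \<le> K * (2 * (t - s)) powr \<gamma>"
        by (intro mean_incr_le[OF x d(1) h e(1,3) g(1)])
    next
      show "0 \<le> K * (2 * (t - s)) powr \<gamma>" using e(3) by simp
    qed
    moreover have "0 \<le> t - s" using d st by linarith
    ultimately have "\<bar>D u\<bar> \<le> 2 * K * (t - s) powr \<gamma>"
      using mult_left_mono[OF two[of "t - s"] e(3)] by linarith
    then have "(D u)\<^sup>2 \<le> (2 * K * (t - s) powr \<gamma>)\<^sup>2" by (metis abs_ge_zero power2_abs power_mono)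
    then show ?thesis using 3 by (simp add: power_mult_distrib sq)
  qed
qed

lemma card_grid_le:
  fixes p q :: real assumes "p \<le> q"
  shows "real (card {k \<in> {..<n}. p < real (Suc k) \<and> real (Suc k) \<le> q}) \<le> q - p + 1"
proof -
  have "card {k \<in> {..<n}. p < real (Suc k) \<and> real (Suc k) \<le> q} \<le> card {\<lfloor>p\<rfloor><..\<lfloor>q\<rfloor>}"
  proof (rule card_inj_on_le[where f="\<lambda>k. int (Suc k)"])
    show "(\<lambda>k. int (Suc k)) ` {k \<in> {..<n}. p < real (Suc k) \<and> real (Suc k) \<le> q} \<subseteq> {\<lfloor>p\<rfloor><..\<lfloor>q\<rfloor>}"
      by (auto simp: le_floor_iff floor_less_iff)
  qed (auto simp: inj_on_def)
  also have "card {\<lfloor>p\<rfloor><..\<lfloor>q\<rfloor>} = nat (\<lfloor>q\<rfloor> - \<lfloor>p\<rfloor>)" by simp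
  finally have "real (card {k \<in> {..<n}. p < real (Suc k) \<and> real (Suc k) \<le> q}) \<le> real (nat (\<lfloor>q\<rfloor> - \<lfloor>p\<rfloor>))"
    by (simp only: of_nat_le_iff)
  also have "\<dots> = of_int \<lfloor>q\<rfloor> - of_int \<lfloor>p\<rfloor>" using floor_mono[OF assms] by simp
  also have "\<dots> \<le> q - p + 1" by linarith
  finally show ?thesis .
qed

section \<open>Step paths on a grid\<close>

definition grid :: "nat \<Rightarrow> nat \<Rightarrow> nat \<Rightarrow> real" where
  "grid R N k = - real R + real k / real N"

text \<open>A Riemann sum of an indicator exceeds the length of the interval by at most one
  cell.\<close>

lemma grid_count:
  assumes "a \<le> b" "0 < N"
  shows "(\<Sum>k<n. indicator {a<..b} (grid R N (Suc k)) / real N) \<le> b - a + 1 / N"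
proof -
  have i: "indicator {a<..b} (grid R N (Suc k)) =
      (if N * (a + R) < real (Suc k) \<and> real (Suc k) \<le> N * (b + R) then 1 else 0 :: real)" for k
    using assms by (auto simp: grid_def field_simps split: split_indicator)
  have "(\<Sum>k<n. indicator {a<..b} (grid R N (Suc k)) :: real) =
     real (card {k \<in> {..<n}. N * (a + R) < real (Suc k) \<and> real (Suc k) \<le> N * (b + R)})"
    unfolding i by (subst sum.inter_filter[symmetric]) simp_all
  also have "\<dots> \<le> N * (b + R) - N * (a + R) + 1" by (rule card_grid_le) (use assms in \<open>auto intro!: mult_left_mono\<close>)
  finally have "(\<Sum>k<n. indicator {a<..b} (grid R N (Suc k)) :: real) / N \<le> (N * (b + R) - N * (a + R) + 1) / N"
    by (intro divide_right_mono) auto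
  also have "\<dots> = b - a + 1 / N" using assms by (simp add: field_simps)
  finally show ?thesis by (simp add: sum_divide_distrib)
qed

text \<open>The left side is the variance, given the first path, of the error as a Gaussian form:
  \<open>1 / N\<close> is the variance of each increment of the second path. Rounding to the grid at
  most doubles the lengths \<open>t - s\<close> and \<open>\<delta>\<close>, so 80 is twice 36 plus
  twice 4.\<close>

lemma kernel_difference_sum:
  fixes T :: real
  assumes x: "loc_bdd_meas x" and d: "0 < \<delta>" "\<delta> \<le> 1" and h: "hoelder_up_to (1 / real N) (real R) \<gamma> K x"
    and e: "0 < N" "1 / real N \<le> \<delta>" "0 \<le> K" and g: "0 \<le> \<gamma>" "\<gamma> \<le> 1/2"
    and sT: "\<bar>s\<bar> \<le> T" "\<bar>t\<bar> \<le> T" "T + 2 \<le> real R" and st: "\<delta> \<le> t - s"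
    and p: "partition_of s t n \<pi>" and mesh: "\<And>k. k < n \<Longrightarrow> \<pi> (Suc k) - \<pi> k \<le> \<delta>"
  defines "D \<equiv> \<lambda>u. smooth_area \<delta> x (step u) s t - stieltjes_sum n \<pi> x (step u)"
  shows "(\<Sum>k<m. (D (grid R N (Suc k)))\<^sup>2 * (1 / N)) \<le> 80 * K\<^sup>2 * \<delta> powr (2 * \<gamma>) * (t - s)"
proof -
  let ?u = "\<lambda>k. grid R N (Suc k)"
  have "(\<Sum>k<m. (D (?u k))\<^sup>2 * (1 / N)) \<le> (\<Sum>k<m. (36 * K\<^sup>2 * \<delta> powr (2 * \<gamma>) * indicator {s<..t} (?u k) +
     4 * K\<^sup>2 * (t - s) powr (2 * \<gamma>) * indicator {t<..t + \<delta>} (?u k)) * (1 / N))"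
    unfolding D_def
    by (intro sum_mono mult_right_mono kernel_difference[OF x d h _ e(2,3) g(1) _ sT st p mesh]) (use g in auto)
  also have "\<dots> = 36 * K\<^sup>2 * \<delta> powr (2 * \<gamma>) * (\<Sum>k<m. indicator {s<..t} (?u k) / N) +
     4 * K\<^sup>2 * (t - s) powr (2 * \<gamma>) * (\<Sum>k<m. indicator {t<..t + \<delta>} (?u k) / N)"
    by (simp only: sum_distrib_left sum.distrib[symmetric]) (intro sum.cong refl, simp add: algebra_simps)
  also have "\<dots> \<le> 36 * K\<^sup>2 * \<delta> powr (2 * \<gamma>) * (2 * (t - s)) + 4 * K\<^sup>2 * (t - s) powr (2 * \<gamma>) * (2 * \<delta>)"
  proof (intro add_mono mult_left_mono)
    have "(\<Sum>k<m. indicator {s<..t} (?u k) / N) \<le> t - s + 1 / N"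
      by (rule grid_count) (use d st e in auto)
    then show "(\<Sum>k<m. indicator {s<..t} (?u k) / N) \<le> 2 * (t - s)" using e st by simp
    have "(\<Sum>k<m. indicator {t<..t+\<delta>} (?u k) / N) \<le> (t + \<delta>) - t + 1 / N"
      by (rule grid_count) (use d e in auto)
    then show "(\<Sum>k<m. indicator {t<..t+\<delta>} (?u k) / N) \<le> 2 * \<delta>" using e by simp
  qed auto
  \<comment> \<open>The part beyond \<open>t\<close> is absorbed because
    \<open>2 * \<gamma> - 1 \<le> 0\<close> and \<open>\<delta> \<le> t - s\<close>: the negative
    power is larger at \<open>\<delta>\<close>.\<close>
  also have "4 * K\<^sup>2 * (t - s) powr (2 * \<gamma>) * (2 * \<delta>) \<le> 8 * K\<^sup>2 * (\<delta> powr (2 * \<gamma>) * (t - s))"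
  proof -
    have "(t - s) powr (2 * \<gamma>) * \<delta> = (t - s) * ((t - s) powr (2 * \<gamma> - 1) * \<delta>)"
      using d st by (simp add: powr_diff)
    also have "\<dots> \<le> (t - s) * (\<delta> powr (2 * \<gamma> - 1) * \<delta>)"
      using d st g by (intro mult_left_mono mult_right_mono powr_mono2') auto
    also have "\<dots> = \<delta> powr (2 * \<gamma>) * (t - s)" using d by (simp add: powr_diff)
    finally have "8 * K\<^sup>2 * ((t - s) powr (2 * \<gamma>) * \<delta>) \<le> 8 * K\<^sup>2 * (\<delta> powr (2 * \<gamma>) * (t - s))"
      by (intro mult_left_mono) auto
    then show ?thesis by (simp add: algebra_simps)
  qed
  finally show ?thesis by (simp add: algebra_simps)
qed


text \<open>The path sampled at the last grid point before \<open>r\<close>, written as a sum of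
  jumps so that linearity applies and the coefficients are the Gaussian increments.\<close>

definition grid_path :: "nat \<Rightarrow> nat \<Rightarrow> (real \<Rightarrow> real) \<Rightarrow> real \<Rightarrow> real" where
  "grid_path R N x r = x (grid R N 0) +
     (\<Sum>k<2 * R * N. (x (grid R N (Suc k)) - x (grid R N k)) * step (grid R N (Suc k)) r)"

lemma loc_bdd_meas_grid_path[intro]: "loc_bdd_meas (grid_path R N x)"
proof -
  have "loc_bdd_meas (\<lambda>r. x (grid R N 0) +
     (\<Sum>k<2 * R * N. (x (grid R N (Suc k)) - x (grid R N k)) * step (grid R N (Suc k)) r))"
    by (intro loc_bdd_meas_add loc_bdd_meas_sum loc_bdd_meas_mult) auto
  then show ?thesis by (simp add: grid_path_def[abs_def])
qed

lemma grid_bounds: "0 < N \<Longrightarrow> k \<le> 2 * R * N \<Longrightarrow> \<bar>grid R N k\<bar> \<le> R"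
proof -
  assume a: "0 < N" "k \<le> 2 * R * N"
  then have "real k \<le> real (2 * R * N)" by (simp only: of_nat_le_iff)
  then show ?thesis using a by (auto simp: grid_def abs_le_iff field_simps)
qed

text \<open>The jumps up to \<open>r\<close> telescope. The index \<open>k\<close> depends on
  \<open>r\<close> alone, so one grid point serves all paths.\<close>

lemma grid_path_eq:
  assumes "\<bar>r\<bar> \<le> real R" "0 < N"
  obtains k where "k \<le> 2 * R * N" "grid R N k \<le> r" "r < grid R N k + 1 / N" "\<forall>x. grid_path R N x r = x (grid R N k)"
proof -
  define k where "k = nat \<lfloor>(r + R) * N\<rfloor>"
  have nn: "0 \<le> (r + R) * N" using assms by (intro mult_nonneg_nonneg) auto
  have kl: "real k \<le> (r + R) * N" "(r + R) * N < real k + 1" using nn unfolding k_def by (auto simp: floor_less_iff)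
  have "(r + R) * N \<le> (2 * real R) * N" using assms by (intro mult_right_mono) auto
  then have "real k \<le> real (2 * R * N)" using kl by simp
  then have k: "k \<le> 2 * R * N" by (simp only: of_nat_le_iff)
  have s: "step (grid R N (Suc l)) r = (if l < k then 1 else 0)" for l
  proof -
    have "grid R N (Suc l) \<le> r \<longleftrightarrow> real (Suc l) \<le> (r + R) * N"
      using assms by (simp add: grid_def field_simps)
    also have "\<dots> \<longleftrightarrow> l < k"
    proof
      assume "real (Suc l) \<le> (r + R) * N"
      then have "real (Suc l) < real (Suc k)" using kl by simp
      then show "l < k" by (simp only: of_nat_less_iff)
    next
      assume "l < k"
      then have "real (Suc l) \<le> real k" by (simp only: of_nat_le_iff)
      then show "real (Suc l) \<le> (r + R) * N" using kl by simp
    qed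
    finally show ?thesis by (simp add: step_def)
  qed
  have "grid_path R N x r = x (grid R N k)" for x
  proof -
    have "(\<Sum>l<2 * R * N. (x (grid R N (Suc l)) - x (grid R N l)) * step (grid R N (Suc l)) r) =
       (\<Sum>l\<in>{l\<in>{..<2 * R * N}. l < k}. x (grid R N (Suc l)) - x (grid R N l))"
      unfolding s by (subst sum.inter_filter) (auto intro!: sum.cong)
    also have "{l\<in>{..<2 * R * N}. l < k} = {..<k}" using k by auto
    also have "(\<Sum>l\<in>{..<k}. x (grid R N (Suc l)) - x (grid R N l)) = x (grid R N k) - x (grid R N 0)"
      by (rule sum_lessThan_telescope)
    finally show ?thesis by (simp add: grid_path_def)
  qed
  moreover have "grid R N k \<le> r" "r < grid R N k + 1 / N"
    using kl assms by (simp_all add: grid_def field_simps)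
  ultimately show ?thesis using k that by blast
qed

text \<open>Two sampled times are at most \<open>1 / N\<close> further apart than the original ones,
  which is the slack. The hypothesis concerns grid values only and is thus a condition on finitely
  many increments.\<close>

lemma hoelder_grid_path:
  assumes "\<And>k l. k \<le> 2 * R * N \<Longrightarrow> l \<le> 2 * R * N \<Longrightarrow>
      \<bar>x (grid R N k) - x (grid R N l)\<bar> \<le> K * \<bar>grid R N k - grid R N l\<bar> powr \<gamma>"
    and "0 < N" "0 \<le> K" "0 \<le> \<gamma>"
  shows "hoelder_up_to (1 / N) R \<gamma> K (grid_path R N x)"
  unfolding hoelder_up_to_def
proof (intro allI impI)
  fix a b assume a: "\<bar>a\<bar> \<le> real R" and b: "\<bar>b\<bar> \<le> real R"
  obtain k where k: "k \<le> 2 * R * N" "grid R N k \<le> a" "a < grid R N k + 1 / N" "\<forall>x. grid_path R N x a = x (grid R N k)"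
    using grid_path_eq[OF a assms(2)] by blast
  obtain l where l: "l \<le> 2 * R * N" "grid R N l \<le> b" "b < grid R N l + 1 / N" "\<forall>x. grid_path R N x b = x (grid R N l)"
    using grid_path_eq[OF b assms(2)] by blast
  have "\<bar>grid R N k - grid R N l\<bar> \<le> \<bar>a - b\<bar> + 1 / N" using k l by linarith
  then have "K * \<bar>grid R N k - grid R N l\<bar> powr \<gamma> \<le> K * (\<bar>a - b\<bar> + 1 / N) powr \<gamma>"
    using assms by (intro mult_left_mono powr_mono2) auto
  then show "\<bar>grid_path R N x a - grid_path R N x b\<bar> \<le> K * (\<bar>a - b\<bar> + 1 / N) powr \<gamma>"
    using assms(1)[OF k(1) l(1)] k(4) l(4) by simp
qed

lemma grid_path_tendsto:
  assumes x: "continuous_on UNIV x" and r: "\<bar>r\<bar> \<le> real R"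
  shows "(\<lambda>N. grid_path R (Suc N) x r) \<longlonglongrightarrow> x r"
proof -
  have "\<exists>g. \<forall>N. \<bar>g N - r\<bar> \<le> 1 / Suc N \<and> grid_path R (Suc N) x r = x (g N)"
  proof (rule choice, intro allI)
    fix N
    obtain k where "k \<le> 2 * R * Suc N" "grid R (Suc N) k \<le> r" "r < grid R (Suc N) k + 1 / real (Suc N)"
      "\<forall>x. grid_path R (Suc N) x r = x (grid R (Suc N) k)"
      using grid_path_eq[OF r zero_less_Suc[of N]] by blast
    then show "\<exists>g. \<bar>g - r\<bar> \<le> 1 / Suc N \<and> grid_path R (Suc N) x r = x g"
      by (intro exI[of _ "grid R (Suc N) k"]) auto
  qed
  then obtain g where g: "\<And>N. \<bar>g N - r\<bar> \<le> 1 / Suc N" "\<And>N. grid_path R (Suc N) x r = x (g N)" by blast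
  have "(\<lambda>N. g N - r) \<longlonglongrightarrow> 0"
    by (rule Lim_null_comparison[OF _ LIMSEQ_Suc[OF lim_1_over_n]]) (use g in auto)
  then have "g \<longlonglongrightarrow> r" by (simp add: LIM_zero_iff)
  then have "(\<lambda>N. x (g N)) \<longlonglongrightarrow> x r"
    using x by (metis UNIV_I continuous_on_def eventually_at_topological filterlim_compose continuous_on_eq_continuous_at isCont_tendsto_compose open_UNIV)
  then show ?thesis by (simp add: g(2))
qed

lemma grid_path_bounded:
  assumes "continuous_on UNIV x"
  obtains B where "0 \<le> B" "\<And>N r. 0 < N \<Longrightarrow> \<bar>r\<bar> \<le> real R \<Longrightarrow> \<bar>grid_path R N x r\<bar> \<le> B"
    "\<And>r. \<bar>r\<bar> \<le> real R \<Longrightarrow> \<bar>x r\<bar> \<le> B"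
proof -
  obtain B where B: "0 \<le> B" "\<And>r. \<bar>r\<bar> \<le> real R \<Longrightarrow> \<bar>x r\<bar> \<le> B" using loc_bdd_meas_bound[OF loc_bdd_meas_continuous[OF assms], where R="real R"] by blast
  show ?thesis
  proof (rule that[OF B(1) _ B(2)])
    fix N :: nat and r :: real assume N: "0 < N" and r: "\<bar>r\<bar> \<le> real R"
    obtain k where k: "k \<le> 2 * R * N" "grid R N k \<le> r" "r < grid R N k + 1 / N"
      "\<forall>x. grid_path R N x r = x (grid R N k)"
      using grid_path_eq[OF r N] by blast
    show "\<bar>grid_path R N x r\<bar> \<le> B" unfolding k(4)[rule_format] by (rule B(2)[OF grid_bounds[OF N k(1)]])
  qed auto
qed

section \<open>Limits along refining grids\<close>

lemma loc_bdd_meas_dominated: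
  assumes f: "\<And>n. loc_bdd_meas (f n)" and g: "loc_bdd_meas g"
    and B: "\<And>n r. r \<in> {a..b} \<Longrightarrow> \<bar>f n r\<bar> \<le> B"
    and lim: "\<And>r. r \<in> {a..b} \<Longrightarrow> (\<lambda>n. f n r) \<longlonglongrightarrow> g r"
  shows "(\<lambda>n. LBINT r:{a..b}. f n r) \<longlonglongrightarrow> (LBINT r:{a..b}. g r)"
  unfolding set_lebesgue_integral_def
proof (rule integral_dominated_convergence[where w="\<lambda>r. B * indicator {a..b} r"])
  show "integrable lborel (\<lambda>r. B * indicator {a..b} r)"
    by (intro integrable_mult_right integrable_real_indicator) (simp_all add: emeasure_lborel_Icc_eq)
  show "(\<lambda>r. indicator {a..b} r *\<^sub>R g r) \<in> borel_measurable lborel"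
    "(\<lambda>r. indicator {a..b} r *\<^sub>R f n r) \<in> borel_measurable lborel" for n
    using loc_bdd_measD[OF g] loc_bdd_measD[OF f] by measurable
qed (use B lim in \<open>auto split: split_indicator\<close>)

lemma mean_tendsto:
  assumes x: "continuous_on UNIV x" and d: "0 < \<delta>" and r: "\<bar>r\<bar> + \<delta> \<le> real R"
  shows "(\<lambda>N. mean \<delta> (grid_path R (Suc N) x) r) \<longlonglongrightarrow> mean \<delta> x r"
  unfolding mean_def
proof (intro tendsto_divide)
  obtain B where B: "0 \<le> B" "\<And>N r. 0 < N \<Longrightarrow> \<bar>r\<bar> \<le> real R \<Longrightarrow> \<bar>grid_path R N x r\<bar> \<le> B"
    using grid_path_bounded[OF x] by metis
  have *: "\<bar>r + v\<bar> \<le> real R" if "v \<in> {0..\<delta>}" for v using that r by auto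
  show "(\<lambda>N. LBINT v:{0..\<delta>}. grid_path R (Suc N) x (r + v)) \<longlonglongrightarrow> (LBINT v:{0..\<delta>}. x (r + v))"
    by (rule loc_bdd_meas_dominated[where B=B])
       (auto intro!: B * grid_path_tendsto x loc_bdd_meas_shift'[OF loc_bdd_meas_grid_path] loc_bdd_meas_shift'[OF loc_bdd_meas_continuous])
qed (use d in auto)

lemma smooth_area_tendsto:
  assumes x: "continuous_on UNIV x" and y: "continuous_on UNIV y" and d: "0 < \<delta>" "\<delta> \<le> 1"
    and sT: "\<bar>s\<bar> \<le> T" "\<bar>t\<bar> \<le> T" "T + 2 \<le> real R"
  shows "(\<lambda>N. smooth_area \<delta> (grid_path R (Suc N) x) (grid_path R (Suc N) y) s t) \<longlonglongrightarrow> smooth_area \<delta> x y s t"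
proof -
  obtain A where A: "0 \<le> A" "\<And>N r. 0 < N \<Longrightarrow> \<bar>r\<bar> \<le> real R \<Longrightarrow> \<bar>grid_path R N x r\<bar> \<le> A"
    using grid_path_bounded[OF x] by metis
  obtain B where B: "0 \<le> B" "\<And>N r. 0 < N \<Longrightarrow> \<bar>r\<bar> \<le> real R \<Longrightarrow> \<bar>grid_path R N y r\<bar> \<le> B"
    using grid_path_bounded[OF y] by metis
  have T: "\<bar>r\<bar> \<le> T" if "r \<in> {s..t}" for r using that sT by auto
  have m: "\<bar>mean \<delta> (grid_path R (Suc N) x) r\<bar> \<le> A" if r: "\<bar>r\<bar> \<le> T" for N r
  proof -
    have "\<bar>mean \<delta> (grid_path R (Suc N) x) r - 0\<bar> \<le> A"
    proof (rule mean_minus_le[OF loc_bdd_meas_grid_path d(1)])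
      fix v assume v: "0 \<le> v" "v \<le> \<delta>"
      have "\<bar>r + v\<bar> \<le> real R" using v r sT(3) d(2) by linarith
      then show "\<bar>grid_path R (Suc N) x (r + v) - 0\<bar> \<le> A" using A(2)[of "Suc N"] by simp
    qed
    then show ?thesis by simp
  qed
  have R: "\<bar>r\<bar> \<le> real R" "\<bar>r + \<delta>\<bar> \<le> real R" "\<bar>r\<bar> + \<delta> \<le> real R" if "\<bar>r\<bar> \<le> T" for r
    using that sT(3) d by linarith+
  show ?thesis
    unfolding smooth_area_def
  proof (rule loc_bdd_meas_dominated[where B="(A + A) * ((B + B) / \<delta>)"])
    fix N r assume r: "r \<in> {s..t}"
    have 1: "\<bar>mean \<delta> (grid_path R (Suc N) x) r - mean \<delta> (grid_path R (Suc N) x) s\<bar> \<le> A + A"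
      using m[OF T[OF r], of N] m[OF sT(1), of N] by linarith
    have "\<bar>grid_path R (Suc N) y (r + \<delta>) - grid_path R (Suc N) y r\<bar> \<le> B + B"
      using B(2)[of "Suc N" r] B(2)[of "Suc N" "r + \<delta>"] R[OF T[OF r]] by simp
    then have "\<bar>(grid_path R (Suc N) y (r + \<delta>) - grid_path R (Suc N) y r) / \<delta>\<bar> \<le> (B + B) / \<delta>"
      using d by (simp add: divide_right_mono)
    then show "\<bar>(mean \<delta> (grid_path R (Suc N) x) r - mean \<delta> (grid_path R (Suc N) x) s) *
       ((grid_path R (Suc N) y (r + \<delta>) - grid_path R (Suc N) y r) / \<delta>)\<bar> \<le> (A + A) * ((B + B) / \<delta>)"
      unfolding abs_mult using 1 A(1) by (intro mult_mono) auto
  next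
    fix r assume r: "r \<in> {s..t}"
    show "(\<lambda>N. (mean \<delta> (grid_path R (Suc N) x) r - mean \<delta> (grid_path R (Suc N) x) s) *
       ((grid_path R (Suc N) y (r + \<delta>) - grid_path R (Suc N) y r) / \<delta>)) \<longlonglongrightarrow>
       (mean \<delta> x r - mean \<delta> x s) * ((y (r + \<delta>) - y r) / \<delta>)"
      by (intro tendsto_intros mean_tendsto grid_path_tendsto x y d R T[OF r] sT(1)) (use d in auto)
  qed (rule loc_bdd_meas_smooth_area_integrand loc_bdd_meas_grid_path loc_bdd_meas_continuous x y)+
qed

lemma stieltjes_tendsto:
  assumes x: "continuous_on UNIV x" and y: "continuous_on UNIV y"
    and p: "partition_of s t n \<pi>" and sT: "\<bar>s\<bar> \<le> real R" "\<bar>t\<bar> \<le> real R"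
  shows "(\<lambda>N. stieltjes_sum n \<pi> (grid_path R (Suc N) x) (grid_path R (Suc N) y)) \<longlonglongrightarrow> stieltjes_sum n \<pi> x y"
proof -
  have *: "\<bar>\<pi> k\<bar> \<le> real R" if "k \<le> n" for k using partition_mem[OF p that] sT by linarith
  show ?thesis unfolding stieltjes_sum_def
    by (intro tendsto_intros grid_path_tendsto x y *) auto
qed

lemma smooth_area_grid_right:
  assumes "loc_bdd_meas x"
  shows "smooth_area \<delta> x (grid_path R N y) s t =
    (\<Sum>k<2 * R * N. (y (grid R N (Suc k)) - y (grid R N k)) * smooth_area \<delta> x (step (grid R N (Suc k))) s t)"
  unfolding grid_path_def[abs_def] by (rule smooth_area_sum_right) (use assms in auto)

lemma smooth_area_grid_left:
  assumes "loc_bdd_meas y" "0 < \<delta>"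
  shows "smooth_area \<delta> (grid_path R N x) y s t =
    (\<Sum>k<2 * R * N. (x (grid R N (Suc k)) - x (grid R N k)) * smooth_area \<delta> (step (grid R N (Suc k))) y s t)"
  unfolding grid_path_def[abs_def] by (rule smooth_area_sum_left) (use assms in auto)

lemma stieltjes_grid_right:
  "stieltjes_sum n \<pi> x (grid_path R N y) =
    (\<Sum>k<2 * R * N. (y (grid R N (Suc k)) - y (grid R N k)) * stieltjes_sum n \<pi> x (step (grid R N (Suc k))))"
  unfolding grid_path_def[abs_def] by (rule stieltjes_sum_right)

lemma stieltjes_grid_left:
  "stieltjes_sum n \<pi> (grid_path R N x) y =
    (\<Sum>k<2 * R * N. (x (grid R N (Suc k)) - x (grid R N k)) * stieltjes_sum n \<pi> (step (grid R N (Suc k))) y)"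
  unfolding grid_path_def[abs_def] by (rule stieltjes_sum_left)

section \<open>Continuous paths\<close>

lemma set_integral_FTC:
  fixes f F :: "real \<Rightarrow> real"
  assumes "s \<le> t" "continuous_on UNIV f" "\<And>r. (F has_real_derivative f r) (at r)"
  shows "(LBINT r:{s..t}. f r) = F t - F s"
proof -
  have "(LBINT r=s..t. f r) = F t - F s"
    by (rule interval_integral_FTC_finite)
       (use assms in \<open>auto intro: continuous_on_subset has_field_derivative_at_within
          simp: has_real_derivative_iff_has_vector_derivative[symmetric]\<close>)
  then show ?thesis using assms by (simp add: interval_integral_Icc)
qed

lemma antiderivative_exists:
  fixes f :: "real \<Rightarrow> 'a::euclidean_space"
  assumes "continuous_on UNIV f"
  obtains F where "\<And>r. (F has_vector_derivative f r) (at r)"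
proof -
  have "\<exists>F. \<forall>x. -\<infinity> < ereal x \<longrightarrow> ereal x < \<infinity> \<longrightarrow> (F has_vector_derivative f x) (at x)"
    by (rule einterval_antiderivative) (use assms in \<open>auto simp: continuous_on_eq_continuous_at\<close>)
  then show ?thesis using that by auto
qed

lemma mean_antiderivative:
  assumes x: "continuous_on UNIV x" and F: "\<And>r. (F has_real_derivative x r) (at r)" and d: "0 < \<delta>"
  shows "mean \<delta> x r = (F (r + \<delta>) - F r) / \<delta>"
proof -
  have "(LBINT v:{0..\<delta>}. x (r + v)) = F (r + \<delta>) - F (r + 0)"
  proof (rule set_integral_FTC)
    show "continuous_on UNIV (\<lambda>v. x (r + v))"
      by (rule continuous_on_compose2[OF x]) (auto intro!: continuous_intros)
    show "((\<lambda>v. F (r + v)) has_real_derivative x (r + v)) (at v)" for v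
      using F[of "v + r"] unfolding DERIV_shift[of F _ v r] by (simp add: add.commute[of r])
  qed (use d in auto)
  then show ?thesis by (simp add: mean_def)
qed

lemma continuous_shift:
  fixes x :: "real \<Rightarrow> 'a::topological_space"
  assumes "continuous_on UNIV x" shows "continuous_on UNIV (\<lambda>r. x (r + c))"
  by (rule continuous_on_compose2[OF assms]) (auto intro!: continuous_intros)

lemma mean_derivative:
  assumes x: "continuous_on UNIV x" and d: "0 < \<delta>"
  shows "(mean \<delta> x has_real_derivative (x (r + \<delta>) - x r) / \<delta>) (at r)"
proof -
  obtain F where F: "\<And>r. (F has_real_derivative x r) (at r)"
    using antiderivative_exists[OF x] by (auto simp: has_real_derivative_iff_has_vector_derivative)
  have "((\<lambda>r. (F (r + \<delta>) - F r) / \<delta>) has_real_derivative (x (r + \<delta>) - x r) / \<delta>) (at r)"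
    using F[of "r + \<delta>"] F[of r] by (intro DERIV_cdivide DERIV_diff) (simp_all add: DERIV_shift)
  then show ?thesis using mean_antiderivative[OF x F d] by presburger
qed

lemma continuous_mean:
  assumes "continuous_on UNIV x" "0 < \<delta>" shows "continuous_on UNIV (mean \<delta> x)"
  using DERIV_isCont[OF mean_derivative[OF assms]] by (simp add: continuous_on_eq_continuous_at)

text \<open>\<open>H\<close> is an antiderivative of the mean of \<open>x\<close> times the
  derivative of the mean of \<open>y\<close>. Separating \<open>s\<close> and \<open>t\<close> in
  this way yields Chen's relation by algebra and joint continuity in both times.\<close>

lemma smooth_area_formula:
  assumes x: "continuous_on UNIV x" and y: "continuous_on UNIV y" and d: "0 < \<delta>"
  obtains H where "continuous_on UNIV H"
    "\<And>s t. s \<le> t \<Longrightarrow> smooth_area \<delta> x y s t = H t - H s - mean \<delta> x s * (mean \<delta> y t - mean \<delta> y s)"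
proof -
  have c: "continuous_on UNIV (\<lambda>r. mean \<delta> x r * ((y (r + \<delta>) - y r) / \<delta>))"
    using d by (intro continuous_intros continuous_mean continuous_shift x y) auto
  obtain H where H: "\<And>r. (H has_real_derivative mean \<delta> x r * ((y (r + \<delta>) - y r) / \<delta>)) (at r)"
    using antiderivative_exists[OF c] by (auto simp: has_real_derivative_iff_has_vector_derivative)
  have "continuous_on UNIV H" using DERIV_isCont[OF H] by (simp add: continuous_on_eq_continuous_at)
  moreover have "smooth_area \<delta> x y s t = H t - H s - mean \<delta> x s * (mean \<delta> y t - mean \<delta> y s)" if "s \<le> t" for s t
  proof -
    have "smooth_area \<delta> x y s t = (H t - mean \<delta> x s * mean \<delta> y t) - (H s - mean \<delta> x s * mean \<delta> y s)"
      unfolding smooth_area_def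
    proof (rule set_integral_FTC[OF that])
      show "continuous_on UNIV (\<lambda>r. (mean \<delta> x r - mean \<delta> x s) * ((y (r + \<delta>) - y r) / \<delta>))"
        using d by (intro continuous_intros continuous_mean continuous_shift x y) auto
      show "((\<lambda>r. H r - mean \<delta> x s * mean \<delta> y r) has_real_derivative
          (mean \<delta> x r - mean \<delta> x s) * ((y (r + \<delta>) - y r) / \<delta>)) (at r)" for r
        unfolding left_diff_distrib by (intro DERIV_diff H DERIV_cmult mean_derivative y d)
    qed
    then show ?thesis by (simp add: algebra_simps)
  qed
  ultimately show ?thesis using that by blast
qed

lemma smooth_area_chen:
  assumes "continuous_on UNIV x" "continuous_on UNIV y" "0 < \<delta>" "s \<le> u" "u \<le> t"
  shows "smooth_area \<delta> x y s t = smooth_area \<delta> x y s u + smooth_area \<delta> x y u t +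
    (mean \<delta> x u - mean \<delta> x s) * (mean \<delta> y t - mean \<delta> y u)"
proof -
  obtain H where H: "\<And>s t. s \<le> t \<Longrightarrow> smooth_area \<delta> x y s t = H t - H s - mean \<delta> x s * (mean \<delta> y t - mean \<delta> y s)"
    using smooth_area_formula[OF assms(1-3)] by metis
  show ?thesis using assms(4,5) by (simp add: H algebra_simps)
qed

text \<open>By the product rule the sum of the two integrands is a derivative. With
  \<open>x = y\<close> it determines the diagonal entries.\<close>

lemma smooth_area_by_parts:
  assumes x: "continuous_on UNIV x" and y: "continuous_on UNIV y" and d: "0 < \<delta>" and "s \<le> t"
  shows "smooth_area \<delta> x y s t + smooth_area \<delta> y x s t = (mean \<delta> x t - mean \<delta> x s) * (mean \<delta> y t - mean \<delta> y s)"
proof -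
  have c: "continuous_on UNIV (\<lambda>r. (mean \<delta> x r - mean \<delta> x s) * ((y (r + \<delta>) - y r) / \<delta>))"
    if "continuous_on UNIV x" "continuous_on UNIV y" for x y
    using d by (intro continuous_intros continuous_mean continuous_shift that) auto
  have "smooth_area \<delta> x y s t + smooth_area \<delta> y x s t =
    (LBINT r:{s..t}. (mean \<delta> x r - mean \<delta> x s) * ((y (r + \<delta>) - y r) / \<delta>) +
       (mean \<delta> y r - mean \<delta> y s) * ((x (r + \<delta>) - x r) / \<delta>))"
    unfolding smooth_area_def
    by (rule set_integral_add(2)[symmetric]) (intro loc_bdd_meas_integrable loc_bdd_meas_smooth_area_integrand loc_bdd_meas_continuous x y)+
  also have "\<dots> = (mean \<delta> x t - mean \<delta> x s) * (mean \<delta> y t - mean \<delta> y s) -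
      (mean \<delta> x s - mean \<delta> x s) * (mean \<delta> y s - mean \<delta> y s)"
  proof (rule set_integral_FTC[OF \<open>s \<le> t\<close>])
    show "((\<lambda>r. (mean \<delta> x r - mean \<delta> x s) * (mean \<delta> y r - mean \<delta> y s)) has_real_derivative
       (mean \<delta> x r - mean \<delta> x s) * ((y (r + \<delta>) - y r) / \<delta>) +
       (mean \<delta> y r - mean \<delta> y s) * ((x (r + \<delta>) - x r) / \<delta>)) (at r)" for r
    proof -
      have "((\<lambda>r. (mean \<delta> x r - mean \<delta> x s) * (mean \<delta> y r - mean \<delta> y s)) has_real_derivative
        ((x (r + \<delta>) - x r) / \<delta> - 0) * (mean \<delta> y r - mean \<delta> y s) +
        ((y (r + \<delta>) - y r) / \<delta> - 0) * (mean \<delta> x r - mean \<delta> x s)) (at r)"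
        by (intro DERIV_mult DERIV_diff DERIV_const mean_derivative x y d)
      then show ?thesis by (rule DERIV_cong) (simp add: algebra_simps)
    qed
  qed (intro continuous_on_add c x y)
  finally show ?thesis by simp
qed

lemma mean_shift:
  assumes "continuous_on UNIV x" "0 < \<delta>"
  shows "mean \<delta> (\<lambda>r. x (r + \<tau>) - c) r = mean \<delta> x (r + \<tau>) - c"
proof -
  have "mean \<delta> (\<lambda>r. - c + x (r + \<tau>)) r = - c + mean \<delta> (\<lambda>r. x (r + \<tau>)) r"
    by (rule mean_add_const) (use assms in \<open>auto intro: loc_bdd_meas_continuous continuous_shift\<close>)
  also have "mean \<delta> (\<lambda>r. x (r + \<tau>)) r = mean \<delta> x (r + \<tau>)" by (simp add: mean_def algebra_simps)
  finally show ?thesis by simp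
qed

lemma smooth_area_shift:
  assumes "continuous_on UNIV x" "continuous_on UNIV y" "0 < \<delta>"
  shows "smooth_area \<delta> (\<lambda>r. x (r + \<tau>) - c) (\<lambda>r. y (r + \<tau>) - d) s t = smooth_area \<delta> x y (s + \<tau>) (t + \<tau>)"
proof -
  have "smooth_area \<delta> x y (s + \<tau>) (t + \<tau>) = (LBINT r. indicator {s + \<tau>..t + \<tau>} (\<tau> + 1 * r) *\<^sub>R
      ((mean \<delta> x (\<tau> + 1 * r) - mean \<delta> x (s + \<tau>)) * ((y (\<tau> + 1 * r + \<delta>) - y (\<tau> + 1 * r)) / \<delta>)))"
    unfolding smooth_area_def set_lebesgue_integral_def
    by (subst lborel_integral_real_affine[where c=1 and t=\<tau>]) auto
  also have "\<dots> = smooth_area \<delta> (\<lambda>r. x (r + \<tau>) - c) (\<lambda>r. y (r + \<tau>) - d) s t"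
    unfolding smooth_area_def set_lebesgue_integral_def mean_shift[OF assms(1,3)]
    by (intro Bochner_Integration.integral_cong) (auto split: split_indicator simp: algebra_simps)
  finally show ?thesis by simp
qed

lemma smooth_area_continuous:
  assumes "continuous_on UNIV x" "continuous_on UNIV y" "0 < \<delta>"
  shows "continuous_on {(s, t). s \<le> t} (\<lambda>(s, t). smooth_area \<delta> x y s t)"
proof -
  obtain H where H: "continuous_on UNIV H" "\<And>s t. s \<le> t \<Longrightarrow> smooth_area \<delta> x y s t = H t - H s - mean \<delta> x s * (mean \<delta> y t - mean \<delta> y s)"
    using smooth_area_formula[OF assms] by metis
  have m: "continuous_on UNIV (mean \<delta> x)" "continuous_on UNIV (mean \<delta> y)" using assms continuous_mean by auto
  have "continuous_on {(s, t). s \<le> t} (\<lambda>z. H (snd z) - H (fst z) - mean \<delta> x (fst z) * (mean \<delta> y (snd z) - mean \<delta> y (fst z)))"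
    by (intro continuous_intros continuous_on_compose2[OF H(1)] continuous_on_compose2[OF m(1)] continuous_on_compose2[OF m(2)]) auto
  then show ?thesis by (rule continuous_on_cong[THEN iffD1, rotated -1]) (auto simp: H(2))
qed

section \<open>The given approximations in terms of scalar means and areas\<close>

lemma approx_path_component:
  fixes \<omega> :: "'m::finite path"
  assumes w: "continuous_on UNIV \<omega>" and d: "0 < \<delta>"
  shows "approx_path \<delta> \<omega> t $ i = mean \<delta> (\<lambda>r. \<omega> r $ i) t - mean \<delta> (\<lambda>r. \<omega> r $ i) 0"
    and "(approx_path \<delta> \<omega> has_vector_derivative (1 / \<delta>) *\<^sub>R (\<omega> (t + \<delta>) - \<omega> t)) (at t)"
proof -
  obtain F where F: "\<And>r. (F has_vector_derivative \<omega> r) (at r)" using antiderivative_exists[OF w] by blast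
  have Fd: "((\<lambda>r. F (\<delta> + r)) has_vector_derivative \<omega> (\<delta> + r)) (at r)" for r
  proof -
    have "((\<lambda>r. \<delta> + r) has_vector_derivative 1) (at r)"
      by (auto intro!: derivative_eq_intros simp: has_real_derivative_iff_has_vector_derivative[symmetric])
    from vector_diff_chain_at[OF this F] show ?thesis by (simp add: o_def)
  qed
  have FF: "((\<lambda>r. F (\<delta> + r) - F r) has_vector_derivative \<omega> (\<delta> + r) - \<omega> r) (at r)" for r
    by (intro derivative_intros Fd F)
  have a: "approx_path \<delta> \<omega> t = (1 / \<delta>) *\<^sub>R ((F (\<delta> + t) - F t) - (F (\<delta> + 0) - F 0))" for t
    unfolding approx_path_def zero_ereal_def
    by (subst interval_integral_FTC_finite[where F="\<lambda>r. F (\<delta> + r) - F r"])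
       (auto intro!: continuous_intros continuous_on_compose2[OF w] has_vector_derivative_at_within FF)
  have Fi: "((\<lambda>r. F r $ i) has_real_derivative \<omega> r $ i) (at r)" for r
    using bounded_linear.has_vector_derivative[OF bounded_linear_vec_nth F[of r]]
    by (simp add: has_real_derivative_iff_has_vector_derivative)
  show "approx_path \<delta> \<omega> t $ i = mean \<delta> (\<lambda>r. \<omega> r $ i) t - mean \<delta> (\<lambda>r. \<omega> r $ i) 0"
    using mean_antiderivative[OF continuous_on_component[OF w] Fi d]
    by (simp add: a diff_divide_distrib[symmetric] add.commute)
  have "((\<lambda>t. (1 / \<delta>) *\<^sub>R ((F (\<delta> + t) - F t) - (F (\<delta> + 0) - F 0))) has_vector_derivative
      (1 / \<delta>) *\<^sub>R ((\<omega> (\<delta> + t) - \<omega> t) - 0)) (at t)"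
    by (intro bounded_linear.has_vector_derivative[OF bounded_linear_scaleR_right] has_vector_derivative_diff
         has_vector_derivative_const FF)
  then show "(approx_path \<delta> \<omega> has_vector_derivative (1 / \<delta>) *\<^sub>R (\<omega> (t + \<delta>) - \<omega> t)) (at t)"
    unfolding a[abs_def] by (simp add: add.commute)
qed

lemma approx_path_continuous:
  fixes \<omega> :: "'m::finite path"
  assumes "continuous_on UNIV \<omega>" "0 < \<delta>" shows "continuous_on A (approx_path \<delta> \<omega>)"
  using has_vector_derivative_continuous[OF approx_path_component(2)[OF assms]] continuous_at_imp_continuous_on by blast

text \<open>Taking an entry of a matrix is bounded linear and passes through the integral; the
  normalisation of \<open>approx_path\<close> at time 0 cancels in the increment.\<close>

lemma approx_area_component:
  fixes \<omega> :: "'m::finite path"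
  assumes w: "continuous_on UNIV \<omega>" and d: "0 < \<delta>" and st: "s \<le> t"
  shows "approx_area \<delta> \<omega> s t $ i $ j = smooth_area \<delta> (\<lambda>r. \<omega> r $ i) (\<lambda>r. \<omega> r $ j) s t"
proof -
  have vd: "vector_derivative (approx_path \<delta> \<omega>) (at r) = (1 / \<delta>) *\<^sub>R (\<omega> (r + \<delta>) - \<omega> r)" for r
    using approx_path_component(2)[OF w d] by (rule vector_derivative_at)
  define f where "f r = tensor (approx_path \<delta> \<omega> r - approx_path \<delta> \<omega> s) ((1 / \<delta>) *\<^sub>R (\<omega> (r + \<delta>) - \<omega> r))" for r
  have cf: "continuous_on UNIV f"
    unfolding f_def tensor_def using d
    by (intro continuous_intros approx_path_continuous w continuous_shift) auto
  have int: "set_integrable lborel {s..t} f"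
    unfolding set_integrable_def by (rule borel_integrable_compact) (auto intro: continuous_on_subset[OF cf])
  have bl: "bounded_linear (\<lambda>A::(real ^ 'm) ^ 'm. A $ i $ j)"
    using bounded_linear_compose[OF bounded_linear_vec_nth bounded_linear_vec_nth] .
  have "approx_area \<delta> \<omega> s t $ i $ j = (LBINT r:{s..t}. f r) $ i $ j"
    unfolding approx_area_def vd f_def[symmetric] using st by (simp add: interval_integral_Icc)
  also have "\<dots> = (LBINT r:{s..t}. f r $ i $ j)"
    using integral_bounded_linear[OF bl int[unfolded set_integrable_def]]
    by (simp add: set_lebesgue_integral_def)
  also have "\<dots> = smooth_area \<delta> (\<lambda>r. \<omega> r $ i) (\<lambda>r. \<omega> r $ j) s t"
    unfolding smooth_area_def f_def tensor_def
    by (simp add: approx_path_component(1)[OF w d])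
  finally show ?thesis .
qed

section \<open>Moments of bilinear forms in the increments\<close>

locale wiener =
  fixes W :: "('m::finite) path measure"
  assumes wiener: "two_sided_wiener_measure W"
begin

lemma prob_space_W: "prob_space W"
  using wiener by (simp add: two_sided_wiener_measure_def)

end

sublocale wiener \<subseteq> prob_space W
  by (rule prob_space_W)

context wiener
begin

lemma space_W: "\<omega> \<in> space W \<Longrightarrow> continuous_on UNIV \<omega>" "\<omega> \<in> space W \<Longrightarrow> \<omega> 0 = 0"
  using wiener by (auto simp: two_sided_wiener_measure_def C0_paths_def)

lemma incr_distributed:
  "s < t \<Longrightarrow> distributed W lborel (\<lambda>\<omega>. (\<omega> t - \<omega> s) $ i) (normal_density 0 (sqrt (t - s)))"
  using wiener unfolding two_sided_wiener_measure_def by blast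

lemma incr_indep:
  "strict_mono_on {..n} \<tau> \<Longrightarrow> indep_vars (\<lambda>_. borel)
          (\<lambda>(k, i) \<omega>. (\<omega> (\<tau> (Suc k)) - \<omega> (\<tau> k)) $ i) ({..<n} \<times> UNIV)"
  using wiener unfolding two_sided_wiener_measure_def by blast

text \<open>Having a density includes being measurable, so increments are random variables; a
  coordinate is an increment from or to time 0, where the path vanishes.\<close>

lemma measurable_coord[measurable]: "(\<lambda>\<omega>. \<omega> t $ i) \<in> borel_measurable W"
proof -
  have *: "(\<lambda>\<omega>. (\<omega> t - \<omega> s) $ i) \<in> borel_measurable W" if "s < t" for s t
    using distributed_measurable[OF incr_distributed[OF that]] by simp
  consider "t = 0" | "0 < t" | "t < 0" by linarith
  then show ?thesis
  proof cases
    case 1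
    then show ?thesis by (subst measurable_cong[where g="\<lambda>_. 0"]) (auto simp: space_W)
  next
    case 2
    then show ?thesis using *[of 0 t] by (subst measurable_cong[where g="\<lambda>\<omega>. (\<omega> t - \<omega> 0) $ i"]) (auto simp: space_W)
  next
    case 3
    have "(\<lambda>\<omega>. - ((\<omega> 0 - \<omega> t) $ i)) \<in> borel_measurable W" using *[OF 3] by (rule borel_measurable_uminus)
    then show ?thesis by (subst measurable_cong[where g="\<lambda>\<omega>. - ((\<omega> 0 - \<omega> t) $ i)"]) (auto simp: space_W)
  qed
qed

section \<open>Exponential and polynomial moments of linear forms in the increments\<close>

lemma incr_mgf:
  assumes "s < t"
  shows "(\<integral>\<^sup>+\<omega>. ennreal (exp (a * (\<omega> t - \<omega> s) $ i)) \<partial>W) = ennreal (exp (a\<^sup>2 * (t - s) / 2))"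
proof -
  let ?\<sigma> = "sqrt (t - s)"
  have s: "0 < ?\<sigma>" "?\<sigma>\<^sup>2 = t - s" using assms by auto
  have "(\<integral>\<^sup>+\<omega>. ennreal (exp (a * (\<omega> t - \<omega> s) $ i)) \<partial>W) =
    (\<integral>\<^sup>+x. ennreal (normal_density 0 ?\<sigma> x) * ennreal (exp (a * x)) \<partial>lborel)"
    by (rule distributed_nn_integral[OF incr_distributed[OF assms], symmetric]) auto
  also have "\<dots> = (\<integral>\<^sup>+x. ennreal (exp (a\<^sup>2 * (t - s) / 2)) * ennreal (normal_density (a * (t - s)) ?\<sigma> x) \<partial>lborel)"
  proof (intro nn_integral_cong)
    fix x :: real
    \<comment> \<open>Completing the square: the exponential factor moves the mean of the density to
      \<open>a * (t - s)\<close>.\<close>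
    have "normal_density 0 ?\<sigma> x * exp (a * x) = exp (a\<^sup>2 * (t - s) / 2) * normal_density (a * (t - s)) ?\<sigma> x"
    proof -
      have "- x\<^sup>2 / (2 * (t - s)) + a * x = a\<^sup>2 * (t - s) / 2 + (- (x - a * (t - s))\<^sup>2 / (2 * (t - s)))"
        using assms by (simp add: field_simps power2_eq_square)
      then show ?thesis unfolding normal_density_def s(2) using assms
        by (simp add: exp_add[symmetric])
    qed
    then show "ennreal (normal_density 0 ?\<sigma> x) * ennreal (exp (a * x)) =
       ennreal (exp (a\<^sup>2 * (t - s) / 2)) * ennreal (normal_density (a * (t - s)) ?\<sigma> x)"
      by (simp add: ennreal_mult[symmetric])
  qed
  also have "\<dots> = ennreal (exp (a\<^sup>2 * (t - s) / 2)) * (\<integral>\<^sup>+x. ennreal (normal_density (a * (t - s)) ?\<sigma> x) \<partial>lborel)"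
    by (rule nn_integral_cmult) simp
  also have "(\<integral>\<^sup>+x. ennreal (normal_density (a * (t - s)) ?\<sigma> x) \<partial>lborel) = 1"
    using s(1) by (subst nn_integral_eq_integral) auto
  finally show ?thesis by simp
qed

lemma incr_sum_mgf:
  assumes "strict_mono_on {..n} \<tau>"
  shows "(\<integral>\<^sup>+\<omega>. ennreal (exp (\<Sum>k<n. c k * (\<omega> (\<tau> (Suc k)) - \<omega> (\<tau> k)) $ j)) \<partial>W) =
    ennreal (exp ((\<Sum>k<n. (c k)\<^sup>2 * (\<tau> (Suc k) - \<tau> k)) / 2))"
proof -
  have lt: "\<tau> k < \<tau> (Suc k)" if "k < n" for k using assms that by (auto simp: strict_mono_on_def)
  define X :: "nat \<times> 'm \<Rightarrow> 'm path \<Rightarrow> real" where "X = (\<lambda>(k, i) \<omega>. (\<omega> (\<tau> (Suc k)) - \<omega> (\<tau> k)) $ i)"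
  have ind: "indep_vars (\<lambda>_. borel) X ({..<n} \<times> {j})"
    unfolding X_def by (rule indep_vars_subset[OF incr_indep[OF assms]]) auto
  have pr: "(\<Prod>z\<in>{..<n} \<times> {j}. f z) = (\<Prod>k<n. f (k, j))" for f :: "nat \<times> 'm \<Rightarrow> ennreal"
    using prod.cartesian_product[of "\<lambda>k i. f (k, i)" "{j}" "{..<n}"] by simp
  have "(\<integral>\<^sup>+\<omega>. ennreal (exp (\<Sum>k<n. c k * (\<omega> (\<tau> (Suc k)) - \<omega> (\<tau> k)) $ j)) \<partial>W) =
    (\<integral>\<^sup>+\<omega>. (\<Prod>z\<in>{..<n} \<times> {j}. ennreal (exp (c (fst z) * X z \<omega>))) \<partial>W)"
    unfolding pr by (simp add: exp_sum prod_ennreal X_def)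
  also have "\<dots> = (\<Prod>z\<in>{..<n} \<times> {j}. \<integral>\<^sup>+\<omega>. ennreal (exp (c (fst z) * X z \<omega>)) \<partial>W)"
  proof (rule indep_vars_nn_integral)
    show "indep_vars (\<lambda>_. borel) (\<lambda>z \<omega>. ennreal (exp (c (fst z) * X z \<omega>))) ({..<n} \<times> {j})"
      by (rule indep_vars_compose2[OF ind]) measurable
  qed auto
  also have "\<dots> = (\<Prod>k<n. \<integral>\<^sup>+\<omega>. ennreal (exp (c k * (\<omega> (\<tau> (Suc k)) - \<omega> (\<tau> k)) $ j)) \<partial>W)"
    unfolding pr by (simp add: X_def)
  also have "\<dots> = (\<Prod>k<n. ennreal (exp ((c k)\<^sup>2 * (\<tau> (Suc k) - \<tau> k) / 2)))"
    by (intro prod.cong refl incr_mgf lt) auto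
  also have "\<dots> = ennreal (exp ((\<Sum>k<n. (c k)\<^sup>2 * (\<tau> (Suc k) - \<tau> k)) / 2))"
    by (simp add: prod_ennreal exp_sum sum_divide_distrib)
  finally show ?thesis .
qed

lemma power_le_fact_exp:
  fixes z :: real shows "z ^ (2 * p) \<le> fact (2 * p) * (exp z + exp (- z))"
proof -
  have *: "z ^ n \<le> fact n * exp z" if "0 \<le> z" for z :: real and n
  proof -
    have "z ^ n / fact n \<le> exp z" unfolding exp_def
    proof -
      have "(\<Sum>k\<in>{n}. z ^ k /\<^sub>R fact k) \<le> (\<Sum>k. z ^ k /\<^sub>R fact k)"
        by (rule sum_le_suminf[OF summable_exp_generic[of z]]) (use that in auto)
      then show "z ^ n / fact n \<le> (\<Sum>k. z ^ k /\<^sub>R fact k)" by (simp add: divide_inverse mult.commute)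
    qed
    then show ?thesis by (simp add: field_simps)
  qed
  have "z ^ (2 * p) = \<bar>z\<bar> ^ (2 * p)" by (simp add: power_even_abs)
  also have "\<dots> \<le> fact (2 * p) * exp \<bar>z\<bar>" by (rule *) simp
  also have "\<dots> \<le> fact (2 * p) * (exp z + exp (- z))" by (intro mult_left_mono) (auto simp: abs_if)
  finally show ?thesis .
qed

text \<open>A power is dominated by one term of the exponential series, so the moment generating
  function suffices. The constant is cruder than the exact Gaussian one, but only the power of the
  variance matters later.\<close>

lemma incr_sum_moment:
  assumes t: "strict_mono_on {..n} \<tau>"
  shows "(\<integral>\<^sup>+\<omega>. ennreal ((\<Sum>k<n. c k * (\<omega> (\<tau> (Suc k)) - \<omega> (\<tau> k)) $ j) ^ (2 * p)) \<partial>W) \<le>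
    ennreal (4 * fact (2 * p) * (\<Sum>k<n. (c k)\<^sup>2 * (\<tau> (Suc k) - \<tau> k)) ^ p)"
proof -
  let ?S = "\<lambda>c \<omega>. \<Sum>k<n. c k * (\<omega> (\<tau> (Suc k)) - \<omega> (\<tau> k)) $ j"
  define v where "v = (\<Sum>k<n. (c k)\<^sup>2 * (\<tau> (Suc k) - \<tau> k))"
  have lt: "\<tau> k < \<tau> (Suc k)" if "k < n" for k using t that by (auto simp: strict_mono_on_def)
  have nn: "0 \<le> (c k)\<^sup>2 * (\<tau> (Suc k) - \<tau> k)" if "k < n" for k using lt[OF that] by simp
  have v0: "0 \<le> v" unfolding v_def by (intro sum_nonneg nn) auto
  show ?thesis
  \<comment> \<open>With variance zero all coefficients vanish and the rescaling below is
    impossible. The case \<open>p = 0\<close> is split off there because a zeroth power is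
    1.\<close>
  proof (cases "v = 0")
    case True
    then have "c k = 0" if "k < n" for k
      using sum_nonneg_eq_0_iff[of "{..<n}" "\<lambda>k. (c k)\<^sup>2 * (\<tau> (Suc k) - \<tau> k)"] nn lt[OF that] that
      unfolding v_def by auto
    then have "?S c \<omega> = 0" for \<omega> by (intro sum.neutral) auto
    then show ?thesis using True by (cases p) (auto simp: v_def[symmetric] emeasure_space_1)
  next
    case False
    then have vpos: "0 < v" using v0 by simp
    \<comment> \<open>This scales the form to variance 1, and its exponential moment becomes
      \<open>exp (1 / 2)\<close>, which is at most 2 since \<open>exp 1 \<le> 3\<close>.\<close>
    define lam where "lam = 1 / sqrt v"
    have l: "lam\<^sup>2 = 1 / v" "0 < lam" using vpos by (auto simp: lam_def power_divide)
    have mgf: "(\<integral>\<^sup>+\<omega>. ennreal (exp (e * lam * ?S c \<omega>)) \<partial>W) \<le> 2" if "e\<^sup>2 = 1" for e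
    proof -
      have "(\<integral>\<^sup>+\<omega>. ennreal (exp (e * lam * ?S c \<omega>)) \<partial>W) = (\<integral>\<^sup>+\<omega>. ennreal (exp (?S (\<lambda>k. e * lam * c k) \<omega>)) \<partial>W)"
        by (simp only: sum_distrib_left mult.assoc)
      also have "\<dots> = ennreal (exp ((\<Sum>k<n. (e * lam * c k)\<^sup>2 * (\<tau> (Suc k) - \<tau> k)) / 2))"
        by (rule incr_sum_mgf[OF t])
      also have "(\<Sum>k<n. (e * lam * c k)\<^sup>2 * (\<tau> (Suc k) - \<tau> k)) = lam\<^sup>2 * v"
        unfolding v_def sum_distrib_left using that by (intro sum.cong) (auto simp: power_mult_distrib)
      also have "lam\<^sup>2 * v = 1" using l vpos by simp
      also have "exp (1 / 2 :: real) \<le> 2"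
      proof -
        have "(exp (1 / 2 :: real))\<^sup>2 \<le> 2\<^sup>2" using exp_le by (simp add: exp_double[symmetric])
        then show ?thesis by (rule power2_le_imp_le) simp
      qed
      then have "ennreal (exp (1 / 2)) \<le> ennreal 2" by (rule ennreal_leI)
      finally show ?thesis by simp
    qed
    have "?S c \<omega> ^ (2 * p) \<le> v ^ p * fact (2 * p) * (exp (1 * lam * ?S c \<omega>) + exp (-1 * lam * ?S c \<omega>))" for \<omega>
    proof -
      have "(lam * ?S c \<omega>) ^ (2 * p) \<le> fact (2 * p) * (exp (lam * ?S c \<omega>) + exp (- (lam * ?S c \<omega>)))"
        by (rule power_le_fact_exp)
      then have "v ^ p * (lam * ?S c \<omega>) ^ (2 * p) \<le> v ^ p * (fact (2 * p) * (exp (lam * ?S c \<omega>) + exp (- (lam * ?S c \<omega>))))"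
        using v0 by (intro mult_left_mono) auto
      also have "v ^ p * (lam * ?S c \<omega>) ^ (2 * p) = ?S c \<omega> ^ (2 * p)"
        using vpos by (simp add: power_mult_distrib power_mult l power_divide)
      finally show ?thesis by (simp add: mult.assoc)
    qed
    then have "(\<integral>\<^sup>+\<omega>. ennreal (?S c \<omega> ^ (2 * p)) \<partial>W) \<le>
      (\<integral>\<^sup>+\<omega>. ennreal (v ^ p * fact (2 * p)) * (ennreal (exp (1 * lam * ?S c \<omega>)) + ennreal (exp (-1 * lam * ?S c \<omega>))) \<partial>W)"
      using v0 by (intro nn_integral_mono) (simp add: ennreal_mult[symmetric] ennreal_plus[symmetric] del: ennreal_plus)
    also have "\<dots> = ennreal (v ^ p * fact (2 * p)) *
      ((\<integral>\<^sup>+\<omega>. ennreal (exp (1 * lam * ?S c \<omega>)) \<partial>W) + (\<integral>\<^sup>+\<omega>. ennreal (exp (-1 * lam * ?S c \<omega>)) \<partial>W))"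
      by (subst nn_integral_cmult) (auto simp: nn_integral_add)
    also have "\<dots> \<le> ennreal (v ^ p * fact (2 * p)) * (2 + 2)"
      by (intro mult_left_mono add_mono mgf) auto
    also have "\<dots> = ennreal (4 * fact (2 * p) * v ^ p)"
      using v0 by (simp add: ennreal_mult[symmetric] ennreal_plus[symmetric] mult.commute mult.left_commute del: ennreal_plus flip: ennreal_numeral)
    finally show ?thesis unfolding v_def .
  qed
qed


lemma bilinear_moment:
  fixes \<tau> :: "nat \<Rightarrow> real" and i j :: 'm and n :: nat
  defines "D \<equiv> \<lambda>i \<omega>. \<lambda>k\<in>{..<n}. (\<omega> (\<tau> (Suc k)) - \<omega> (\<tau> k)) $ i"
  assumes t: "strict_mono_on {..n} \<tau>" and ij: "i \<noteq> j"
    and Phi[measurable]: "Phi \<in> borel_measurable (\<Pi>\<^sub>M k\<in>{..<n}. (borel :: real measure))"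
  shows "(\<integral>\<^sup>+\<omega>. Phi (D i \<omega>) * ennreal ((\<Sum>k<n. (\<Sum>l<n. D i \<omega> l * a l k) * D j \<omega> k) ^ (2 * p)) \<partial>W) \<le>
    (\<integral>\<^sup>+\<omega>. Phi (D i \<omega>) *
       ennreal (4 * fact (2 * p) * (\<Sum>k<n. (\<Sum>l<n. D i \<omega> l * a l k)\<^sup>2 * (\<tau> (Suc k) - \<tau> k)) ^ p) \<partial>W)"
proof -
  let ?P = "\<Pi>\<^sub>M k\<in>{..<n}. (borel :: real measure)"
  define X :: "nat \<times> 'm \<Rightarrow> 'm path \<Rightarrow> real" where "X = (\<lambda>(k, i) \<omega>. (\<omega> (\<tau> (Suc k)) - \<omega> (\<tau> k)) $ i)"
  have DX: "D i = (\<lambda>f. \<lambda>k\<in>{..<n}. f (k, i)) \<circ> (\<lambda>\<omega>. restrict (\<lambda>z. X z \<omega>) ({..<n} \<times> {i}))" for i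
    by (auto simp: D_def X_def fun_eq_iff restrict_def)
  have ind0: "indep_vars (\<lambda>_. borel) X ({..<n} \<times> UNIV)"
    unfolding X_def by (rule incr_indep[OF t])
  \<comment> \<open>The increments of components \<open>i\<close> and \<open>j\<close> are disjoint
    blocks of one independent family, since \<open>i \<noteq> j\<close>.\<close>
  have ind: "indep_var ?P (D i) ?P (D j)"
    unfolding DX
    by (rule indep_var_compose[OF indep_var_restrict[OF ind0]])
       (use ij in \<open>auto intro!: measurable_restrict measurable_component_singleton\<close>)
  note rv = indep_var_rv1[OF ind] indep_var_rv2[OF ind]
  note [measurable] = rv
  define h where "h = (\<lambda>(x, y). Phi x * ennreal ((\<Sum>k<n. (\<Sum>l<n. x l * a l k) * y k) ^ (2 * p)))"
  have h[measurable]: "h \<in> borel_measurable (?P \<Otimes>\<^sub>M ?P)"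
    unfolding h_def by measurable
  interpret A: prob_space "distr W ?P (D i)" by (rule prob_space_distr[OF rv(1)])
  interpret B: prob_space "distr W ?P (D j)" by (rule prob_space_distr[OF rv(2)])
  have "(\<integral>\<^sup>+\<omega>. h (D i \<omega>, D j \<omega>) \<partial>W) = (\<integral>\<^sup>+z. h z \<partial>distr W (?P \<Otimes>\<^sub>M ?P) (\<lambda>\<omega>. (D i \<omega>, D j \<omega>)))"
    by (subst nn_integral_distr) auto
  also have "\<dots> = (\<integral>\<^sup>+z. h z \<partial>(distr W ?P (D i) \<Otimes>\<^sub>M distr W ?P (D j)))"
    using ind unfolding indep_var_distribution_eq by simp
  also have "\<dots> = (\<integral>\<^sup>+x. (\<integral>\<^sup>+y. h (x, y) \<partial>distr W ?P (D j)) \<partial>distr W ?P (D i))"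
    by (rule B.nn_integral_fst[symmetric]) measurable
  also have "\<dots> \<le> (\<integral>\<^sup>+x. Phi x * ennreal (4 * fact (2 * p) * (\<Sum>k<n. (\<Sum>l<n. x l * a l k)\<^sup>2 * (\<tau> (Suc k) - \<tau> k)) ^ p) \<partial>distr W ?P (D i))"
  proof (intro nn_integral_mono)
    fix x assume "x \<in> space (distr W ?P (D i))"
    then have [measurable]: "x \<in> space ?P" by simp
    have "(\<integral>\<^sup>+y. h (x, y) \<partial>distr W ?P (D j)) = (\<integral>\<^sup>+\<omega>. h (x, D j \<omega>) \<partial>W)"
      by (subst nn_integral_distr) measurable
    also have "\<dots> = (\<integral>\<^sup>+\<omega>. Phi x * ennreal ((\<Sum>k<n. (\<Sum>l<n. x l * a l k) * (\<omega> (\<tau> (Suc k)) - \<omega> (\<tau> k)) $ j) ^ (2 * p)) \<partial>W)"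
      unfolding h_def D_def by simp
    also have "\<dots> = Phi x * (\<integral>\<^sup>+\<omega>. ennreal ((\<Sum>k<n. (\<Sum>l<n. x l * a l k) * (\<omega> (\<tau> (Suc k)) - \<omega> (\<tau> k)) $ j) ^ (2 * p)) \<partial>W)"
      by (rule nn_integral_cmult) (simp, measurable)
    also have "\<dots> \<le> Phi x * ennreal (4 * fact (2 * p) * (\<Sum>k<n. (\<Sum>l<n. x l * a l k)\<^sup>2 * (\<tau> (Suc k) - \<tau> k)) ^ p)"
      by (intro mult_left_mono incr_sum_moment[OF t]) auto
    finally show "(\<integral>\<^sup>+y. h (x, y) \<partial>distr W ?P (D j)) \<le> \<dots>" .
  qed
  also have "\<dots> = (\<integral>\<^sup>+\<omega>. Phi (D i \<omega>) * ennreal (4 * fact (2 * p) * (\<Sum>k<n. (\<Sum>l<n. D i \<omega> l * a l k)\<^sup>2 * (\<tau> (Suc k) - \<tau> k)) ^ p) \<partial>W)"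
    by (subst nn_integral_distr) measurable
  finally show ?thesis by (simp add: h_def)
qed

lemma strict_mono_grid: "0 < N \<Longrightarrow> strict_mono_on {..n} (grid R N)"
  by (auto simp: strict_mono_on_def grid_def divide_strict_right_mono)

lemma grid_Suc_diff: "grid R N (Suc k) - grid R N k = 1 / N"
  by (simp add: grid_def add_divide_distrib)

definition hoelder_paths :: "real \<Rightarrow> real \<Rightarrow> real \<Rightarrow> 'm path set" where
  "hoelder_paths R \<gamma> K = {\<omega> \<in> space W. \<forall>i. hoelder_up_to 0 R \<gamma> K (\<lambda>r. \<omega> r $ i)}"

lemma grid_path_measurable[measurable]: "(\<lambda>\<omega>. grid_path R N (\<lambda>r. \<omega> r $ i) r) \<in> borel_measurable W"
  unfolding grid_path_def by measurable

lemma smooth_area_grid_measurable: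
  assumes "0 < \<delta>"
  shows "(\<lambda>\<omega>. smooth_area \<delta> (grid_path R N (\<lambda>r. \<omega> r $ i)) (grid_path R N (\<lambda>r. \<omega> r $ j)) s t) \<in> borel_measurable W"
  unfolding smooth_area_grid_right[OF loc_bdd_meas_grid_path] smooth_area_grid_left[OF loc_bdd_meas_step assms]
  by measurable

lemma stieltjes_grid_measurable:
  "(\<lambda>\<omega>. stieltjes_sum n \<pi> (grid_path R N (\<lambda>r. \<omega> r $ i)) (grid_path R N (\<lambda>r. \<omega> r $ j))) \<in> borel_measurable W"
  unfolding stieltjes_sum_def by measurable

lemma continuous_coord: "\<omega> \<in> space W \<Longrightarrow> continuous_on UNIV (\<lambda>r. \<omega> r $ i)"
  by (intro continuous_on_component space_W)

text \<open>On a grid the area is a polynomial in finitely many coordinates, hence measurable, and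
  the pathwise integral is the limit of these.\<close>

lemma smooth_area_measurable:
  assumes "0 < \<delta>" "\<delta> \<le> 1"
  shows "(\<lambda>\<omega>. smooth_area \<delta> (\<lambda>r. \<omega> r $ i) (\<lambda>r. \<omega> r $ j) s t) \<in> borel_measurable W"
proof -
  obtain R :: nat where R: "\<bar>s\<bar> + \<bar>t\<bar> + 2 \<le> real R" using real_arch_simple by blast
  show ?thesis
  proof (rule borel_measurable_LIMSEQ_real)
    fix \<omega> assume w: "\<omega> \<in> space W"
    show "(\<lambda>N. smooth_area \<delta> (grid_path R (Suc N) (\<lambda>r. \<omega> r $ i)) (grid_path R (Suc N) (\<lambda>r. \<omega> r $ j)) s t) \<longlonglongrightarrow>
      smooth_area \<delta> (\<lambda>r. \<omega> r $ i) (\<lambda>r. \<omega> r $ j) s t"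
      by (rule smooth_area_tendsto[OF continuous_coord[OF w] continuous_coord[OF w] assms _ _ R]) auto
  qed (rule smooth_area_grid_measurable[OF assms(1)])
qed

lemma stieltjes_measurable[measurable]:
  "(\<lambda>\<omega>. stieltjes_sum n \<pi> (\<lambda>r. \<omega> r $ i) (\<lambda>r. \<omega> r $ j)) \<in> borel_measurable W"
  unfolding stieltjes_sum_def by measurable

text \<open>On a grid, an area is a bilinear form in the increments of two independent components.
  The truncation to Hoelder paths only involves the first of them.\<close>

lemma grid_area_moment:
  fixes i j :: 'm and R n p :: nat and \<delta> s t :: real and \<pi> :: "nat \<Rightarrow> real"
  defines "err \<equiv> \<lambda>N \<omega>. smooth_area \<delta> (grid_path R N (\<lambda>r. \<omega> r $ i)) (grid_path R N (\<lambda>r. \<omega> r $ j)) s t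
     - stieltjes_sum n \<pi> (grid_path R N (\<lambda>r. \<omega> r $ i)) (grid_path R N (\<lambda>r. \<omega> r $ j))"
  assumes ij: "i \<noteq> j" and d: "0 < \<delta>" "\<delta> \<le> 1" and N: "0 < N" "1 / real N \<le> \<delta>" and K: "0 \<le> K"
    and g: "0 \<le> \<gamma>" "\<gamma> \<le> 1/2"
    and sT: "\<bar>s\<bar> \<le> T" "\<bar>t\<bar> \<le> T" "T + 2 \<le> real R" and st: "\<delta> \<le> t - s"
    and p: "partition_of s t n \<pi>" and mesh: "\<And>k. k < n \<Longrightarrow> \<pi> (Suc k) - \<pi> k \<le> \<delta>"
  obtains F where "F \<in> borel_measurable W" "\<And>\<omega>. \<omega> \<in> hoelder_paths R \<gamma> K \<Longrightarrow> F \<omega> = ennreal (err N \<omega> ^ (2 * p))"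
    "(\<integral>\<^sup>+\<omega>. F \<omega> \<partial>W) \<le> ennreal (4 * fact (2 * p) * (80 * K\<^sup>2 * \<delta> powr (2 * \<gamma>) * (t - s)) ^ p)"
proof -
  define m where "m = 2 * R * N"
  define u where "u k = grid R N (Suc k)" for k
  define \<tau> where "\<tau> = grid R N"
  let ?P = "\<Pi>\<^sub>M k\<in>{..<m}. (borel :: real measure)"
  define D where "D i \<omega> = (\<lambda>k\<in>{..<m}. (\<omega> (\<tau> (Suc k)) - \<omega> (\<tau> k)) $ i)" for i and \<omega> :: "'m path"
  define C where "C = 4 * fact (2 * p) * (80 * K\<^sup>2 * \<delta> powr (2 * \<gamma>) * (t - s)) ^ p"
  \<comment> \<open>Partial sums of the increments are the grid values relative to the first one, so
    Hoelder continuity on the grid is a finite condition on the increment vector.\<close>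
  define good :: "(nat \<Rightarrow> real) \<Rightarrow> bool" where
    "good v \<longleftrightarrow> (\<forall>k\<in>{..m}. \<forall>l\<in>{..m}. \<bar>(\<Sum>q<k. v q) - (\<Sum>q<l. v q)\<bar> \<le> K * \<bar>\<tau> k - \<tau> l\<bar> powr \<gamma>)" for v
  define Phi :: "(nat \<Rightarrow> real) \<Rightarrow> ennreal" where "Phi v = indicator {v \<in> space ?P. good v} v" for v
  define a where "a l k = smooth_area \<delta> (step (u l)) (step (u k)) s t - stieltjes_sum n \<pi> (step (u l)) (step (u k))" for l k
  have sums: "(\<Sum>q<k. D i \<omega> q) = \<omega> (\<tau> k) $ i - \<omega> (\<tau> 0) $ i" if "k \<le> m" for k i \<omega>
  proof -
    have "(\<Sum>q<k. D i \<omega> q) = (\<Sum>q<k. \<omega> (\<tau> (Suc q)) $ i - \<omega> (\<tau> q) $ i)"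
      using that by (intro sum.cong) (auto simp: D_def)
    then show ?thesis by (simp add: sum_lessThan_telescope[of "\<lambda>q. \<omega> (\<tau> q) $ i"])
  qed
  have Dsp: "D i \<omega> \<in> space ?P" for i \<omega> by (simp add: D_def space_PiM)
  have [measurable]: "(\<lambda>v. \<Sum>q<k. v q) \<in> borel_measurable ?P" if "k \<le> m" for k
    using that by (intro borel_measurable_sum measurable_component_singleton) auto
  have "{v \<in> space ?P. good v} \<in> sets ?P"
    unfolding good_def by (intro sets.sets_Collect_finite_All) measurable
  then have Phi[measurable]: "Phi \<in> borel_measurable ?P"
    unfolding Phi_def by measurable
  have coef: "(\<Sum>l<m. D i \<omega> l * a l k) = smooth_area \<delta> (grid_path R N (\<lambda>r. \<omega> r $ i)) (step (u k)) s t
     - stieltjes_sum n \<pi> (grid_path R N (\<lambda>r. \<omega> r $ i)) (step (u k))" for k \<omega>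
    unfolding smooth_area_grid_left[OF loc_bdd_meas_step d(1)] stieltjes_grid_left a_def right_diff_distrib sum_subtractf
    by (simp add: D_def m_def \<tau>_def u_def)
  have err: "err N \<omega> = (\<Sum>k<m. (\<Sum>l<m. D i \<omega> l * a l k) * D j \<omega> k)" for \<omega>
    unfolding err_def coef smooth_area_grid_right[OF loc_bdd_meas_grid_path] stieltjes_grid_right left_diff_distrib sum_subtractf
    by (simp add: D_def m_def \<tau>_def u_def left_diff_distrib right_diff_distrib sum_subtractf mult.commute)
  have sm: "strict_mono_on {..m} \<tau>" unfolding \<tau>_def by (rule strict_mono_grid[OF N(1)])
  have Dm[measurable]: "D i \<in> measurable W ?P" for i
    unfolding D_def[abs_def] by (rule measurable_restrict) simp
  \<comment> \<open>The cut-off \<open>Phi\<close> is larger than the indicator of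
    \<open>hoelder_paths\<close> and equals 1 on that set. Being a function of the increments of
    component \<open>i\<close>, it is an admissible weight in
    \<open>bilinear_moment\<close>.\<close>
  define F where "F \<omega> = Phi (D i \<omega>) * ennreal (err N \<omega> ^ (2 * p))" for \<omega>
  show ?thesis
  proof (rule that)
    have [measurable]: "err N \<in> borel_measurable W"
      unfolding err_def by (intro borel_measurable_diff smooth_area_grid_measurable stieltjes_grid_measurable d)
    show "F \<in> borel_measurable W" unfolding F_def[abs_def] by measurable
    fix \<omega> assume w: "\<omega> \<in> hoelder_paths R \<gamma> K"
    have "good (D i \<omega>)"
      unfolding good_def
    proof (intro ballI)
      fix k l assume kl: "k \<in> {..m}" "l \<in> {..m}"
      have "\<bar>\<tau> k\<bar> \<le> R" "\<bar>\<tau> l\<bar> \<le> R" using kl grid_bounds[OF N(1)] by (auto simp: \<tau>_def m_def)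
      then show "\<bar>(\<Sum>q<k. D i \<omega> q) - (\<Sum>q<l. D i \<omega> q)\<bar> \<le> K * \<bar>\<tau> k - \<tau> l\<bar> powr \<gamma>"
        using w kl by (simp add: sums hoelder_paths_def hoelder_up_to_def)
    qed
    then show "F \<omega> = ennreal (err N \<omega> ^ (2 * p))" using Dsp by (simp add: F_def Phi_def)
  next
    have "(\<integral>\<^sup>+\<omega>. F \<omega> \<partial>W) \<le> (\<integral>\<^sup>+\<omega>. Phi (D i \<omega>) *
       ennreal (4 * fact (2 * p) * (\<Sum>k<m. (\<Sum>l<m. D i \<omega> l * a l k)\<^sup>2 * (\<tau> (Suc k) - \<tau> k)) ^ p) \<partial>W)"
      unfolding F_def err D_def by (rule bilinear_moment[OF sm ij Phi])
    also have "\<dots> \<le> (\<integral>\<^sup>+\<omega>. ennreal C \<partial>W)"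
    proof (intro nn_integral_mono)
      fix \<omega> assume w: "\<omega> \<in> space W"
      show "Phi (D i \<omega>) * ennreal (4 * fact (2 * p) * (\<Sum>k<m. (\<Sum>l<m. D i \<omega> l * a l k)\<^sup>2 * (\<tau> (Suc k) - \<tau> k)) ^ p) \<le> ennreal C"
      proof (cases "good (D i \<omega>)")
        case False
        then show ?thesis by (simp add: Phi_def)
      next
        case True
        have h: "hoelder_up_to (1 / N) R \<gamma> K (grid_path R N (\<lambda>r. \<omega> r $ i))"
        proof (rule hoelder_grid_path[OF _ N(1) K g(1)])
          fix k l assume kl: "k \<le> 2 * R * N" "l \<le> 2 * R * N"
          then have "\<bar>(\<Sum>q<k. D i \<omega> q) - (\<Sum>q<l. D i \<omega> q)\<bar> \<le> K * \<bar>\<tau> k - \<tau> l\<bar> powr \<gamma>"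
            using True unfolding good_def m_def by auto
          then show "\<bar>\<omega> (grid R N k) $ i - \<omega> (grid R N l) $ i\<bar> \<le> K * \<bar>grid R N k - grid R N l\<bar> powr \<gamma>"
            using kl by (simp add: sums m_def \<tau>_def)
        qed
        have "(\<Sum>k<m. (\<Sum>l<m. D i \<omega> l * a l k)\<^sup>2 * (\<tau> (Suc k) - \<tau> k)) \<le> 80 * K\<^sup>2 * \<delta> powr (2 * \<gamma>) * (t - s)"
          unfolding coef \<tau>_def grid_Suc_diff u_def
          by (rule kernel_difference_sum[OF loc_bdd_meas_grid_path d h N K g sT st p mesh])
        moreover have "0 \<le> (\<Sum>k<m. (\<Sum>l<m. D i \<omega> l * a l k)\<^sup>2 * (\<tau> (Suc k) - \<tau> k))"
          by (intro sum_nonneg) (auto simp: \<tau>_def grid_Suc_diff)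
        ultimately have "4 * fact (2 * p) * (\<Sum>k<m. (\<Sum>l<m. D i \<omega> l * a l k)\<^sup>2 * (\<tau> (Suc k) - \<tau> k)) ^ p \<le> C"
          unfolding C_def by (intro mult_left_mono power_mono) auto
        then show ?thesis by (auto simp: Phi_def ennreal_leI split: split_indicator)
      qed
    qed
    also have "\<dots> = ennreal C" by (simp add: emeasure_space_1)
    finally show "(\<integral>\<^sup>+\<omega>. F \<omega> \<partial>W) \<le> ennreal (4 * fact (2 * p) * (80 * K\<^sup>2 * \<delta> powr (2 * \<gamma>) * (t - s)) ^ p)"
      by (simp add: C_def)
  qed
qed

text \<open>On \<open>hoelder_paths\<close> the truncated grid errors converge to the true error,
  and their integrals share one bound, so Fatou's lemma applies. Grids start at \<open>N0\<close>
  with \<open>1 / \<delta> \<le> N0\<close>, so that their mesh never exceeds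
  \<open>\<delta>\<close>.\<close>

lemma area_error_moment:
  fixes i j :: 'm and R n p :: nat and \<delta> s t :: real and \<pi> :: "nat \<Rightarrow> real"
  defines "err \<equiv> \<lambda>\<omega>. smooth_area \<delta> (\<lambda>r. \<omega> r $ i) (\<lambda>r. \<omega> r $ j) s t - stieltjes_sum n \<pi> (\<lambda>r. \<omega> r $ i) (\<lambda>r. \<omega> r $ j)"
  assumes ij: "i \<noteq> j" and d: "0 < \<delta>" "\<delta> \<le> 1" and K: "0 \<le> K"
    and g: "0 \<le> \<gamma>" "\<gamma> \<le> 1/2"
    and sT: "\<bar>s\<bar> \<le> T" "\<bar>t\<bar> \<le> T" "T + 2 \<le> real R" and st: "\<delta> \<le> t - s"
    and p: "partition_of s t n \<pi>" and mesh: "\<And>k. k < n \<Longrightarrow> \<pi> (Suc k) - \<pi> k \<le> \<delta>"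
  shows "(\<integral>\<^sup>+\<omega>. indicator (hoelder_paths R \<gamma> K) \<omega> * ennreal (err \<omega> ^ (2 * p)) \<partial>W)
    \<le> ennreal (4 * fact (2 * p) * (80 * K\<^sup>2 * \<delta> powr (2 * \<gamma>) * (t - s)) ^ p)" (is "_ \<le> ?C")
proof -
  obtain N0 :: nat where N0: "1 / \<delta> \<le> real N0" using real_arch_simple by blast
  define e where "e N \<omega> = smooth_area \<delta> (grid_path R (Suc N) (\<lambda>r. \<omega> r $ i)) (grid_path R (Suc N) (\<lambda>r. \<omega> r $ j)) s t
     - stieltjes_sum n \<pi> (grid_path R (Suc N) (\<lambda>r. \<omega> r $ i)) (grid_path R (Suc N) (\<lambda>r. \<omega> r $ j))" for N and \<omega> :: "'m path"
  have "\<exists>F. \<forall>N. F N \<in> borel_measurable W \<and> (\<forall>\<omega>\<in>hoelder_paths R \<gamma> K. F N \<omega> = ennreal (e (N + N0) \<omega> ^ (2 * p))) \<and>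
    (\<integral>\<^sup>+\<omega>. F N \<omega> \<partial>W) \<le> ?C"
  proof (rule choice, intro allI)
    fix N
    have N: "0 < Suc (N + N0)" "1 / real (Suc (N + N0)) \<le> \<delta>"
    proof -
      have "1 / \<delta> \<le> real (Suc (N + N0))" using N0 by simp
      then show "1 / real (Suc (N + N0)) \<le> \<delta>" using d by (simp add: field_simps)
    qed simp
    show "\<exists>F. F \<in> borel_measurable W \<and> (\<forall>\<omega>\<in>hoelder_paths R \<gamma> K. F \<omega> = ennreal (e (N + N0) \<omega> ^ (2 * p))) \<and>
      (\<integral>\<^sup>+\<omega>. F \<omega> \<partial>W) \<le> ?C"
      by (rule grid_area_moment[OF ij d N K g sT st p mesh, where p=p]) (auto simp: e_def)
  qed
  then obtain F where F[measurable]: "\<And>N. F N \<in> borel_measurable W"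
    and Fe: "\<And>N \<omega>. \<omega> \<in> hoelder_paths R \<gamma> K \<Longrightarrow> F N \<omega> = ennreal (e (N + N0) \<omega> ^ (2 * p))"
    and FC: "\<And>N. (\<integral>\<^sup>+\<omega>. F N \<omega> \<partial>W) \<le> ?C" by blast
  have "(\<integral>\<^sup>+\<omega>. indicator (hoelder_paths R \<gamma> K) \<omega> * ennreal (err \<omega> ^ (2 * p)) \<partial>W) \<le>
     (\<integral>\<^sup>+\<omega>. liminf (\<lambda>N. F N \<omega>) \<partial>W)"
  proof (intro nn_integral_mono)
    fix \<omega> assume w: "\<omega> \<in> space W"
    show "indicator (hoelder_paths R \<gamma> K) \<omega> * ennreal (err \<omega> ^ (2 * p)) \<le> liminf (\<lambda>N. F N \<omega>)"
    proof (cases "\<omega> \<in> hoelder_paths R \<gamma> K")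
      case True
      have R: "\<bar>s\<bar> \<le> real R" "\<bar>t\<bar> \<le> real R" using sT by linarith+
      have "(\<lambda>N. e N \<omega>) \<longlonglongrightarrow> err \<omega>"
        unfolding e_def err_def
        by (intro tendsto_diff smooth_area_tendsto[OF continuous_coord[OF w] continuous_coord[OF w] d sT]
            stieltjes_tendsto[OF continuous_coord[OF w] continuous_coord[OF w] p R])
      then have "(\<lambda>N. e (N + N0) \<omega>) \<longlonglongrightarrow> err \<omega>" by (rule LIMSEQ_ignore_initial_segment)
      then have "(\<lambda>N. F N \<omega>) \<longlonglongrightarrow> ennreal (err \<omega> ^ (2 * p))"
        unfolding Fe[OF True] by (intro tendsto_ennrealI tendsto_power)
      then have "liminf (\<lambda>N. F N \<omega>) = ennreal (err \<omega> ^ (2 * p))"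
        by (intro lim_imp_Liminf) auto
      then show ?thesis using True by simp
    qed simp
  qed
  also have "\<dots> \<le> liminf (\<lambda>N. \<integral>\<^sup>+\<omega>. F N \<omega> \<partial>W)" by (rule nn_integral_liminf) simp
  also have "\<dots> \<le> liminf (\<lambda>N. ?C)" by (intro Liminf_mono always_eventually allI FC)
  also have "\<dots> = ?C" by (simp add: Liminf_const)
  finally show ?thesis .
qed

end

section \<open>Reduction to a grid\<close>

text \<open>Rounding down to multiples of \<open>1 / (n + 1)\<close> is monotone, so ordered pairs
  of times stay ordered, and it fixes integers, so intervals with integer ends are not left.\<close>

definition rat_below :: "real \<Rightarrow> nat \<Rightarrow> rat" where
  "rat_below a n = of_int \<lfloor>a * real (Suc n)\<rfloor> / of_nat (Suc n)"

lemma rat_below_eq: "real_of_rat (rat_below a n) = real_of_int \<lfloor>a * real (Suc n)\<rfloor> / real (Suc n)"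
  unfolding rat_below_def of_rat_divide of_rat_of_int_eq of_rat_of_nat_eq ..

lemma rat_below_mono: "a \<le> b \<Longrightarrow> rat_below a n \<le> rat_below b n"
  unfolding rat_below_def by (intro divide_right_mono) (auto intro!: floor_mono mult_right_mono)

lemma rat_below_of_int: "rat_below (of_int z) n = of_int z"
proof -
  have "real_of_int z * real (Suc n) = real_of_int (z * int (Suc n))"
    by (simp only: of_int_mult of_int_of_nat_eq)
  then show ?thesis unfolding rat_below_def by (simp only: floor_of_int) (simp del: of_nat_Suc)
qed

lemma rat_below_bound: "\<bar>a\<bar> \<le> real R \<Longrightarrow> \<bar>real_of_rat (rat_below a n)\<bar> \<le> real R"
proof -
  assume a: "\<bar>a\<bar> \<le> real R"
  have "rat_below a n \<le> rat_below (of_int (int R)) n" "rat_below (of_int (- int R)) n \<le> rat_below a n"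
    using a by (auto intro!: rat_below_mono)
  then have "real_of_rat (rat_below a n) \<le> real_of_rat (of_int (int R))"
    "real_of_rat (of_int (- int R)) \<le> real_of_rat (rat_below a n)"
    unfolding rat_below_of_int by (simp_all only: of_rat_less_eq)
  moreover have "real_of_rat (of_int (int R)) = real R" "real_of_rat (of_int (- int R)) = - real R"
    by (simp_all add: of_rat_minus)
  ultimately show ?thesis by linarith
qed

lemma rat_below_tendsto: "(\<lambda>n. real_of_rat (rat_below a n)) \<longlonglongrightarrow> a"
proof -
  have "(\<lambda>n. real_of_rat (rat_below a n) - a) \<longlonglongrightarrow> 0"
  proof (rule Lim_null_comparison[OF _ LIMSEQ_Suc[OF lim_1_over_n]], intro always_eventually allI)
    fix n
    have "\<bar>real_of_int \<lfloor>a * real (Suc n)\<rfloor> - a * real (Suc n)\<bar> \<le> 1" by linarith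
    then have "\<bar>(real_of_int \<lfloor>a * real (Suc n)\<rfloor> - a * real (Suc n)) / real (Suc n)\<bar> \<le> 1 / real (Suc n)"
      unfolding abs_divide by (intro frac_le) auto
    then show "norm (real_of_rat (rat_below a n) - a) \<le> 1 / real (Suc n)"
      by (simp add: rat_below_eq diff_divide_distrib)
  qed
  then show ?thesis by (simp add: LIM_zero_iff)
qed

lemma hoelder_up_to_rat:
  assumes x: "continuous_on UNIV x" and g: "0 < \<gamma>"
    and r: "\<And>(a::rat) (b::rat). \<bar>real_of_rat a\<bar> \<le> real R \<Longrightarrow> \<bar>real_of_rat b\<bar> \<le> real R \<Longrightarrow>
      \<bar>x (of_rat a) - x (of_rat b)\<bar> \<le> K * \<bar>of_rat a - of_rat b\<bar> powr \<gamma>"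
  shows "hoelder_up_to 0 (real R) \<gamma> K x"
  unfolding hoelder_up_to_def
proof (intro allI impI)
  fix a b assume ab: "\<bar>a\<bar> \<le> real R" "\<bar>b\<bar> \<le> real R"
  have c: "(\<lambda>n. x (of_rat (rat_below a n))) \<longlonglongrightarrow> x a" for a
    using x by (intro isCont_tendsto_compose[OF _ rat_below_tendsto]) (simp add: continuous_on_eq_continuous_at)
  show "\<bar>x a - x b\<bar> \<le> K * (\<bar>a - b\<bar> + 0) powr \<gamma>"
  proof (rule LIMSEQ_le)
    show "(\<lambda>n. \<bar>x (of_rat (rat_below a n)) - x (of_rat (rat_below b n))\<bar>) \<longlonglongrightarrow> \<bar>x a - x b\<bar>"
      by (intro tendsto_intros c)
    show "(\<lambda>n. K * \<bar>real_of_rat (rat_below a n) - of_rat (rat_below b n)\<bar> powr \<gamma>) \<longlonglongrightarrow> K * (\<bar>a - b\<bar> + 0) powr \<gamma>"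
      using g by (intro tendsto_mult tendsto_powr' tendsto_intros) (auto intro!: tendsto_rabs tendsto_diff rat_below_tendsto)
    show "\<exists>N. \<forall>n\<ge>N. \<bar>x (of_rat (rat_below a n)) - x (of_rat (rat_below b n))\<bar>
        \<le> K * \<bar>real_of_rat (rat_below a n) - of_rat (rat_below b n)\<bar> powr \<gamma>"
      using r rat_below_bound[OF ab(1)] rat_below_bound[OF ab(2)] by blast
  qed
qed

section \<open>Deterministic bounds at one scale\<close>

lemma small_area:
  assumes x: "loc_bdd_meas x" "hoelder_up_to 0 R \<gamma> K x" and y: "loc_bdd_meas y" "hoelder_up_to 0 R \<gamma> K y"
    and e: "0 < \<epsilon>" "\<epsilon> \<le> 1" and K: "0 \<le> K" and g: "0 \<le> \<gamma>"
    and sT: "\<bar>s\<bar> \<le> T" "\<bar>t\<bar> \<le> T" "T + 2 \<le> R" and st: "s \<le> t"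
  shows "\<bar>smooth_area \<epsilon> x y s t\<bar> \<le> K\<^sup>2 * (t - s) powr (1 + \<gamma>) * \<epsilon> powr (\<gamma> - 1)"
proof -
  have "\<bar>smooth_area \<epsilon> x y s t\<bar> \<le> (K * (t - s) powr \<gamma> * (K * \<epsilon> powr \<gamma> / \<epsilon>)) * (t - s)"
    unfolding smooth_area_def
  proof (rule integral_bound[OF loc_bdd_meas_smooth_area_integrand[OF x(1) y(1)] st])
    fix r assume r: "r \<in> {s..t}"
    have rT: "\<bar>r\<bar> \<le> T" using r sT by auto
    have m: "\<bar>mean \<epsilon> x r - mean \<epsilon> x s\<bar> \<le> K * (t - s) powr \<gamma>"
    proof (rule mean_incr_le[OF x(1) e(1) x(2) _ K g])
      show "\<bar>r\<bar> + \<epsilon> \<le> R" "\<bar>s\<bar> + \<epsilon> \<le> R" using rT sT e(2) by linarith+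
      show "\<bar>r - s\<bar> + 0 \<le> t - s" using r by simp
    qed simp
    have "\<bar>y (r + \<epsilon>) - y r\<bar> \<le> K * \<epsilon> powr \<gamma>"
    proof (rule hoelder_up_toD[OF y(2) _ _ _ _ K g])
      show "\<bar>r + \<epsilon>\<bar> \<le> R" "\<bar>r\<bar> \<le> R" using rT sT e by linarith+
      show "\<bar>r + \<epsilon> - r\<bar> + 0 \<le> \<epsilon>" using e by simp
    qed simp
    then have "\<bar>(y (r + \<epsilon>) - y r) / \<epsilon>\<bar> \<le> K * \<epsilon> powr \<gamma> / \<epsilon>"
      using e by (simp add: divide_right_mono)
    with m show "\<bar>(mean \<epsilon> x r - mean \<epsilon> x s) * ((y (r + \<epsilon>) - y r) / \<epsilon>)\<bar> \<le> K * (t - s) powr \<gamma> * (K * \<epsilon> powr \<gamma> / \<epsilon>)"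
      unfolding abs_mult using K by (intro mult_mono) auto
  qed
  also have "\<dots> = K\<^sup>2 * (t - s) powr (1 + \<gamma>) * \<epsilon> powr (\<gamma> - 1)"
    using st e by (cases "s = t") (simp_all add: powr_add powr_diff power2_eq_square)
  finally show ?thesis .
qed

text \<open>For \<open>\<epsilon>\<close> between \<open>\<delta> / 2\<close> and
  \<open>\<delta>\<close> the blow-up \<open>\<epsilon> powr (\<gamma> - 1)\<close> costs only a
  factor 2 in terms of \<open>\<delta>\<close>. The bound is useful for \<open>t - s\<close> up to
  the order of \<open>\<delta>\<close>.\<close>

lemma small_area_scale:
  assumes x: "loc_bdd_meas x" "hoelder_up_to 0 R \<gamma> K x" and y: "loc_bdd_meas y" "hoelder_up_to 0 R \<gamma> K y"
    and e: "0 < \<epsilon>" "\<epsilon> \<le> \<delta>" "\<delta> \<le> 2 * \<epsilon>" "\<delta> \<le> 1" and K: "0 \<le> K" and g: "0 \<le> \<gamma>" "\<gamma> \<le> 1"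
    and sT: "\<bar>s\<bar> \<le> T" "\<bar>t\<bar> \<le> T" "T + 2 \<le> R" and st: "s \<le> t"
  shows "\<bar>smooth_area \<epsilon> x y s t\<bar> \<le> 2 * K\<^sup>2 * ((t - s) powr (1 + \<gamma>) * \<delta> powr (\<gamma> - 1))"
proof -
  have "\<epsilon> powr (\<gamma> - 1) \<le> (\<delta> / 2) powr (\<gamma> - 1)" using e g by (intro powr_mono2') auto
  also have "\<dots> = \<delta> powr (\<gamma> - 1) * 2 powr (1 - \<gamma>)"
    using e powr_minus_divide[of 2 "\<gamma> - 1"] by (simp add: powr_divide)
  also have "\<dots> \<le> \<delta> powr (\<gamma> - 1) * 2 powr 1" using g by (intro mult_left_mono powr_mono) auto
  finally have "\<epsilon> powr (\<gamma> - 1) \<le> 2 * \<delta> powr (\<gamma> - 1)" by simp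
  then have "K\<^sup>2 * (t - s) powr (1 + \<gamma>) * \<epsilon> powr (\<gamma> - 1) \<le> K\<^sup>2 * (t - s) powr (1 + \<gamma>) * (2 * \<delta> powr (\<gamma> - 1))"
    by (intro mult_left_mono) auto
  moreover have "\<bar>smooth_area \<epsilon> x y s t\<bar> \<le> K\<^sup>2 * (t - s) powr (1 + \<gamma>) * \<epsilon> powr (\<gamma> - 1)"
    by (rule small_area[OF x y e(1) _ K g(1) sT st]) (use e in simp)
  ultimately show ?thesis by (simp add: algebra_simps)
qed

text \<open>An area at the scale \<open>\<delta>\<close> is controlled by its values on a grid of mesh \<open>\<delta>\<^sup>8\<close>,
  so that a union bound over polynomially many pairs of times replaces a chaining argument.\<close>

lemma grid_approximation:
  assumes x: "continuous_on UNIV x" "hoelder_up_to 0 R \<gamma> K x" and y: "continuous_on UNIV y" "hoelder_up_to 0 R \<gamma> K y"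
    and e: "0 < \<epsilon>" "\<epsilon> \<le> \<delta>" "\<delta> \<le> 2 * \<epsilon>" "\<delta> \<le> 1" and K: "0 \<le> K" and g: "1 / 4 \<le> \<gamma>" "\<gamma> \<le> 1"
    and sT: "\<bar>s\<bar> \<le> T" "\<bar>t\<bar> \<le> T" "T + 2 \<le> R"
    and st: "s \<le> s'" "s' \<le> t'" "t' \<le> t" "s' - s \<le> \<delta> ^ 8" "t - t' \<le> \<delta> ^ 8"
  shows "\<bar>smooth_area \<epsilon> x y s t - smooth_area \<epsilon> x y s' t'\<bar> \<le> (6 + 4 * T) * K\<^sup>2 * \<delta>\<^sup>2"
proof -
  have d: "0 < \<delta>" using e by simp
  have T: "0 \<le> T" using sT by linarith
  have e1: "\<epsilon> \<le> 1" using e by simp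
  have g0: "0 \<le> \<gamma>" using g by simp
  \<comment> \<open>This is where the exponent 8 and the lower bound 1/4 on \<open>\<gamma>\<close>
    meet: \<open>8 * \<gamma> \<ge> 2\<close> and \<open>\<delta> \<le> 1\<close>.\<close>
  have hg: "(\<delta> ^ 8) powr \<gamma> \<le> \<delta>\<^sup>2"
  proof -
    have "(\<delta> ^ 8) powr \<gamma> = (\<delta> powr 8) powr \<gamma>" using d by simp
    also have "\<dots> = \<delta> powr (8 * \<gamma>)" by (rule powr_powr)
    also have "\<dots> \<le> \<delta> powr 2" using d e g by (intro powr_mono') auto
    finally show ?thesis using d by simp
  qed
  have lx: "loc_bdd_meas x" and ly: "loc_bdd_meas y" using x y by (auto intro: loc_bdd_meas_continuous)
  have in1: "\<bar>mean \<epsilon> z b - mean \<epsilon> z a\<bar> \<le> K * (b - a) powr \<gamma>"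
    if "s \<le> a" "a \<le> b" "b \<le> t" "loc_bdd_meas z" "hoelder_up_to 0 R \<gamma> K z" for a b z
  proof (rule mean_incr_le[OF that(4) e(1) that(5) _ K])
    have "\<bar>a\<bar> \<le> T" "\<bar>b\<bar> \<le> T" using that sT by linarith+
    then show "\<bar>a\<bar> + \<epsilon> \<le> R" "\<bar>b\<bar> + \<epsilon> \<le> R" using sT e1 by linarith+
  qed (use that g in auto)
  have short: "K * (b - a) powr \<gamma> \<le> K * \<delta>\<^sup>2" if "a \<le> b" "b - a \<le> \<delta> ^ 8" for a b
  proof -
    have "(b - a) powr \<gamma> \<le> (\<delta> ^ 8) powr \<gamma>" using that g by (intro powr_mono2) auto
    then show ?thesis using hg K by (intro mult_left_mono) auto
  qed
  have long: "K * (b - a) powr \<gamma> \<le> K * (2 * T + 1)" if "s \<le> a" "a \<le> b" "b \<le> t" for a b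
  proof -
    have "0 \<le> b - a" "b - a \<le> 2 * T + 1" using that sT by linarith+
    then have "(b - a) powr \<gamma> \<le> (2 * T + 1) powr \<gamma>" by (intro powr_mono2 g0)
    also have "\<dots> \<le> (2 * T + 1) powr 1" using T g by (intro powr_mono) auto
    finally show ?thesis using K T by (intro mult_left_mono) auto
  qed
  have smallA: "\<bar>smooth_area \<epsilon> x y a b\<bar> \<le> 2 * K\<^sup>2 * \<delta>\<^sup>2" if ab: "s \<le> a" "a \<le> b" "b \<le> t" "b - a \<le> \<delta> ^ 8" for a b
  proof -
    have abT: "\<bar>a\<bar> \<le> T" "\<bar>b\<bar> \<le> T" using ab sT by linarith+
    have "\<bar>smooth_area \<epsilon> x y a b\<bar> \<le> 2 * K\<^sup>2 * ((b - a) powr (1 + \<gamma>) * \<delta> powr (\<gamma> - 1))"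
      by (rule small_area_scale[OF lx x(2) ly y(2) e K g0 g(2) abT sT(3) ab(2)])
    also have "\<dots> \<le> 2 * K\<^sup>2 * \<delta>\<^sup>2"
    \<comment> \<open>One factor \<open>(b - a) powr \<gamma>\<close> supplies
      \<open>\<delta>\<close> squared; the remaining \<open>b - a \<le> \<delta>\<close> compensates
      the negative power of \<open>\<delta>\<close>.\<close>
    proof (intro mult_left_mono)
      have b8: "b - a \<le> \<delta>" using ab(4) power_decreasing[of 1 8 \<delta>] d e by simp
      have "(b - a) powr (1 + \<gamma>) * \<delta> powr (\<gamma> - 1) = (b - a) powr \<gamma> * ((b - a) * \<delta> powr (\<gamma> - 1))"
        using ab(2) by (cases "a = b") (simp_all add: powr_add mult.assoc mult.left_commute)
      also have "\<dots> \<le> \<delta>\<^sup>2 * (\<delta> * \<delta> powr (\<gamma> - 1))"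
      proof (intro mult_mono)
        have "(b - a) powr \<gamma> \<le> (\<delta> ^ 8) powr \<gamma>" using ab g by (intro powr_mono2) auto
        then show "(b - a) powr \<gamma> \<le> \<delta>\<^sup>2" using hg by linarith
      qed (use b8 ab d in auto)
      also have "\<delta> * \<delta> powr (\<gamma> - 1) = \<delta> powr \<gamma>" using d by (simp add: powr_diff)
      also have "\<dots> \<le> 1" using d e g by (intro powr_le1) auto
      finally show "(b - a) powr (1 + \<gamma>) * \<delta> powr (\<gamma> - 1) \<le> \<delta>\<^sup>2" using d by (simp add: mult_left_mono)
    qed simp
    finally show ?thesis .
  qed
  \<comment> \<open>Chen's relation is applied twice, cutting off \<open>[t', t]\<close> and then
    \<open>[s, s']\<close>. The two short areas cost 2 each and the two products
    \<open>2 * T + 1\<close> each, in total \<open>6 + 4 * T\<close>.\<close>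
  have "smooth_area \<epsilon> x y s t = smooth_area \<epsilon> x y s t' + smooth_area \<epsilon> x y t' t +
      (mean \<epsilon> x t' - mean \<epsilon> x s) * (mean \<epsilon> y t - mean \<epsilon> y t')"
    by (rule smooth_area_chen[OF x(1) y(1) e(1)]) (use st in auto)
  moreover have "smooth_area \<epsilon> x y s t' = smooth_area \<epsilon> x y s s' + smooth_area \<epsilon> x y s' t' +
      (mean \<epsilon> x s' - mean \<epsilon> x s) * (mean \<epsilon> y t' - mean \<epsilon> y s')"
    by (rule smooth_area_chen[OF x(1) y(1) e(1)]) (use st in auto)
  moreover have "\<bar>smooth_area \<epsilon> x y t' t\<bar> \<le> 2 * K\<^sup>2 * \<delta>\<^sup>2" "\<bar>smooth_area \<epsilon> x y s s'\<bar> \<le> 2 * K\<^sup>2 * \<delta>\<^sup>2"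
    using st by (auto intro!: smallA)
  moreover have "\<bar>(mean \<epsilon> x t' - mean \<epsilon> x s) * (mean \<epsilon> y t - mean \<epsilon> y t')\<bar> \<le> (K * (2 * T + 1)) * (K * \<delta>\<^sup>2)"
    unfolding abs_mult
  proof (intro mult_mono)
    show "\<bar>mean \<epsilon> x t' - mean \<epsilon> x s\<bar> \<le> K * (2 * T + 1)"
      using in1[of s t' x] long[of s t'] st lx x(2) by linarith
    show "\<bar>mean \<epsilon> y t - mean \<epsilon> y t'\<bar> \<le> K * \<delta>\<^sup>2"
      using in1[of t' t y] short[of t' t] st ly y(2) by linarith
  qed (use K T in auto)
  moreover have "\<bar>(mean \<epsilon> x s' - mean \<epsilon> x s) * (mean \<epsilon> y t' - mean \<epsilon> y s')\<bar> \<le> (K * \<delta>\<^sup>2) * (K * (2 * T + 1))"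
    unfolding abs_mult
  proof (intro mult_mono)
    show "\<bar>mean \<epsilon> y t' - mean \<epsilon> y s'\<bar> \<le> K * (2 * T + 1)"
      using in1[of s' t' y] long[of s' t'] st ly y(2) by linarith
    show "\<bar>mean \<epsilon> x s' - mean \<epsilon> x s\<bar> \<le> K * \<delta>\<^sup>2"
      using in1[of s s' x] short[of s s'] st lx x(2) by linarith
  qed (use K T in auto)
  ultimately have "\<bar>smooth_area \<epsilon> x y s t - smooth_area \<epsilon> x y s' t'\<bar> \<le>
      2 * K\<^sup>2 * \<delta>\<^sup>2 + 2 * K\<^sup>2 * \<delta>\<^sup>2 + (K * (2 * T + 1)) * (K * \<delta>\<^sup>2) + (K * \<delta>\<^sup>2) * (K * (2 * T + 1))"
    by linarith
  also have "\<dots> = (6 + 4 * T) * K\<^sup>2 * \<delta>\<^sup>2" by (simp add: power2_eq_square algebra_simps)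
  finally show ?thesis .
qed

text \<open>Close times are handled without comparing the scales, since each area alone is small
  there. For other times the ends are moved inwards to multiples of \<open>\<delta> ^ 8\<close>. The
  first case needs 36 and the second \<open>12 + 8 * T\<close> in front of \<open>K\<close> squared;
  their sum is the constant.\<close>

lemma off_grid:
  assumes x: "continuous_on UNIV x" "hoelder_up_to 0 R \<gamma> K x" and y: "continuous_on UNIV y" "hoelder_up_to 0 R \<gamma> K y"
    and e: "0 < \<epsilon>" "\<epsilon> \<le> \<delta>" "\<delta> \<le> 2 * \<epsilon>" "\<delta> \<le> 1" and K: "0 \<le> K"
    and g: "1 / 4 \<le> \<beta>" "\<beta> < \<gamma>" "\<gamma> \<le> 1 / 2"
    and sT: "\<bar>s\<bar> \<le> T" "\<bar>t\<bar> \<le> T" "T + 2 \<le> R" and st: "s < t"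
    and grid: "\<And>(a::int) (b::int). \<bar>a * \<delta> ^ 8\<bar> \<le> T \<Longrightarrow> \<bar>b * \<delta> ^ 8\<bar> \<le> T \<Longrightarrow> \<delta> \<le> b * \<delta> ^ 8 - a * \<delta> ^ 8 \<Longrightarrow>
      \<bar>smooth_area \<delta> x y (a * \<delta> ^ 8) (b * \<delta> ^ 8) - smooth_area \<epsilon> x y (a * \<delta> ^ 8) (b * \<delta> ^ 8)\<bar>
        \<le> \<delta> powr (\<gamma> - \<beta>) * (b * \<delta> ^ 8 - a * \<delta> ^ 8) powr (2 * \<beta>)"
  shows "\<bar>smooth_area \<delta> x y s t - smooth_area \<epsilon> x y s t\<bar> \<le> (1 + (48 + 8 * T) * K\<^sup>2) * (\<delta> powr (\<gamma> - \<beta>) * (t - s) powr (2 * \<beta>))"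
proof -
  have d: "0 < \<delta>" using e by simp
  have T: "0 \<le> T" using sT by linarith
  have lx: "loc_bdd_meas x" and ly: "loc_bdd_meas y" using x y by (auto intro: loc_bdd_meas_continuous)
  define M where "M = \<delta> powr (\<gamma> - \<beta>) * (t - s) powr (2 * \<beta>)"
  have M0: "0 \<le> M" unfolding M_def by simp
  have "\<bar>smooth_area \<delta> x y s t - smooth_area \<epsilon> x y s t\<bar> \<le> (1 + (48 + 8 * T) * K\<^sup>2) * M"
  \<comment> \<open>The threshold \<open>3 * \<delta>\<close> leaves room to round both ends by at
    most \<open>\<delta>\<close> and keep them \<open>\<delta>\<close> apart.\<close>
  proof (cases "t - s \<le> 3 * \<delta>")
    case True
    have sm: "(t - s) powr (1 + \<gamma>) * \<delta> powr (\<gamma> - 1) \<le> 9 * M"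
    proof -
      have "(t - s) powr (1 + \<gamma> - 2 * \<beta>) \<le> (3 * \<delta>) powr (1 + \<gamma> - 2 * \<beta>)"
        using True st g by (intro powr_mono2) auto
      also have "\<dots> = 3 powr (1 + \<gamma> - 2 * \<beta>) * \<delta> powr (1 + \<gamma> - 2 * \<beta>)" using d by (simp add: powr_mult)
      also have "\<dots> \<le> 3 powr 2 * \<delta> powr (1 + \<gamma> - 2 * \<beta>)" using g by (intro mult_right_mono powr_mono) auto
      finally have 1: "(t - s) powr (1 + \<gamma> - 2 * \<beta>) \<le> 9 * \<delta> powr (1 + \<gamma> - 2 * \<beta>)" by simp
      have "(t - s) powr (1 + \<gamma>) * \<delta> powr (\<gamma> - 1) =
         (t - s) powr (2 * \<beta>) * ((t - s) powr (1 + \<gamma> - 2 * \<beta>) * \<delta> powr (\<gamma> - 1))"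
        using st by (simp add: powr_add[symmetric] mult.assoc[symmetric])
      also have "\<dots> \<le> (t - s) powr (2 * \<beta>) * (9 * \<delta> powr (1 + \<gamma> - 2 * \<beta>) * \<delta> powr (\<gamma> - 1))"
        by (intro mult_left_mono mult_right_mono 1) auto
      also have "9 * \<delta> powr (1 + \<gamma> - 2 * \<beta>) * \<delta> powr (\<gamma> - 1) = 9 * \<delta> powr (2 * (\<gamma> - \<beta>))"
        by (simp add: powr_add[symmetric] algebra_simps)
      also have "\<delta> powr (2 * (\<gamma> - \<beta>)) \<le> \<delta> powr (\<gamma> - \<beta>)" using d e g by (intro powr_mono') auto
      finally have "(t - s) powr (1 + \<gamma>) * \<delta> powr (\<gamma> - 1) \<le> (t - s) powr (2 * \<beta>) * (9 * \<delta> powr (\<gamma> - \<beta>))"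
        by (simp add: mult_left_mono)
      then show ?thesis by (simp add: M_def mult.commute mult.left_commute)
    qed
    have b: "\<bar>smooth_area \<epsilon>' x y s t\<bar> \<le> 18 * K\<^sup>2 * M" if "0 < \<epsilon>'" "\<epsilon>' \<le> \<delta>" "\<delta> \<le> 2 * \<epsilon>'" for \<epsilon>'
    proof -
      have "\<bar>smooth_area \<epsilon>' x y s t\<bar> \<le> 2 * K\<^sup>2 * ((t - s) powr (1 + \<gamma>) * \<delta> powr (\<gamma> - 1))"
        by (rule small_area_scale[OF lx x(2) ly y(2) that e(4) K _ _ sT]) (use g st in auto)
      also have "\<dots> \<le> 2 * K\<^sup>2 * (9 * M)" by (intro mult_left_mono sm) auto
      finally show ?thesis by simp
    qed
    have "\<bar>smooth_area \<delta> x y s t - smooth_area \<epsilon> x y s t\<bar> \<le> 36 * K\<^sup>2 * M"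
      using b[of \<delta>] b[of \<epsilon>] e d by linarith
    also have "\<dots> \<le> (1 + (48 + 8 * T) * K\<^sup>2) * M"
      using M0 T by (intro mult_right_mono) (auto simp: algebra_simps)
    finally show ?thesis .
  next
    case False
    define h where "h = \<delta> ^ 8"
    have h: "0 < h" "h \<le> \<delta>" unfolding h_def using d e power_decreasing[of 1 8 \<delta>] by auto
    define a where "a = \<lceil>s / h\<rceil>"
    define b where "b = \<lfloor>t / h\<rfloor>"
    have a: "s \<le> a * h" "a * h \<le> s + h"
    proof -
      have "s / h \<le> a" "real_of_int a \<le> s / h + 1" unfolding a_def by linarith+
      then show "s \<le> a * h" "a * h \<le> s + h" using h by (simp_all add: field_simps)
    qed
    have b: "b * h \<le> t" "t - h \<le> b * h"
    proof -
      have "b \<le> t / h" "t / h - 1 \<le> real_of_int b" unfolding b_def by linarith+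
      then show "b * h \<le> t" "t - h \<le> b * h" using h by (simp_all add: field_simps)
    qed
    have ab: "\<delta> \<le> b * h - a * h" using a b h False by linarith
    have abT: "\<bar>a * h\<bar> \<le> T" "\<bar>b * h\<bar> \<le> T" using a b ab d sT by linarith+
    have "\<bar>smooth_area \<delta> x y (a * h) (b * h) - smooth_area \<epsilon> x y (a * h) (b * h)\<bar>
        \<le> \<delta> powr (\<gamma> - \<beta>) * (b * h - a * h) powr (2 * \<beta>)"
      using grid[of a b] abT ab unfolding h_def by blast
    also have "\<dots> \<le> M"
      unfolding M_def using a b ab d g by (intro mult_left_mono powr_mono2) auto
    finally have 1: "\<bar>smooth_area \<delta> x y (a * h) (b * h) - smooth_area \<epsilon> x y (a * h) (b * h)\<bar> \<le> M" .
    \<comment> \<open>The cost of moving to the grid is of order \<open>\<delta>\<close> squared,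
      which is below \<open>M\<close> because \<open>\<gamma> + \<beta> \<le> 2\<close> and
      \<open>\<delta> \<le> t - s\<close>.\<close>
    have 2: "\<bar>smooth_area \<epsilon>' x y s t - smooth_area \<epsilon>' x y (a * h) (b * h)\<bar> \<le> (6 + 4 * T) * K\<^sup>2 * \<delta>\<^sup>2"
      if "0 < \<epsilon>'" "\<epsilon>' \<le> \<delta>" "\<delta> \<le> 2 * \<epsilon>'" for \<epsilon>'
    proof (rule grid_approximation[OF x y that e(4) K _ _ sT])
      show "a * h \<le> b * h" using ab d by linarith
    qed (use a b g in \<open>auto simp: h_def[symmetric]\<close>)
    have "\<delta>\<^sup>2 = \<delta> powr 2" using d by simp
    also have "\<dots> \<le> \<delta> powr (\<gamma> - \<beta> + 2 * \<beta>)" using d e g by (intro powr_mono') auto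
    also have "\<dots> = \<delta> powr (\<gamma> - \<beta>) * \<delta> powr (2 * \<beta>)" by (rule powr_add)
    also have "\<dots> \<le> M" unfolding M_def using False d g by (intro mult_left_mono powr_mono2) auto
    finally have "\<delta>\<^sup>2 \<le> M" .
    then have 3: "(6 + 4 * T) * K\<^sup>2 * \<delta>\<^sup>2 \<le> (6 + 4 * T) * K\<^sup>2 * M" using T by (intro mult_left_mono) auto
    have "\<bar>smooth_area \<delta> x y s t - smooth_area \<epsilon> x y s t\<bar> \<le> M + 2 * ((6 + 4 * T) * K\<^sup>2 * M)"
      using 1 2[of \<delta>] 2[of \<epsilon>] 3 e d by linarith
    also have "\<dots> \<le> (1 + (48 + 8 * T) * K\<^sup>2) * M" using M0 T by (simp add: algebra_simps)
    finally show ?thesis .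
  qed
  then show ?thesis by (simp add: M_def)
qed

section \<open>Moment bounds and bad events\<close>

lemma fine_partition:
  assumes "s \<le> t" "0 < \<eta>"
  obtains n \<pi> where "partition_of s t n \<pi>" "\<And>k. k < n \<Longrightarrow> \<pi> (Suc k) - \<pi> k < \<eta>"
proof -
  obtain n0 :: nat where n0: "(t - s) / \<eta> < real n0" using reals_Archimedean2 by blast
  define n where "n = Suc n0"
  define \<pi> where "\<pi> k = s + real k * ((t - s) / real n)" for k
  have "(t - s) / \<eta> < real n" using n0 by (simp add: n_def)
  then have "t - s < \<eta> * real n" using assms by (simp add: pos_divide_less_eq mult.commute)
  then have m: "(t - s) / real n < \<eta>" by (simp add: n_def pos_divide_less_eq)
  have step: "\<pi> (Suc k) - \<pi> k = (t - s) / real n" for k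
    unfolding \<pi>_def of_nat_Suc distrib_right by simp
  have "partition_of s t n \<pi>"
    unfolding partition_of_def
  proof (intro conjI allI impI)
    show "\<pi> k \<le> \<pi> (Suc k)" for k using step[of k] assms by (simp add: n_def \<pi>_def divide_right_mono mult_right_mono)
  qed (auto simp: \<pi>_def n_def)
  then show ?thesis using that step m by metis
qed

context wiener
begin

text \<open>By continuity, Hoelder continuity is tested on the countably many pairs of rational
  times.\<close>

lemma hoelder_paths_sets:
  assumes g: "0 < \<gamma>" shows "hoelder_paths (real R) \<gamma> K \<in> sets W"
proof -
  have "hoelder_paths (real R) \<gamma> K = {\<omega> \<in> space W. \<forall>i. \<forall>a b :: rat. \<bar>real_of_rat a\<bar> \<le> real R \<longrightarrow> \<bar>real_of_rat b\<bar> \<le> real R \<longrightarrow>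
      \<bar>\<omega> (of_rat a) $ i - \<omega> (of_rat b) $ i\<bar> \<le> K * \<bar>of_rat a - of_rat b\<bar> powr \<gamma>}" (is "_ = ?B")
  proof (intro equalityI subsetI)
    fix \<omega> assume "\<omega> \<in> hoelder_paths (real R) \<gamma> K"
    then show "\<omega> \<in> ?B" by (auto simp: hoelder_paths_def hoelder_up_to_def)
  next
    fix \<omega> assume "\<omega> \<in> ?B"
    then show "\<omega> \<in> hoelder_paths (real R) \<gamma> K"
      unfolding hoelder_paths_def by (auto intro!: hoelder_up_to_rat continuous_coord g)
  qed
  also have "\<dots> \<in> sets W" by measurable
  finally show ?thesis .
qed

text \<open>A one-step instance of \<open>incr_sum_moment\<close>, so the constant is
  \<open>4 * fact 2\<close> instead of 1.\<close>

lemma incr_second_moment: "(\<integral>\<^sup>+\<omega>. ennreal ((\<omega> a $ i - \<omega> b $ i)\<^sup>2) \<partial>W) \<le> ennreal (8 * \<bar>a - b\<bar>)"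
proof -
  have *: "(\<integral>\<^sup>+\<omega>. ennreal ((\<omega> b $ i - \<omega> a $ i)\<^sup>2) \<partial>W) \<le> ennreal (8 * (b - a))" if "a < b" for a b
  proof -
    have "strict_mono_on {..1::nat} (\<lambda>k. if k = 0 then a else b)"
      using that by (auto simp: strict_mono_on_def)
    from incr_sum_moment[OF this, of "\<lambda>_. 1" i 1] show ?thesis by (simp add: fact_2)
  qed
  consider "a = b" | "a < b" | "b < a" by linarith
  then show ?thesis using *[of a b] *[of b a] by cases (auto simp: power2_commute)
qed

text \<open>Second moments are accessible for both components, so the coefficients are averaged over
  the first path rather than controlled pathwise. Each of the two averages costs a factor 8, whence
  64.\<close>

lemma stieltjes_L2_grid:
  fixes i j :: 'm and R N :: nat
  defines "S \<equiv> \<lambda>n \<pi> \<omega>. stieltjes_sum n \<pi> (grid_path R N (\<lambda>r. \<omega> r $ i)) (grid_path R N (\<lambda>r. \<omega> r $ j))"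
  assumes ij: "i \<noteq> j" and N: "0 < N" and sT: "\<bar>s\<bar> \<le> real R" "\<bar>t\<bar> \<le> real R" "s \<le> t" and \<eta>: "0 < \<eta>"
    and p: "partition_of s t n \<pi>" "\<And>k. k < n \<Longrightarrow> \<pi> (Suc k) - \<pi> k < \<eta>"
    and p': "partition_of s t n' \<pi>'" "\<And>k. k < n' \<Longrightarrow> \<pi>' (Suc k) - \<pi>' k < \<eta>"
  shows "(\<integral>\<^sup>+\<omega>. ennreal ((S n \<pi> \<omega> - S n' \<pi>' \<omega>)\<^sup>2) \<partial>W) \<le> ennreal (64 * (\<eta> + 1 / N) * (t - s + 1 / N))"
proof -
  define m where "m = 2 * R * N"
  define u where "u k = grid R N (Suc k)" for k
  define \<tau> where "\<tau> = grid R N"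
  let ?P = "\<Pi>\<^sub>M k\<in>{..<m}. (borel :: real measure)"
  define D where "D i \<omega> = (\<lambda>k\<in>{..<m}. (\<omega> (\<tau> (Suc k)) - \<omega> (\<tau> k)) $ i)" for i and \<omega> :: "'m path"
  define a where "a l k = stieltjes_sum n \<pi> (step (u l)) (step (u k)) - stieltjes_sum n' \<pi>' (step (u l)) (step (u k))" for l k
  have coef: "(\<Sum>l<m. D i \<omega> l * a l k) = stieltjes_sum n \<pi> (grid_path R N (\<lambda>r. \<omega> r $ i)) (step (u k))
     - stieltjes_sum n' \<pi>' (grid_path R N (\<lambda>r. \<omega> r $ i)) (step (u k))" for k \<omega>
    unfolding stieltjes_grid_left a_def right_diff_distrib sum_subtractf
    by (simp add: D_def m_def \<tau>_def u_def)
  have err: "S n \<pi> \<omega> - S n' \<pi>' \<omega> = (\<Sum>k<m. (\<Sum>l<m. D i \<omega> l * a l k) * D j \<omega> k)" for \<omega>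
    unfolding S_def coef stieltjes_grid_right left_diff_distrib sum_subtractf
    by (simp add: D_def m_def \<tau>_def u_def left_diff_distrib right_diff_distrib sum_subtractf mult.commute)
  have sm: "strict_mono_on {..m} \<tau>" unfolding \<tau>_def by (rule strict_mono_grid[OF N])
  \<comment> \<open>The coefficient of a jump at \<open>u k\<close> is the increment of the first
    path between the left ends of the two cells containing it. These are at most
    \<open>\<eta>\<close> apart, and sampling adds \<open>1 / N\<close>.\<close>
  have c2: "(\<integral>\<^sup>+\<omega>. ennreal ((\<Sum>l<m. D i \<omega> l * a l k)\<^sup>2) \<partial>W) \<le> ennreal (8 * (\<eta> + 1 / N) * indicator {s<..t} (u k))" for k
  proof (cases "s < u k \<and> u k \<le> t")
    case False
    then have "(\<Sum>l<m. D i \<omega> l * a l k) = 0" for \<omega>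
      unfolding coef by (subst stieltjes_step_zero[OF p(1)], force, subst stieltjes_step_zero[OF p'(1)], force, simp)
    then show ?thesis by simp
  next
    case True
    obtain q where q: "q < n" "\<pi> q < u k" "u k \<le> \<pi> (Suc q)" using partition_cell[OF p(1)] True by blast
    obtain q' where q': "q' < n'" "\<pi>' q' < u k" "u k \<le> \<pi>' (Suc q')" using partition_cell[OF p'(1)] True by blast
    have qR: "\<bar>\<pi> q\<bar> \<le> real R" "\<bar>\<pi>' q'\<bar> \<le> real R"
      using partition_mem[OF p(1), of q] partition_mem[OF p'(1), of q'] q(1) q'(1) sT by auto
    obtain v where v: "v \<le> 2 * R * N" "grid R N v \<le> \<pi> q" "\<pi> q < grid R N v + 1 / N" "\<forall>x. grid_path R N x (\<pi> q) = x (grid R N v)"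
      using grid_path_eq[OF qR(1) N] by blast
    obtain v' where v': "v' \<le> 2 * R * N" "grid R N v' \<le> \<pi>' q'" "\<pi>' q' < grid R N v' + 1 / N" "\<forall>x. grid_path R N x (\<pi>' q') = x (grid R N v')"
      using grid_path_eq[OF qR(2) N] by blast
    have "\<bar>\<pi> q - \<pi>' q'\<bar> \<le> \<eta>" using q q' p(2)[OF q(1)] p'(2)[OF q'(1)] by linarith
    then have vv: "\<bar>grid R N v - grid R N v'\<bar> \<le> \<eta> + 1 / N" using v v' by linarith
    have "(\<Sum>l<m. D i \<omega> l * a l k) = \<omega> (grid R N v) $ i - \<omega> (grid R N v') $ i" for \<omega>
      unfolding coef stieltjes_step[OF p(1) q] stieltjes_step[OF p'(1) q'] using v(4) v'(4) by simp
    then have "(\<integral>\<^sup>+\<omega>. ennreal ((\<Sum>l<m. D i \<omega> l * a l k)\<^sup>2) \<partial>W) \<le> ennreal (8 * \<bar>grid R N v - grid R N v'\<bar>)"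
      using incr_second_moment by simp
    also have "\<dots> \<le> ennreal (8 * (\<eta> + 1 / N) * indicator {s<..t} (u k))"
      using vv True by (intro ennreal_leI) simp
    finally show ?thesis .
  qed
  have Dm[measurable]: "(\<lambda>\<omega>. D i \<omega> l) \<in> borel_measurable W" if "l < m" for l i
    using that by (simp add: D_def)
  have "(\<integral>\<^sup>+\<omega>. ennreal ((S n \<pi> \<omega> - S n' \<pi>' \<omega>)\<^sup>2) \<partial>W) \<le>
     (\<integral>\<^sup>+\<omega>. 1 * ennreal (4 * fact (2 * 1) * (\<Sum>k<m. (\<Sum>l<m. D i \<omega> l * a l k)\<^sup>2 * (\<tau> (Suc k) - \<tau> k)) ^ 1) \<partial>W)"
    using bilinear_moment[OF sm ij, of "\<lambda>_. 1" a 1] unfolding err D_def[symmetric] by simp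
  also have "\<dots> = (\<integral>\<^sup>+\<omega>. (\<Sum>k<m. ennreal (8 / N) * ennreal ((\<Sum>l<m. D i \<omega> l * a l k)\<^sup>2)) \<partial>W)"
    by (intro nn_integral_cong) (simp add: fact_2 \<tau>_def grid_Suc_diff sum_distrib_left ennreal_mult[symmetric] sum_nonneg sum_ennreal)
  also have "\<dots> = (\<Sum>k<m. ennreal (8 / N) * (\<integral>\<^sup>+\<omega>. ennreal ((\<Sum>l<m. D i \<omega> l * a l k)\<^sup>2) \<partial>W))"
    by (subst nn_integral_sum) (auto intro!: sum.cong nn_integral_cmult)
  also have "\<dots> \<le> (\<Sum>k<m. ennreal (8 / N) * ennreal (8 * (\<eta> + 1 / N) * indicator {s<..t} (u k)))"
    by (intro sum_mono mult_left_mono c2) auto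
  also have "\<dots> = ennreal (64 * (\<eta> + 1 / N) * (\<Sum>k<m. indicator {s<..t} (u k) / N))"
  proof -
    have "ennreal (8 / N) * ennreal (8 * (\<eta> + 1 / N) * indicator {s<..t} (u k)) =
      ennreal (64 * (\<eta> + 1 / N) * (indicator {s<..t} (u k) / N))" for k
      using \<eta> by (simp add: ennreal_mult[symmetric])
    moreover have "0 \<le> 64 * (\<eta> + 1 / N) * (indicator {s<..t} (u k) / N)" for k using \<eta> by simp
    ultimately show ?thesis by (simp only: sum_ennreal sum_distrib_left)
  qed
  also have "\<dots> \<le> ennreal (64 * (\<eta> + 1 / N) * (t - s + 1 / N))"
    using \<eta> unfolding u_def by (intro ennreal_leI mult_left_mono grid_count sT N) auto
  finally show ?thesis .
qed

text \<open>The grid terms vanish as \<open>N\<close> tends to infinity, by Fatou's lemma. The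
  estimate is a Cauchy property of the Stieltjes sums in mean square with an explicit rate.\<close>

lemma stieltjes_L2:
  assumes ij: "i \<noteq> j" and st: "s \<le> t" and \<eta>: "0 < \<eta>"
    and p: "partition_of s t n \<pi>" "\<And>k. k < n \<Longrightarrow> \<pi> (Suc k) - \<pi> k < \<eta>"
    and p': "partition_of s t n' \<pi>'" "\<And>k. k < n' \<Longrightarrow> \<pi>' (Suc k) - \<pi>' k < \<eta>"
  shows "(\<integral>\<^sup>+\<omega>. ennreal ((stieltjes_sum n \<pi> (\<lambda>r. \<omega> r $ i) (\<lambda>r. \<omega> r $ j) -
      stieltjes_sum n' \<pi>' (\<lambda>r. \<omega> r $ i) (\<lambda>r. \<omega> r $ j))\<^sup>2) \<partial>W) \<le> ennreal (64 * \<eta> * (t - s))"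
proof -
  obtain R :: nat where R: "\<bar>s\<bar> + \<bar>t\<bar> \<le> real R" using real_arch_simple by blast
  have R': "\<bar>s\<bar> \<le> real R" "\<bar>t\<bar> \<le> real R" using R by auto
  define F where "F N \<omega> = ennreal ((stieltjes_sum n \<pi> (grid_path R (Suc N) (\<lambda>r. \<omega> r $ i)) (grid_path R (Suc N) (\<lambda>r. \<omega> r $ j)) -
      stieltjes_sum n' \<pi>' (grid_path R (Suc N) (\<lambda>r. \<omega> r $ i)) (grid_path R (Suc N) (\<lambda>r. \<omega> r $ j)))\<^sup>2)" for N and \<omega> :: "'m path"
  have [measurable]: "F N \<in> borel_measurable W" for N
    unfolding F_def stieltjes_sum_def by measurable
  have "(\<integral>\<^sup>+\<omega>. ennreal ((stieltjes_sum n \<pi> (\<lambda>r. \<omega> r $ i) (\<lambda>r. \<omega> r $ j) -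
      stieltjes_sum n' \<pi>' (\<lambda>r. \<omega> r $ i) (\<lambda>r. \<omega> r $ j))\<^sup>2) \<partial>W) = (\<integral>\<^sup>+\<omega>. liminf (\<lambda>N. F N \<omega>) \<partial>W)"
  proof (intro nn_integral_cong)
    fix \<omega> assume w: "\<omega> \<in> space W"
    have "(\<lambda>N. F N \<omega>) \<longlonglongrightarrow> ennreal ((stieltjes_sum n \<pi> (\<lambda>r. \<omega> r $ i) (\<lambda>r. \<omega> r $ j) -
      stieltjes_sum n' \<pi>' (\<lambda>r. \<omega> r $ i) (\<lambda>r. \<omega> r $ j))\<^sup>2)"
      unfolding F_def
      by (intro tendsto_ennrealI tendsto_power tendsto_diff stieltjes_tendsto[OF continuous_coord[OF w] continuous_coord[OF w] p(1) R']
         stieltjes_tendsto[OF continuous_coord[OF w] continuous_coord[OF w] p'(1) R'])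
    then show "ennreal ((stieltjes_sum n \<pi> (\<lambda>r. \<omega> r $ i) (\<lambda>r. \<omega> r $ j) -
      stieltjes_sum n' \<pi>' (\<lambda>r. \<omega> r $ i) (\<lambda>r. \<omega> r $ j))\<^sup>2) = liminf (\<lambda>N. F N \<omega>)"
      by (intro lim_imp_Liminf[symmetric]) auto
  qed
  also have "\<dots> \<le> liminf (\<lambda>N. \<integral>\<^sup>+\<omega>. F N \<omega> \<partial>W)" by (rule nn_integral_liminf) simp
  also have "\<dots> \<le> liminf (\<lambda>N. ennreal (64 * (\<eta> + 1 / Suc N) * (t - s + 1 / Suc N)))"
    unfolding F_def
    by (intro Liminf_mono always_eventually allI stieltjes_L2_grid[OF ij _ R' st \<eta> p p']) auto
  also have "\<dots> = ennreal (64 * (\<eta> + 0) * (t - s + 0))"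
    by (intro lim_imp_Liminf tendsto_ennrealI tendsto_intros LIMSEQ_Suc[OF lim_1_over_n]) auto
  finally show ?thesis by simp
qed

end

lemma even_power_diff_le:
  fixes a b :: real shows "(a - b) ^ (2 * p) \<le> 4 ^ p * (a ^ (2 * p) + b ^ (2 * p))"
proof -
  have "(a - b)\<^sup>2 \<le> 4 * max (a\<^sup>2) (b\<^sup>2)"
    using zero_le_power2[of "a + b"] by (simp add: power2_eq_square algebra_simps max_def) 
  then have "((a - b)\<^sup>2) ^ p \<le> (4 * max (a\<^sup>2) (b\<^sup>2)) ^ p" by (rule power_mono) simp
  also have "\<dots> = 4 ^ p * max (a\<^sup>2) (b\<^sup>2) ^ p" by (rule power_mult_distrib)
  also have "max (a\<^sup>2) (b\<^sup>2) ^ p \<le> (a\<^sup>2) ^ p + (b\<^sup>2) ^ p" by (simp add: max_def)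
  finally show ?thesis by (simp add: power_mult)
qed

lemma card_int_multiples:
  fixes h T :: real
  assumes "0 < h" "0 \<le> T"
  shows "finite {a :: int. \<bar>a * h\<bar> \<le> T}" "real (card {a :: int. \<bar>a * h\<bar> \<le> T}) \<le> 2 * T / h + 1"
proof -
  have sub: "{a :: int. \<bar>a * h\<bar> \<le> T} \<subseteq> {- \<lfloor>T / h\<rfloor>..\<lfloor>T / h\<rfloor>}"
  proof
    fix a :: int assume "a \<in> {a. \<bar>a * h\<bar> \<le> T}"
    then have "\<bar>a\<bar> * h \<le> T" using assms by (simp add: abs_mult)
    then have "real_of_int \<bar>a\<bar> \<le> T / h" using assms by (simp add: pos_le_divide_eq)
    then have "\<bar>a\<bar> \<le> \<lfloor>T / h\<rfloor>" by (simp add: le_floor_iff)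
    then show "a \<in> {- \<lfloor>T / h\<rfloor>..\<lfloor>T / h\<rfloor>}" by auto
  qed
  then show "finite {a :: int. \<bar>a * h\<bar> \<le> T}" by (rule finite_subset) simp
  have "card {a :: int. \<bar>a * h\<bar> \<le> T} \<le> card {- \<lfloor>T / h\<rfloor>..\<lfloor>T / h\<rfloor>}" by (rule card_mono[OF _ sub]) simp
  also have "\<dots> = nat (2 * \<lfloor>T / h\<rfloor> + 1)" by simp
  finally have "real (card {a :: int. \<bar>a * h\<bar> \<le> T}) \<le> real (nat (2 * \<lfloor>T / h\<rfloor> + 1))" by (simp only: of_nat_le_iff)
  also have "\<dots> = 2 * real_of_int \<lfloor>T / h\<rfloor> + 1" using assms by simp
  also have "\<dots> \<le> 2 * T / h + 1" using of_int_floor_le[of "T / h"] by linarith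
  finally show "real (card {a :: int. \<bar>a * h\<bar> \<le> T}) \<le> 2 * T / h + 1" .
qed

context wiener
begin

text \<open>One partition of mesh below \<open>\<epsilon>\<close> is fine enough for both scales, so
  its Stieltjes sum serves as a common reference point. Splitting the even power costs
  \<open>4 ^ p\<close>, and the two errors have the same bound.\<close>

lemma area_difference_moment:
  assumes ij: "i \<noteq> j" and e: "0 < \<epsilon>" "\<epsilon> \<le> \<delta>" "\<delta> \<le> 1" and K: "0 \<le> K"
    and g: "0 < \<gamma>" "\<gamma> \<le> 1/2"
    and sT: "\<bar>s\<bar> \<le> T" "\<bar>t\<bar> \<le> T" "T + 2 \<le> real R" and st: "\<delta> \<le> t - s"
  shows "(\<integral>\<^sup>+\<omega>. indicator (hoelder_paths (real R) \<gamma> K) \<omega> * ennreal ((smooth_area \<delta> (\<lambda>r. \<omega> r $ i) (\<lambda>r. \<omega> r $ j) s t -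
      smooth_area \<epsilon> (\<lambda>r. \<omega> r $ i) (\<lambda>r. \<omega> r $ j) s t) ^ (2 * p)) \<partial>W)
    \<le> ennreal (8 * 4 ^ p * fact (2 * p) * (80 * K\<^sup>2 * \<delta> powr (2 * \<gamma>) * (t - s)) ^ p)"
proof -
  have d: "0 < \<delta>" using e by linarith
  let ?A = "\<lambda>\<delta> \<omega>. smooth_area \<delta> (\<lambda>r. \<omega> r $ i) (\<lambda>r. \<omega> r $ j) s t"
  let ?H = "hoelder_paths (real R) \<gamma> K"
  obtain n \<pi> where p: "partition_of s t n \<pi>" "\<And>k. k < n \<Longrightarrow> \<pi> (Suc k) - \<pi> k < \<epsilon>"
    using fine_partition[of s t \<epsilon>] st d e(1) by auto
  let ?S = "\<lambda>\<omega>. stieltjes_sum n \<pi> (\<lambda>r. \<omega> r $ i) (\<lambda>r. \<omega> r $ j)"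
  have [measurable]: "?H \<in> sets W" by (rule hoelder_paths_sets[OF g(1)])
  have [measurable]: "?A \<delta> \<in> borel_measurable W" "?A \<epsilon> \<in> borel_measurable W"
    using e d by (auto intro: smooth_area_measurable)
  define C where "C x = 4 * fact (2 * p) * (80 * K\<^sup>2 * x powr (2 * \<gamma>) * (t - s)) ^ p" for x
  have C0: "0 \<le> C x" for x unfolding C_def using st d by simp
  have m1: "(\<integral>\<^sup>+\<omega>. indicator ?H \<omega> * ennreal ((?A \<delta> \<omega> - ?S \<omega>) ^ (2 * p)) \<partial>W) \<le> ennreal (C \<delta>)"
    unfolding C_def by (rule area_error_moment[OF ij d e(3) K _ g(2) sT st p(1)]) (use g p(2) e(2) in \<open>auto intro: order.trans less_imp_le\<close>)
  have m2: "(\<integral>\<^sup>+\<omega>. indicator ?H \<omega> * ennreal ((?A \<epsilon> \<omega> - ?S \<omega>) ^ (2 * p)) \<partial>W) \<le> ennreal (C \<epsilon>)"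
    unfolding C_def by (rule area_error_moment[OF ij e(1) _ K _ g(2) sT _ p(1)]) (use g p(2) e st in \<open>auto intro: less_imp_le\<close>)
  have Ce: "C \<epsilon> \<le> C \<delta>" unfolding C_def using e st d K g
    by (intro mult_left_mono power_mono mult_right_mono powr_mono2) auto
  have "(\<integral>\<^sup>+\<omega>. indicator ?H \<omega> * ennreal ((?A \<delta> \<omega> - ?A \<epsilon> \<omega>) ^ (2 * p)) \<partial>W) \<le>
    (\<integral>\<^sup>+\<omega>. ennreal (4 ^ p) * (indicator ?H \<omega> * ennreal ((?A \<delta> \<omega> - ?S \<omega>) ^ (2 * p)) +
       indicator ?H \<omega> * ennreal ((?A \<epsilon> \<omega> - ?S \<omega>) ^ (2 * p))) \<partial>W)"
  proof (intro nn_integral_mono)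
    fix \<omega>
    have "(?A \<delta> \<omega> - ?A \<epsilon> \<omega>) ^ (2 * p) \<le> 4 ^ p * ((?A \<delta> \<omega> - ?S \<omega>) ^ (2 * p) + (?A \<epsilon> \<omega> - ?S \<omega>) ^ (2 * p))"
      using even_power_diff_le[of "?A \<delta> \<omega> - ?S \<omega>" "?A \<epsilon> \<omega> - ?S \<omega>" p] by simp
    then have "ennreal ((?A \<delta> \<omega> - ?A \<epsilon> \<omega>) ^ (2 * p)) \<le> ennreal (4 ^ p) * (ennreal ((?A \<delta> \<omega> - ?S \<omega>) ^ (2 * p)) + ennreal ((?A \<epsilon> \<omega> - ?S \<omega>) ^ (2 * p)))"
      by (subst ennreal_plus[symmetric]) (auto simp: ennreal_mult[symmetric] simp del: ennreal_plus intro!: ennreal_leI)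
    then show "indicator ?H \<omega> * ennreal ((?A \<delta> \<omega> - ?A \<epsilon> \<omega>) ^ (2 * p)) \<le>
       ennreal (4 ^ p) * (indicator ?H \<omega> * ennreal ((?A \<delta> \<omega> - ?S \<omega>) ^ (2 * p)) +
       indicator ?H \<omega> * ennreal ((?A \<epsilon> \<omega> - ?S \<omega>) ^ (2 * p)))"
      by (auto split: split_indicator)
  qed
  also have "\<dots> = ennreal (4 ^ p) * ((\<integral>\<^sup>+\<omega>. indicator ?H \<omega> * ennreal ((?A \<delta> \<omega> - ?S \<omega>) ^ (2 * p)) \<partial>W) +
       (\<integral>\<^sup>+\<omega>. indicator ?H \<omega> * ennreal ((?A \<epsilon> \<omega> - ?S \<omega>) ^ (2 * p)) \<partial>W))"
    by (subst nn_integral_cmult) (auto simp: nn_integral_add)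
  also have "\<dots> \<le> ennreal (4 ^ p) * (ennreal (C \<delta>) + ennreal (C \<delta>))"
    using m1 order_trans[OF m2 ennreal_leI[OF Ce]] by (intro mult_left_mono add_mono) auto
  also have "\<dots> = ennreal (8 * 4 ^ p * fact (2 * p) * (80 * K\<^sup>2 * \<delta> powr (2 * \<gamma>) * (t - s)) ^ p)"
    using C0[of \<delta>] by (simp add: ennreal_plus[symmetric] ennreal_mult[symmetric] C_def del: ennreal_plus) (simp add: algebra_simps)
  finally show ?thesis .
qed

text \<open>Markov's inequality for a high moment at each pair of multiples of
  \<open>\<delta> ^ 8\<close> at least \<open>\<delta>\<close> apart, followed by a union bound;
  \<open>off_grid\<close> then extends the estimate to all pairs of times.\<close>

lemma bad_event:
  assumes ij: "i \<noteq> j" and K: "0 \<le> K" and g: "1 / 4 \<le> \<beta>" "\<beta> < \<gamma>" "\<gamma> < 1 / 2"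
    and T: "0 \<le> T" "T + 2 \<le> real R" and q: "0 < q"
  obtains C where "0 \<le> C" "\<And>\<delta> \<epsilon>. 0 < \<epsilon> \<Longrightarrow> \<epsilon> \<le> \<delta> \<Longrightarrow> \<delta> \<le> 2 * \<epsilon> \<Longrightarrow> \<delta> \<le> 1 \<Longrightarrow>
    \<exists>B\<in>sets W. emeasure W B \<le> ennreal (C * \<delta> powr q) \<and>
      (\<forall>\<omega>\<in>hoelder_paths (real R) \<gamma> K - B. \<forall>s t. \<bar>s\<bar> \<le> T \<longrightarrow> \<bar>t\<bar> \<le> T \<longrightarrow> s < t \<longrightarrow>
        \<bar>smooth_area \<delta> (\<lambda>r. \<omega> r $ i) (\<lambda>r. \<omega> r $ j) s t - smooth_area \<epsilon> (\<lambda>r. \<omega> r $ i) (\<lambda>r. \<omega> r $ j) s t\<bar>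
        \<le> (1 + (48 + 8 * T) * K\<^sup>2) * (\<delta> powr (\<gamma> - \<beta>) * (t - s) powr (2 * \<beta>)))"
proof -
  let ?H = "hoelder_paths (real R) \<gamma> K"
  \<comment> \<open>There are of the order \<open>\<delta> powr (- 16)\<close> pairs of grid times,
    and a single pair fails with probability of order
    \<open>\<delta> powr ((1 - 2 * \<beta>) * p)\<close>.\<close>
  define p where "p = nat \<lceil>(q + 16) / (1 - 2 * \<beta>)\<rceil>"
  have p: "q + 16 \<le> (1 - 2 * \<beta>) * real p"
  proof -
    have "(q + 16) / (1 - 2 * \<beta>) \<le> real p" unfolding p_def by linarith
    then show ?thesis using g by (simp add: divide_le_eq mult.commute)
  qed
  define c1 where "c1 = 8 * 4 ^ p * fact (2 * p) * (80 * K\<^sup>2) ^ p"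
  have c1: "0 \<le> c1" unfolding c1_def by simp
  show ?thesis
  proof (rule that[of "(2 * T + 1)\<^sup>2 * c1"])
    show "0 \<le> (2 * T + 1)\<^sup>2 * c1" using c1 by simp
    fix \<delta> \<epsilon> :: real assume e: "0 < \<epsilon>" "\<epsilon> \<le> \<delta>" "\<delta> \<le> 2 * \<epsilon>" "\<delta> \<le> 1"
    have d: "0 < \<delta>" using e by linarith
    define h where "h = \<delta> ^ 8"
    have h: "0 < h" "h \<le> 1" unfolding h_def using d e by (auto intro: power_le_one)
    define dA where "dA \<omega> s t = smooth_area \<delta> (\<lambda>r. \<omega> r $ i) (\<lambda>r. \<omega> r $ j) s t - smooth_area \<epsilon> (\<lambda>r. \<omega> r $ i) (\<lambda>r. \<omega> r $ j) s t"
      for \<omega> :: "'m path" and s t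
    have dAm[measurable]: "(\<lambda>\<omega>. dA \<omega> s t) \<in> borel_measurable W" for s t
      unfolding dA_def by (intro borel_measurable_diff smooth_area_measurable) (use e d in auto)
    have Hm[measurable]: "?H \<in> sets W" using g by (intro hoelder_paths_sets) simp
    define thr where "thr s t = \<delta> powr (\<gamma> - \<beta>) * (t - s) powr (2 * \<beta>)" for s t
    have one: "emeasure W {\<omega> \<in> ?H. thr s t < \<bar>dA \<omega> s t\<bar>} \<le> ennreal (c1 * \<delta> powr (q + 16))"
      if sT: "\<bar>s\<bar> \<le> T" "\<bar>t\<bar> \<le> T" and st: "\<delta> \<le> t - s" for s t
    proof -
      have thr0: "0 < thr s t" unfolding thr_def using d st by simp
      have "emeasure W {\<omega> \<in> ?H. thr s t < \<bar>dA \<omega> s t\<bar>} \<le>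
         emeasure W {\<omega> \<in> ?H. 1 \<le> ennreal (1 / thr s t ^ (2 * p)) * ennreal (dA \<omega> s t ^ (2 * p))}"
      proof (rule emeasure_mono)
        show "{\<omega> \<in> ?H. thr s t < \<bar>dA \<omega> s t\<bar>} \<subseteq> {\<omega> \<in> ?H. 1 \<le> ennreal (1 / thr s t ^ (2 * p)) * ennreal (dA \<omega> s t ^ (2 * p))}"
        proof safe
          fix \<omega> assume "thr s t < \<bar>dA \<omega> s t\<bar>"
          then have "thr s t ^ (2 * p) \<le> \<bar>dA \<omega> s t\<bar> ^ (2 * p)" using thr0 by (intro power_mono) auto
          also have "\<dots> = dA \<omega> s t ^ (2 * p)" by (simp add: power_even_abs)
          finally have "1 \<le> 1 / thr s t ^ (2 * p) * dA \<omega> s t ^ (2 * p)" using thr0 by (simp add: field_simps)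
          then show "1 \<le> ennreal (1 / thr s t ^ (2 * p)) * ennreal (dA \<omega> s t ^ (2 * p))"
            using thr0 by (simp add: ennreal_mult[symmetric])
        qed
        show "{\<omega> \<in> ?H. 1 \<le> ennreal (1 / thr s t ^ (2 * p)) * ennreal (dA \<omega> s t ^ (2 * p))} \<in> sets W"
        proof -
          have "{\<omega> \<in> ?H. 1 \<le> ennreal (1 / thr s t ^ (2 * p)) * ennreal (dA \<omega> s t ^ (2 * p))} =
            ?H \<inter> {\<omega> \<in> space W. 1 \<le> ennreal (1 / thr s t ^ (2 * p)) * ennreal (dA \<omega> s t ^ (2 * p))}"
            by (auto simp: hoelder_paths_def)
          then show ?thesis by simp
        qed
      qed
      also have "\<dots> \<le> ennreal (1 / thr s t ^ (2 * p)) * (\<integral>\<^sup>+\<omega>. ennreal (dA \<omega> s t ^ (2 * p)) * indicator ?H \<omega> \<partial>W)"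
        by (rule nn_integral_Markov_inequality) measurable
      also have "\<dots> \<le> ennreal (1 / thr s t ^ (2 * p)) * ennreal (8 * 4 ^ p * fact (2 * p) * (80 * K\<^sup>2 * \<delta> powr (2 * \<gamma>) * (t - s)) ^ p)"
        using area_difference_moment[OF ij e(1,2,4) K _ _ sT T(2) st, of \<gamma> p] g
        unfolding dA_def by (intro mult_left_mono) (auto simp: mult.commute)
      also have "\<dots> = ennreal (c1 * ((\<delta> powr (2 * \<gamma>) * (t - s)) / (thr s t)\<^sup>2) ^ p)"
        using thr0 st d by (simp add: ennreal_mult[symmetric] c1_def power_mult_distrib power_divide power_mult mult.assoc)
      also have "\<dots> \<le> ennreal (c1 * \<delta> powr (q + 16))"
      proof (intro ennreal_leI mult_left_mono c1)
        have "(thr s t)\<^sup>2 = \<delta> powr (2 * \<gamma> - 2 * \<beta>) * (t - s) powr (4 * \<beta>)"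
          unfolding thr_def power_mult_distrib by (simp add: power2_eq_square powr_add[symmetric])
        \<comment> \<open>The ratio of variance to squared threshold. As
          \<open>1 - 4 * \<beta> \<le> 0\<close> and \<open>\<delta> \<le> t - s\<close>, it is
          largest at \<open>t - s = \<delta>\<close>, where it equals the positive power
          \<open>\<delta> powr (1 - 2 * \<beta>)\<close>.\<close>
        then have "(\<delta> powr (2 * \<gamma>) * (t - s)) / (thr s t)\<^sup>2 = \<delta> powr (2 * \<beta>) * (t - s) powr (1 - 4 * \<beta>)"
        proof -
          define x where "x = t - s"
          have x: "0 < x" using d st by (simp add: x_def)
          have "\<delta> powr (2 * \<gamma>) * x / (\<delta> powr (2 * \<gamma>) / \<delta> powr (2 * \<beta>) * x powr (4 * \<beta>)) =
            \<delta> powr (2 * \<beta>) * (x / x powr (4 * \<beta>))"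
            using d x by (simp add: field_simps)
          then show ?thesis using x \<open>(thr s t)\<^sup>2 = _\<close> by (simp add: powr_diff x_def)
        qed
        also have "\<dots> \<le> \<delta> powr (2 * \<beta>) * \<delta> powr (1 - 4 * \<beta>)"
          using d st g by (intro mult_left_mono powr_mono2') auto
        also have "\<dots> = \<delta> powr (1 - 2 * \<beta>)" by (simp add: powr_add[symmetric])
        finally have "((\<delta> powr (2 * \<gamma>) * (t - s)) / (thr s t)\<^sup>2) ^ p \<le> (\<delta> powr (1 - 2 * \<beta>)) ^ p"
          using d st by (intro power_mono) auto
        also have "\<dots> = (\<delta> powr (1 - 2 * \<beta>)) powr real p" using d by (simp add: powr_realpow)
        also have "\<dots> = \<delta> powr ((1 - 2 * \<beta>) * real p)" by (rule powr_powr)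
        also have "\<dots> \<le> \<delta> powr (q + 16)" using d e p by (intro powr_mono') auto
        finally show "((\<delta> powr (2 * \<gamma>) * (t - s)) / (thr s t)\<^sup>2) ^ p \<le> \<delta> powr (q + 16)" .
      qed
      finally show ?thesis .
    qed
    define I where "I = {a :: int. \<bar>a * h\<bar> \<le> T}"
    have I: "finite I" "real (card I) \<le> (2 * T + 1) / h"
    proof -
      show "finite I" unfolding I_def by (rule card_int_multiples[OF h(1) T(1)])
      have "real (card I) \<le> 2 * T / h + 1" unfolding I_def by (rule card_int_multiples[OF h(1) T(1)])
      also have "\<dots> \<le> (2 * T + 1) / h" using h by (simp add: add_divide_distrib)
      finally show "real (card I) \<le> (2 * T + 1) / h" .
    qed
    define J where "J = {z \<in> I \<times> I. \<delta> \<le> snd z * h - fst z * h}"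
    define E where "E z = {\<omega> \<in> ?H. thr (fst z * h) (snd z * h) < \<bar>dA \<omega> (fst z * h) (snd z * h)\<bar>}" for z :: "int \<times> int"
    have "J \<subseteq> I \<times> I" "finite (I \<times> I)" unfolding J_def using I(1) by auto
    then have J: "finite J" "card J \<le> card I * card I"
      using card_mono[of "I \<times> I" J] by (auto simp: card_cartesian_product intro: finite_subset)
    have Em: "E z \<in> sets W" for z
    proof -
      have "E z = ?H \<inter> {\<omega> \<in> space W. thr (fst z * h) (snd z * h) < \<bar>dA \<omega> (fst z * h) (snd z * h)\<bar>}"
        by (auto simp: E_def hoelder_paths_def)
      then show ?thesis by simp
    qed
    show "\<exists>B\<in>sets W. emeasure W B \<le> ennreal ((2 * T + 1)\<^sup>2 * c1 * \<delta> powr q) \<and>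
      (\<forall>\<omega>\<in>?H - B. \<forall>s t. \<bar>s\<bar> \<le> T \<longrightarrow> \<bar>t\<bar> \<le> T \<longrightarrow> s < t \<longrightarrow>
        \<bar>smooth_area \<delta> (\<lambda>r. \<omega> r $ i) (\<lambda>r. \<omega> r $ j) s t - smooth_area \<epsilon> (\<lambda>r. \<omega> r $ i) (\<lambda>r. \<omega> r $ j) s t\<bar>
        \<le> (1 + (48 + 8 * T) * K\<^sup>2) * (\<delta> powr (\<gamma> - \<beta>) * (t - s) powr (2 * \<beta>)))"
    proof (intro bexI[of _ "\<Union>z\<in>J. E z"] conjI ballI allI impI)
      show "(\<Union>z\<in>J. E z) \<in> sets W" using J(1) Em by blast
      have "emeasure W (\<Union>z\<in>J. E z) \<le> (\<Sum>z\<in>J. emeasure W (E z))"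
        using J(1) Em by (intro emeasure_subadditive_finite) auto
      also have "\<dots> \<le> (\<Sum>z\<in>J. ennreal (c1 * \<delta> powr (q + 16)))"
        unfolding E_def by (intro sum_mono one) (auto simp: J_def I_def)
      also have "\<dots> = ennreal (real (card J) * (c1 * \<delta> powr (q + 16)))"
        using c1 by (simp add: ennreal_mult ennreal_of_nat_eq_real_of_nat)
      also have "\<dots> \<le> ennreal ((2 * T + 1)\<^sup>2 * c1 * \<delta> powr q)"
      proof (rule ennreal_leI)
        have "real (card J) \<le> real (card I * card I)" using J(2) by (simp only: of_nat_le_iff)
        also have "\<dots> \<le> ((2 * T + 1) / h) * ((2 * T + 1) / h)" unfolding of_nat_mult
          using I T h by (intro mult_mono) auto
        finally have "real (card J) * (c1 * \<delta> powr (q + 16)) \<le> ((2 * T + 1) / h) * ((2 * T + 1) / h) * (c1 * \<delta> powr (q + 16))"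
          using c1 by (intro mult_right_mono) auto
        also have "\<dots> = (2 * T + 1)\<^sup>2 * c1 * \<delta> powr q"
        proof -
          have "\<delta> powr (q + 16) = \<delta> powr q * (h * h)" using d by (simp add: powr_add h_def power_add[symmetric])
          then show ?thesis using h by (simp add: power2_eq_square)
        qed
        finally show "real (card J) * (c1 * \<delta> powr (q + 16)) \<le> (2 * T + 1)\<^sup>2 * c1 * \<delta> powr q" .
      qed
      finally show "emeasure W (\<Union>z\<in>J. E z) \<le> ennreal ((2 * T + 1)\<^sup>2 * c1 * \<delta> powr q)" .
    next
      fix \<omega> s t assume w: "\<omega> \<in> ?H - (\<Union>z\<in>J. E z)" and sT: "\<bar>s\<bar> \<le> T" "\<bar>t\<bar> \<le> T" "s < t"
      then have wW: "\<omega> \<in> space W" and hh: "\<And>i. hoelder_up_to 0 (real R) \<gamma> K (\<lambda>r. \<omega> r $ i)"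
        by (auto simp: hoelder_paths_def)
      have gr: "\<bar>smooth_area \<delta> (\<lambda>r. \<omega> r $ i) (\<lambda>r. \<omega> r $ j) (a * \<delta> ^ 8) (b * \<delta> ^ 8) -
          smooth_area \<epsilon> (\<lambda>r. \<omega> r $ i) (\<lambda>r. \<omega> r $ j) (a * \<delta> ^ 8) (b * \<delta> ^ 8)\<bar>
          \<le> \<delta> powr (\<gamma> - \<beta>) * (b * \<delta> ^ 8 - a * \<delta> ^ 8) powr (2 * \<beta>)"
        if ab: "\<bar>a * \<delta> ^ 8\<bar> \<le> T" "\<bar>b * \<delta> ^ 8\<bar> \<le> T" "\<delta> \<le> b * \<delta> ^ 8 - a * \<delta> ^ 8" for a b :: int
      proof -
        have "\<omega> \<notin> E (a, b)" using w ab by (auto simp: J_def I_def h_def)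
        then show ?thesis
          using w by (auto simp: E_def dA_def thr_def h_def not_less)
      qed
      have g3: "\<gamma> \<le> 1 / 2" using g by simp
      show "\<bar>smooth_area \<delta> (\<lambda>r. \<omega> r $ i) (\<lambda>r. \<omega> r $ j) s t - smooth_area \<epsilon> (\<lambda>r. \<omega> r $ i) (\<lambda>r. \<omega> r $ j) s t\<bar>
        \<le> (1 + (48 + 8 * T) * K\<^sup>2) * (\<delta> powr (\<gamma> - \<beta>) * (t - s) powr (2 * \<beta>))"
        by (rule off_grid[OF continuous_coord[OF wW] hh continuous_coord[OF wW] hh e K g(1,2) g3 sT(1,2) T(2) sT(3)])
          (rule gr)
    qed
  qed
qed

end

section \<open>Almost sure convergence\<close>

text \<open>The estimates compare only scales within a factor 2 of each other, so every scale is
  paired with a dyadic one just above it: the predecessor of the first dyadic number below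
  \<open>\<delta>\<close>.\<close>

lemma dyadic_scale:
  fixes \<delta> :: real assumes "0 < \<delta>" "\<delta> \<le> 1"
  obtains k where "\<delta> \<le> (1 / 2) ^ k" "(1 / 2) ^ k \<le> 2 * \<delta>"
proof -
  define n where "n = (LEAST n. (1 / 2 :: real) ^ n < \<delta>)"
  have "\<exists>n. (1 / 2 :: real) ^ n < \<delta>" using real_arch_pow_inv[of \<delta> "1 / 2"] assms by auto
  then have n: "(1 / 2) ^ n < \<delta>" unfolding n_def by (rule LeastI_ex)
  have n0: "n \<noteq> 0" using n assms by (intro notI) simp
  have "\<not> (1 / 2) ^ (n - 1) < \<delta>" using n0 unfolding n_def by (intro not_less_Least) simp
  moreover have "(1 / 2 :: real) ^ n = (1 / 2) ^ (n - 1) / 2" using n0 by (cases n) auto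
  ultimately show ?thesis using n by (intro that[of "n - 1"]) auto
qed

text \<open>Consecutive terms of \<open>\<delta>\<close> may have any ratio, so they are not
  compared directly. Each \<open>A (\<delta> i)\<close> is moved to its dyadic neighbour and then
  along the dyadic chain to one fixed level \<open>n\<close>; the chain costs a geometric series.
  Everything is uniform in \<open>z\<close> relative to the weight \<open>w z\<close>.\<close>

lemma dyadic_cauchy:
  fixes A :: "real \<Rightarrow> 'a \<Rightarrow> real" and w :: "'a \<Rightarrow> real"
  assumes \<kappa>: "0 < \<kappa>" and c: "0 \<le> c" and w: "\<And>z. z \<in> Z \<Longrightarrow> 0 \<le> w z"
    and dy: "eventually (\<lambda>n. \<forall>z\<in>Z. \<bar>A ((1 / 2) ^ n) z - A ((1 / 2) ^ Suc n) z\<bar> \<le> c * (((1 / 2) ^ n) powr \<kappa> * w z)) sequentially"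
    and k: "\<And>i. (1 / 2) ^ k i \<le> 2 * \<delta> i" and \<delta>: "\<delta> \<longlonglongrightarrow> 0"
    and dk: "eventually (\<lambda>i. \<forall>z\<in>Z. \<bar>A ((1 / 2) ^ k i) z - A (\<delta> i) z\<bar> \<le> c * (((1 / 2) ^ k i) powr \<kappa> * w z)) sequentially"
    and e: "0 < e"
  shows "\<exists>N. \<forall>i\<ge>N. \<forall>j\<ge>N. \<forall>z\<in>Z. \<bar>A (\<delta> i) z - A (\<delta> j) z\<bar> \<le> e * w z"
proof -
  define r :: real where "r = (1 / 2) powr \<kappa>"
  have r: "0 < r" "r < 1" using \<kappa> powr_less_mono2[of \<kappa> "1 / 2" 1] by (auto simp: r_def)
  have rn: "((1 / 2) ^ n) powr \<kappa> = r ^ n" for n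
  proof -
    have "((1 / 2 :: real) ^ n) powr \<kappa> = ((1 / 2) powr real n) powr \<kappa>" by (simp add: powr_realpow)
    also have "\<dots> = ((1 / 2) powr \<kappa>) powr real n" by (simp add: powr_powr mult.commute)
    also have "\<dots> = r ^ n" using r by (simp add: r_def powr_realpow)
    finally show ?thesis .
  qed
  obtain n0 where n0: "\<And>n z. n0 \<le> n \<Longrightarrow> z \<in> Z \<Longrightarrow> \<bar>A ((1 / 2) ^ n) z - A ((1 / 2) ^ Suc n) z\<bar> \<le> c * (r ^ n * w z)"
    using dy unfolding eventually_sequentially rn by blast
  have tele: "\<bar>A ((1 / 2) ^ n) z - A ((1 / 2) ^ (n + l)) z\<bar> \<le> c * ((\<Sum>m<l. r ^ (n + m)) * w z)" if "n0 \<le> n" "z \<in> Z" for n l z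
  proof (induction l)
    case (Suc l)
    have "\<bar>A ((1 / 2) ^ (n + l)) z - A ((1 / 2) ^ (n + Suc l)) z\<bar> \<le> c * (r ^ (n + l) * w z)"
      using n0[of "n + l" z] that by simp
    then show ?case using Suc by (simp add: algebra_simps)
  qed simp
  have sum: "(\<Sum>m<l. r ^ (n + m)) \<le> r ^ n / (1 - r)" for n l
  proof -
    have "(\<Sum>m<l. r ^ (n + m)) = r ^ n * (\<Sum>m<l. r ^ m)" by (simp add: power_add sum_distrib_left)
    also have "(\<Sum>m<l. r ^ m) = (1 - r ^ l) / (1 - r)" using r sum_gp_strict[of r l] by simp
    also have "\<dots> \<le> 1 / (1 - r)" using r by (intro divide_right_mono) auto
    finally show ?thesis using r by (simp add: mult_left_mono)
  qed
  have far: "\<bar>A ((1 / 2) ^ n) z - A ((1 / 2) ^ l) z\<bar> \<le> c * (r ^ n / (1 - r) * w z)" if "n0 \<le> n" "n \<le> l" "z \<in> Z" for n l z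
  proof -
    have "\<bar>A ((1 / 2) ^ n) z - A ((1 / 2) ^ l) z\<bar> \<le> c * ((\<Sum>m<l - n. r ^ (n + m)) * w z)"
      using tele[of n z "l - n"] that by simp
    also have "\<dots> \<le> c * (r ^ n / (1 - r) * w z)" using c w that by (intro mult_left_mono mult_right_mono sum) auto
    finally show ?thesis .
  qed
  obtain N1 where N1: "\<And>i z. N1 \<le> i \<Longrightarrow> z \<in> Z \<Longrightarrow> \<bar>A ((1 / 2) ^ k i) z - A (\<delta> i) z\<bar> \<le> c * (r ^ k i * w z)"
    using dk unfolding eventually_sequentially rn by blast
  \<comment> \<open>Half of \<open>D * r ^ n\<close> bounds the way from \<open>\<delta> i\<close>
    to level \<open>n\<close>: the chain contributes \<open>1 / (1 - r)\<close> and the step to the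
    dyadic neighbour 1.\<close>
  define D where "D = 2 * c * (1 + 1 / (1 - r))"
  have "(\<lambda>n. D * r ^ n) \<longlonglongrightarrow> D * 0" using r by (intro tendsto_mult tendsto_const LIMSEQ_realpow_zero) auto
  then have "eventually (\<lambda>n. D * r ^ n < e) sequentially" using e by (intro order_tendstoD(2)[where y="D * 0"]) auto
  then obtain n1 where n1: "\<And>n. n1 \<le> n \<Longrightarrow> D * r ^ n < e" unfolding eventually_sequentially by blast
  define n where "n = max n0 n1"
  have "eventually (\<lambda>i. \<delta> i < (1 / 2) ^ n / 2) sequentially" using \<delta> by (intro order_tendstoD(2)[where y=0]) auto
  then obtain N2 where N2: "\<And>i. N2 \<le> i \<Longrightarrow> \<delta> i < (1 / 2) ^ n / 2" unfolding eventually_sequentially by blast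
  \<comment> \<open>A dyadic neighbour coarser than level \<open>n\<close> would force
    \<open>2 * \<delta> i\<close> to be at least \<open>(1 / 2) ^ n\<close>.\<close>
  have kn: "n \<le> k i" if "N2 \<le> i" for i
  proof (rule ccontr)
    assume "\<not> n \<le> k i"
    then have "(1 / 2 :: real) ^ n \<le> (1 / 2) ^ k i" by (intro power_decreasing) auto
    then show False using k[of i] N2[OF that] by linarith
  qed
  have one: "\<bar>A ((1 / 2) ^ n) z - A (\<delta> i) z\<bar> \<le> e / 2 * w z" if i: "max N1 N2 \<le> i" and z: "z \<in> Z" for i z
  proof -
    have "\<bar>A ((1 / 2) ^ n) z - A (\<delta> i) z\<bar> \<le> c * (r ^ n / (1 - r) * w z) + c * (r ^ k i * w z)"
      using far[of n "k i" z] N1[of i z] kn[of i] i z by (simp add: n_def)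
    also have "c * (r ^ k i * w z) \<le> c * (r ^ n * w z)"
      using r kn[of i] i c w[OF z] by (intro mult_left_mono mult_right_mono power_decreasing) auto
    also have "c * (r ^ n / (1 - r) * w z) + c * (r ^ n * w z) = D * r ^ n / 2 * w z"
      by (simp add: D_def algebra_simps)
    also have "\<dots> \<le> e / 2 * w z" using n1[of n] w[OF z] by (intro mult_right_mono divide_right_mono) (auto simp: n_def)
    finally show ?thesis by simp
  qed
  show ?thesis
  proof (intro exI[of _ "max N1 N2"] allI impI ballI)
    fix i j z assume "max N1 N2 \<le> i" "max N1 N2 \<le> j" "z \<in> Z"
    then have "\<bar>A ((1 / 2) ^ n) z - A (\<delta> i) z\<bar> \<le> e * w z / 2" "\<bar>A ((1 / 2) ^ n) z - A (\<delta> j) z\<bar> \<le> e * w z / 2"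
      using one[of i z] one[of j z] by simp_all
    then show "\<bar>A (\<delta> i) z - A (\<delta> j) z\<bar> \<le> e * w z" by linarith
  qed
qed

text \<open>Interpolation: for close times each increment is bounded by itself, for distant times
  each mean is close to its path value. Both give the same bound in terms of the smaller of
  \<open>t - s\<close> and \<open>\<delta>\<close>, whose power is then shared between the
  two.\<close>

lemma mean_incr_error:
  assumes x: "loc_bdd_meas x" "hoelder_up_to 0 R \<gamma> K x" and d: "0 < \<delta>" "\<delta> \<le> 1" and K: "0 \<le> K"
    and g: "0 < \<beta>" "\<beta> < \<gamma>" "\<gamma> \<le> 1"
    and sT: "\<bar>s\<bar> \<le> T" "\<bar>t\<bar> \<le> T" "T + 2 \<le> R" and st: "s < t"
  shows "\<bar>(mean \<delta> x t - mean \<delta> x s) - (x t - x s)\<bar> \<le> 2 * K * (\<delta> powr (\<gamma> - \<beta>) * (t - s) powr \<beta>)"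
proof -
  have R: "\<bar>s\<bar> + \<delta> \<le> R" "\<bar>t\<bar> + \<delta> \<le> R" "\<bar>s\<bar> \<le> R" "\<bar>t\<bar> \<le> R" using sT d by linarith+
  define m where "m = min (t - s) \<delta>"
  have "\<bar>(mean \<delta> x t - mean \<delta> x s) - (x t - x s)\<bar> \<le> 2 * K * m powr \<gamma>"
  proof (cases "t - s \<le> \<delta>")
    case True
    have "\<bar>mean \<delta> x t - mean \<delta> x s\<bar> \<le> K * (t - s) powr \<gamma>"
      by (rule mean_incr_le[OF x(1) d(1) x(2) _ K _ R(2,1)]) (use st g in auto)
    moreover have "\<bar>x t - x s\<bar> \<le> K * (t - s) powr \<gamma>"
      by (rule hoelder_up_toD[OF x(2) R(4,3) _ _ K]) (use st g in auto)
    ultimately show ?thesis using True by (simp add: m_def)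
  next
    case False
    have "\<bar>mean \<delta> x t - x t\<bar> \<le> K * \<delta> powr \<gamma>"
      by (rule mean_near_le[OF x(1) d(1) x(2) _ K _ R(2,4)]) (use d g in auto)
    moreover have "\<bar>mean \<delta> x s - x s\<bar> \<le> K * \<delta> powr \<gamma>"
      by (rule mean_near_le[OF x(1) d(1) x(2) _ K _ R(1,3)]) (use d g in auto)
    ultimately show ?thesis using False by (simp add: m_def)
  qed
  also have "m powr \<gamma> = m powr (\<gamma> - \<beta>) * m powr \<beta>" by (simp add: powr_add[symmetric])
  also have "2 * K * (m powr (\<gamma> - \<beta>) * m powr \<beta>) \<le> 2 * K * (\<delta> powr (\<gamma> - \<beta>) * (t - s) powr \<beta>)"
    using K g st d by (intro mult_left_mono mult_mono powr_mono2) (auto simp: m_def)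
  finally show ?thesis .
qed

context wiener
begin

lemma area_cauchy_component:
  assumes ij: "i \<noteq> j" and K: "0 \<le> K" and g: "1 / 4 \<le> \<beta>" "\<beta> < \<gamma>" "\<gamma> < 1 / 2"
    and T: "0 \<le> T" "T + 2 \<le> real R"
    and \<delta>: "\<And>n. 0 < \<delta> n" "\<And>n. \<delta> n \<le> 1" "sufficiently_fast \<delta>"
  shows "AE \<omega> in W. \<omega> \<in> hoelder_paths (real R) \<gamma> K \<longrightarrow> (\<forall>e>0. \<exists>N. \<forall>m\<ge>N. \<forall>n\<ge>N. \<forall>s t. \<bar>s\<bar> \<le> T \<longrightarrow> \<bar>t\<bar> \<le> T \<longrightarrow> s < t \<longrightarrow>
     \<bar>smooth_area (\<delta> m) (\<lambda>r. \<omega> r $ i) (\<lambda>r. \<omega> r $ j) s t - smooth_area (\<delta> n) (\<lambda>r. \<omega> r $ i) (\<lambda>r. \<omega> r $ j) s t\<bar>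
       \<le> e * (t - s) powr (2 * \<beta>))"
proof -
  let ?H = "hoelder_paths (real R) \<gamma> K"
  define c where "c = 1 + (48 + 8 * T) * K\<^sup>2"
  have c: "0 \<le> c" unfolding c_def using T by simp
  define Z where "Z = {(s, t). \<bar>s\<bar> \<le> T \<and> \<bar>t\<bar> \<le> T \<and> s < t}"
  define A where "A \<omega> \<delta> z = smooth_area \<delta> (\<lambda>r. \<omega> r $ i) (\<lambda>r. \<omega> r $ j) (fst z) (snd z)" for \<omega> :: "'m path" and \<delta> z
  define w where "w z = (snd z - fst z) powr (2 * \<beta>)" for z :: "real \<times> real"
  \<comment> \<open>One application of Borel-Cantelli for any two comparable sequences of scales; it
    is used below along the dyadic chain and for the dyadic neighbours.\<close>
  have bad: "AE \<omega> in W. \<omega> \<in> ?H \<longrightarrow> eventually (\<lambda>n. \<forall>z\<in>Z. \<bar>A \<omega> (a n) z - A \<omega> (b n) z\<bar> \<le> c * (a n powr (\<gamma> - \<beta>) * w z)) sequentially"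
    if ab: "\<And>n. 0 < b n" "\<And>n. b n \<le> a n" "\<And>n. a n \<le> 2 * b n" "\<And>n. a n \<le> 1" and q: "0 < q" and sm: "summable (\<lambda>n. a n powr q)"
    for a b :: "nat \<Rightarrow> real" and q
  proof -
    obtain C where C: "0 \<le> C" "\<And>\<delta> \<epsilon>. 0 < \<epsilon> \<Longrightarrow> \<epsilon> \<le> \<delta> \<Longrightarrow> \<delta> \<le> 2 * \<epsilon> \<Longrightarrow> \<delta> \<le> 1 \<Longrightarrow>
      \<exists>B\<in>sets W. emeasure W B \<le> ennreal (C * \<delta> powr q) \<and>
        (\<forall>\<omega>\<in>?H - B. \<forall>s t. \<bar>s\<bar> \<le> T \<longrightarrow> \<bar>t\<bar> \<le> T \<longrightarrow> s < t \<longrightarrow>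
          \<bar>smooth_area \<delta> (\<lambda>r. \<omega> r $ i) (\<lambda>r. \<omega> r $ j) s t - smooth_area \<epsilon> (\<lambda>r. \<omega> r $ i) (\<lambda>r. \<omega> r $ j) s t\<bar>
          \<le> (1 + (48 + 8 * T) * K\<^sup>2) * (\<delta> powr (\<gamma> - \<beta>) * (t - s) powr (2 * \<beta>)))"
      using bad_event[OF ij K g T q] by blast
    have "\<forall>n. \<exists>B. B \<in> sets W \<and> emeasure W B \<le> ennreal (C * a n powr q) \<and>
        (\<forall>\<omega>\<in>?H - B. \<forall>z\<in>Z. \<bar>A \<omega> (a n) z - A \<omega> (b n) z\<bar> \<le> c * (a n powr (\<gamma> - \<beta>) * w z))"
    proof
      fix n
      show "\<exists>B. B \<in> sets W \<and> emeasure W B \<le> ennreal (C * a n powr q) \<and>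
        (\<forall>\<omega>\<in>?H - B. \<forall>z\<in>Z. \<bar>A \<omega> (a n) z - A \<omega> (b n) z\<bar> \<le> c * (a n powr (\<gamma> - \<beta>) * w z))"
        using C(2)[OF ab(1-4)] unfolding A_def Z_def c_def w_def by fastforce
    qed
    then obtain B where B: "\<And>n. B n \<in> sets W" "\<And>n. emeasure W (B n) \<le> ennreal (C * a n powr q)"
      "\<And>n \<omega> z. \<omega> \<in> ?H - B n \<Longrightarrow> z \<in> Z \<Longrightarrow> \<bar>A \<omega> (a n) z - A \<omega> (b n) z\<bar> \<le> c * (a n powr (\<gamma> - \<beta>) * w z)"
      by metis
    have "AE \<omega> in W. eventually (\<lambda>n. \<omega> \<in> space W - B n) sequentially"
    proof (rule borel_cantelli_AE1[OF B(1)])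
      show "emeasure W (B n) < \<infinity>" for n by (simp add: emeasure_eq_measure)
      have "measure W (B n) \<le> C * a n powr q" for n
        using B(2)[of n] C(1) by (simp add: emeasure_eq_measure)
      then show "summable (\<lambda>n. measure W (B n))"
        by (intro summable_comparison_test[OF _ summable_mult[OF sm, of C]]) auto
    qed
    then show ?thesis
    proof (rule AE_mp, intro AE_I2 impI)
      fix \<omega> assume "eventually (\<lambda>n. \<omega> \<in> space W - B n) sequentially" and H: "\<omega> \<in> ?H"
      then show "eventually (\<lambda>n. \<forall>z\<in>Z. \<bar>A \<omega> (a n) z - A \<omega> (b n) z\<bar> \<le> c * (a n powr (\<gamma> - \<beta>) * w z)) sequentially"
        by (elim eventually_mono) (use B(3) in blast)
    qed
  qed
  have "\<forall>n. \<exists>k. \<delta> n \<le> (1 / 2) ^ k \<and> (1 / 2) ^ k \<le> 2 * \<delta> n" using dyadic_scale \<delta>(1,2) by metis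
  then obtain k where k: "\<And>n. \<delta> n \<le> (1 / 2) ^ k n" "\<And>n. (1 / 2) ^ k n \<le> 2 * \<delta> n" by metis
  obtain q where q: "0 < q" "summable (\<lambda>n. \<delta> n powr q)" and \<delta>0: "\<delta> \<longlonglongrightarrow> 0"
    using \<delta>(3) unfolding sufficiently_fast_def by blast
  have 1: "AE \<omega> in W. \<omega> \<in> ?H \<longrightarrow> eventually (\<lambda>n. \<forall>z\<in>Z. \<bar>A \<omega> ((1 / 2) ^ n) z - A \<omega> ((1 / 2) ^ Suc n) z\<bar> \<le> c * (((1 / 2) ^ n) powr (\<gamma> - \<beta>) * w z)) sequentially"
  proof (rule bad[OF _ _ _ _ zero_less_one])
    show "summable (\<lambda>n. ((1 / 2 :: real) ^ n) powr 1)" by (simp add: summable_geometric)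
  qed (auto intro: power_le_one)
  \<comment> \<open>Here the rate hypothesis enters:
    \<open>(1 / 2) ^ k n \<le> 2 * \<delta> n\<close> transfers summability of a power of
    \<open>\<delta>\<close> to the neighbours.\<close>
  have 2: "AE \<omega> in W. \<omega> \<in> ?H \<longrightarrow> eventually (\<lambda>n. \<forall>z\<in>Z. \<bar>A \<omega> ((1 / 2) ^ k n) z - A \<omega> (\<delta> n) z\<bar> \<le> c * (((1 / 2) ^ k n) powr (\<gamma> - \<beta>) * w z)) sequentially"
  proof (rule bad[OF _ _ _ _ q(1)])
    show "summable (\<lambda>n. ((1 / 2 :: real) ^ k n) powr q)"
    proof (rule summable_comparison_test[OF _ summable_mult[OF q(2), of "2 powr q"]], intro exI allI impI)
      fix n
      have "((1 / 2 :: real) ^ k n) powr q \<le> (2 * \<delta> n) powr q" using k q by (intro powr_mono2) auto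
      also have "\<dots> = 2 powr q * \<delta> n powr q" using \<delta>(1)[of n] by (simp add: powr_mult)
      finally show "norm (((1 / 2 :: real) ^ k n) powr q) \<le> 2 powr q * \<delta> n powr q" by simp
    qed
  qed (use k \<delta> q in \<open>auto intro: power_le_one\<close>)
  show ?thesis
    using 1 2
  proof (eventually_elim, intro impI allI)
    case (elim \<omega>)
    fix e :: real assume H: "\<omega> \<in> ?H" and e: "0 < e"
    have "\<exists>N. \<forall>m\<ge>N. \<forall>n\<ge>N. \<forall>z\<in>Z. \<bar>A \<omega> (\<delta> m) z - A \<omega> (\<delta> n) z\<bar> \<le> e * w z"
      by (rule dyadic_cauchy[where \<kappa>="\<gamma> - \<beta>", OF _ c _ _ k(2) \<delta>0 _ e]) (use elim H g in \<open>auto simp: w_def\<close>)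
    then show "\<exists>N. \<forall>m\<ge>N. \<forall>n\<ge>N. \<forall>s t. \<bar>s\<bar> \<le> T \<longrightarrow> \<bar>t\<bar> \<le> T \<longrightarrow> s < t \<longrightarrow>
     \<bar>smooth_area (\<delta> m) (\<lambda>r. \<omega> r $ i) (\<lambda>r. \<omega> r $ j) s t - smooth_area (\<delta> n) (\<lambda>r. \<omega> r $ i) (\<lambda>r. \<omega> r $ j) s t\<bar>
       \<le> e * (t - s) powr (2 * \<beta>)"
      unfolding A_def Z_def w_def by fastforce
  qed
qed

end

section \<open>Hoelder seminorms and componentwise bounds\<close>

lemma ennreal_tendsto_zeroI:
  assumes "\<And>e :: real. 0 < e \<Longrightarrow> eventually (\<lambda>i. f i \<le> ennreal e) F"
  shows "(f \<longlongrightarrow> (0 :: ennreal)) F"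
proof (rule order_tendstoI)
  fix a :: ennreal assume "0 < a"
  then obtain e :: real where e: "0 < e" "ennreal e < a"
  proof (cases a)
    case (real x)
    then show ?thesis using \<open>0 < a\<close> by (intro that[of "x / 2"]) (auto simp: ennreal_less_iff)
  next
    case top
    then show ?thesis by (intro that[of 1]) auto
  qed
  show "eventually (\<lambda>i. f i < a) F" using assms[OF e(1)] by eventually_elim (use e in auto)
qed simp

lemma hoelder_seminorm_le:
  assumes "\<And>s t. - T \<le> s \<Longrightarrow> s < t \<Longrightarrow> t \<le> T \<Longrightarrow> norm (X t - X s) \<le> C * (t - s) powr \<beta>"
  shows "hoelder_seminorm \<beta> T X \<le> ennreal C"
  unfolding hoelder_seminorm_def using assms
  by (intro SUP_least) (auto intro!: ennreal_leI simp: divide_le_eq)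

lemma hoelder_seminorm2_le:
  assumes "\<And>s t. - T \<le> s \<Longrightarrow> s < t \<Longrightarrow> t \<le> T \<Longrightarrow> norm (X s t) \<le> C * (t - s) powr \<gamma>"
  shows "hoelder_seminorm2 \<gamma> T X \<le> ennreal C"
  unfolding hoelder_seminorm2_def using assms
  by (intro SUP_least) (auto intro!: ennreal_leI simp: divide_le_eq)

lemma hoelder_spaceI:
  assumes "continuous_on {-T..T} X"
    "\<And>s t. - T \<le> s \<Longrightarrow> s < t \<Longrightarrow> t \<le> T \<Longrightarrow> norm (X t - X s) \<le> C * (t - s) powr \<beta>"
  shows "X \<in> hoelder_space \<beta> T"
  using hoelder_seminorm_le[OF assms(2)] assms(1)
  by (simp add: hoelder_space_def) (metis ennreal_less_top order_le_less_trans)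

lemma hoelder_space2I:
  assumes "\<And>s t. - T \<le> s \<Longrightarrow> s < t \<Longrightarrow> t \<le> T \<Longrightarrow> norm (X s t) \<le> C * (t - s) powr \<gamma>"
  shows "X \<in> hoelder_space2 \<gamma> T"
  using hoelder_seminorm2_le[OF assms]
  by (simp add: hoelder_space2_def) (metis ennreal_less_top order_le_less_trans)

lemma norm_vec_le:
  fixes v :: "(real, 'm::finite) vec"
  assumes "\<And>i. \<bar>v $ i\<bar> \<le> c" shows "norm v \<le> real CARD('m) * c"
proof -
  have "norm v \<le> (\<Sum>i\<in>UNIV. \<bar>v $ i\<bar>)" by (rule norm_le_l1_cart)
  also have "\<dots> \<le> (\<Sum>i\<in>(UNIV :: 'm set). c)" by (intro sum_mono assms)
  finally show ?thesis by simp
qed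

lemma norm_matrix_le:
  fixes A :: "((real, 'm::finite) vec, 'm) vec"
  assumes "\<And>i j. \<bar>A $ i $ j\<bar> \<le> c" shows "norm A \<le> (real CARD('m))\<^sup>2 * c"
proof -
  have "norm A \<le> (\<Sum>i\<in>UNIV. norm (A $ i))" unfolding norm_vec_def by (rule L2_set_le_sum) simp
  also have "\<dots> \<le> (\<Sum>i\<in>(UNIV :: 'm set). real CARD('m) * c)" by (intro sum_mono norm_vec_le assms)
  finally show ?thesis by (simp add: power2_eq_square)
qed

text \<open>The constant is a natural number, so that almost sure statements on
  \<open>hoelder_paths\<close> for each constant can be collected into one.\<close>

lemma hoelder_components:
  fixes \<omega> :: "'m::finite path"
  assumes w: "\<omega> \<in> hoelder_space \<gamma> T"
  obtains K :: nat where "\<And>i. hoelder_up_to 0 T \<gamma> (real K) (\<lambda>r. \<omega> r $ i)"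
proof -
  have "hoelder_seminorm \<gamma> T \<omega> < \<infinity>" using w by (simp add: hoelder_space_def)
  then obtain c where c: "0 \<le> c" "hoelder_seminorm \<gamma> T \<omega> = ennreal c" by (cases "hoelder_seminorm \<gamma> T \<omega>") auto
  obtain K :: nat where K: "c \<le> real K" using real_arch_simple by blast
  have le: "norm (\<omega> t - \<omega> s) \<le> real K * (t - s) powr \<gamma>" if "- T \<le> s" "s < t" "t \<le> T" for s t
  proof -
    have "ennreal (norm (\<omega> t - \<omega> s) / (t - s) powr \<gamma>) \<le> hoelder_seminorm \<gamma> T \<omega>"
      unfolding hoelder_seminorm_def using that by (intro SUP_upper2[of "(s, t)"]) auto
    then have "norm (\<omega> t - \<omega> s) / (t - s) powr \<gamma> \<le> real K" using c K by simp
    then show ?thesis using that by (simp add: divide_le_eq)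
  qed
  show ?thesis
  proof (rule that[of K], unfold hoelder_up_to_def, intro allI impI)
    fix i a b assume ab: "\<bar>a\<bar> \<le> T" "\<bar>b\<bar> \<le> T"
    have *: "\<bar>\<omega> t $ i - \<omega> s $ i\<bar> \<le> real K * (t - s) powr \<gamma>" if "- T \<le> s" "s < t" "t \<le> T" for s t
      using le[OF that] component_le_norm_cart[of "\<omega> t - \<omega> s" i] by simp
    consider "a = b" | "a < b" | "b < a" by linarith
    then show "\<bar>\<omega> a $ i - \<omega> b $ i\<bar> \<le> real K * (\<bar>a - b\<bar> + 0) powr \<gamma>"
      using *[of a b] *[of b a] ab by cases (auto simp: abs_minus_commute)
  qed
qed

text \<open>What membership in a canonical path set says about a single path; in this form it can be
  assumed almost surely.\<close>

definition hoelder_path :: "'m::finite path \<Rightarrow> bool" where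
  "hoelder_path \<omega> \<longleftrightarrow> continuous_on UNIV \<omega> \<and> (\<forall>T>0. \<forall>\<beta>. 0 < \<beta> \<and> \<beta> < 1/2 \<longrightarrow> \<omega> \<in> hoelder_space \<beta> T)"

lemma hoelder_path_components:
  assumes "hoelder_path \<omega>" "0 < \<gamma>" "\<gamma> < 1/2"
  obtains K :: nat where "\<And>i. hoelder_up_to 0 R \<gamma> (real K) (\<lambda>r. \<omega> r $ i)"
proof -
  have "\<omega> \<in> hoelder_space \<gamma> (\<bar>R\<bar> + 1)" using assms unfolding hoelder_path_def by simp
  then obtain K :: nat where "\<And>i. hoelder_up_to 0 (\<bar>R\<bar> + 1) \<gamma> (real K) (\<lambda>r. \<omega> r $ i)" by (rule hoelder_components) auto
  then show ?thesis by (intro that[of K]) (auto simp: hoelder_up_to_def)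
qed

lemma loc_bdd_meas_component: "continuous_on UNIV \<omega> \<Longrightarrow> loc_bdd_meas (\<lambda>r. \<omega> r $ i)"
  by (intro loc_bdd_meas_continuous continuous_on_component)

lemma mean_incr_tendsto:
  assumes w: "hoelder_path \<omega>" and \<delta>: "\<And>n. 0 < \<delta> n" "\<And>n. \<delta> n \<le> 1" "\<delta> \<longlonglongrightarrow> 0" and st: "s \<le> t"
  shows "(\<lambda>n. mean (\<delta> n) (\<lambda>r. \<omega> r $ i) t - mean (\<delta> n) (\<lambda>r. \<omega> r $ i) s) \<longlonglongrightarrow> \<omega> t $ i - \<omega> s $ i"
proof (cases "s = t")
  case False
  define T where "T = \<bar>s\<bar> + \<bar>t\<bar>"
  obtain K :: nat where K: "\<And>i. hoelder_up_to 0 (T + 2) (1/4) (real K) (\<lambda>r. \<omega> r $ i)"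
    by (rule hoelder_path_components[OF w, of "1/4" "T + 2"]) auto
  have lb: "loc_bdd_meas (\<lambda>r. \<omega> r $ i)" using w by (simp add: hoelder_path_def loc_bdd_meas_component)
  have "(\<lambda>n. (mean (\<delta> n) (\<lambda>r. \<omega> r $ i) t - mean (\<delta> n) (\<lambda>r. \<omega> r $ i) s) - (\<omega> t $ i - \<omega> s $ i)) \<longlonglongrightarrow> 0"
  proof (rule Lim_null_comparison)
    show "eventually (\<lambda>n. norm ((mean (\<delta> n) (\<lambda>r. \<omega> r $ i) t - mean (\<delta> n) (\<lambda>r. \<omega> r $ i) s) - (\<omega> t $ i - \<omega> s $ i)) \<le>
        2 * real K * (\<delta> n powr (1/4 - 1/8) * (t - s) powr (1/8))) sequentially"
      unfolding real_norm_def
      by (intro always_eventually allI mean_incr_error[OF lb K \<delta>(1,2), where T=T]) (use st False in \<open>auto simp: T_def\<close>)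
    have "(\<lambda>n. 2 * real K * (\<delta> n powr (1/4 - 1/8) * (t - s) powr (1/8))) \<longlonglongrightarrow> 2 * real K * (0 powr (1/4 - 1/8) * (t - s) powr (1/8))"
      by (intro tendsto_intros tendsto_powr' \<delta>(3)) (use \<delta>(1) in \<open>auto intro!: always_eventually less_imp_le\<close>)
    then show "(\<lambda>n. 2 * real K * (\<delta> n powr (1/4 - 1/8) * (t - s) powr (1/8))) \<longlonglongrightarrow> 0" by simp
  qed
  then show ?thesis by (simp add: LIM_zero_iff)
qed simp

text \<open>Deterministic: \<open>mean_incr_error\<close> gives the rate
  \<open>\<delta> powr (\<gamma> - \<beta>)\<close> for every Hoelder path, so the path component
  excludes no null set.\<close>

lemma approx_path_converges:
  fixes \<omega> :: "'m::finite path"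
  assumes w: "hoelder_path \<omega>" and \<delta>: "\<And>n. 0 < \<delta> n" "\<And>n. \<delta> n \<le> 1" "\<delta> \<longlonglongrightarrow> 0"
    and T: "0 < T" and b: "0 < \<beta>" "\<beta> < 1/2"
  shows "hoelder_tendsto \<beta> T (\<lambda>i. approx_path (\<delta> i) \<omega>) \<omega>"
proof -
  \<comment> \<open>Any exponent strictly between \<open>\<beta>\<close> and 1/2 would do; the
    surplus over \<open>\<beta>\<close> is the rate.\<close>
  define \<gamma> where "\<gamma> = (\<beta> + 1/2) / 2"
  have g: "\<beta> < \<gamma>" "\<gamma> < 1/2" using b by (auto simp: \<gamma>_def)
  have c: "continuous_on UNIV \<omega>" using w by (simp add: hoelder_path_def)
  obtain K :: nat where K: "\<And>i. hoelder_up_to 0 (T + 2) \<gamma> (real K) (\<lambda>r. \<omega> r $ i)"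
    by (rule hoelder_path_components[OF w, of \<gamma> "T + 2"]) (use b g in auto)
  obtain K' :: nat where K': "\<And>i. hoelder_up_to 0 (T + 2) \<beta> (real K') (\<lambda>r. \<omega> r $ i)"
    by (rule hoelder_path_components[OF w, of \<beta> "T + 2"]) (use b in auto)
  show ?thesis
    unfolding hoelder_tendsto_def
  proof (intro conjI allI)
    show "\<omega> \<in> hoelder_space \<beta> T" using w T b by (simp add: hoelder_path_def)
    fix i
    show "approx_path (\<delta> i) \<omega> \<in> hoelder_space \<beta> T"
    proof (rule hoelder_spaceI[OF approx_path_continuous[OF c \<delta>(1)]])
      fix s t assume st: "- T \<le> s" "s < t" "t \<le> T"
      have R: "\<bar>s\<bar> + \<delta> i \<le> T + 2" "\<bar>t\<bar> + \<delta> i \<le> T + 2" using st \<delta>(2)[of i] by linarith+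
      show "norm (approx_path (\<delta> i) \<omega> t - approx_path (\<delta> i) \<omega> s) \<le> (real CARD('m) * real K') * (t - s) powr \<beta>"
        unfolding mult.assoc
        using st b R by (intro norm_vec_le) (simp add: approx_path_component(1)[OF c \<delta>(1)] mean_incr_le[OF loc_bdd_meas_component[OF c] \<delta>(1) K'])
    qed
  next
    show "(\<lambda>i. hoelder_seminorm \<beta> T (\<lambda>t. approx_path (\<delta> i) \<omega> t - \<omega> t)) \<longlonglongrightarrow> 0"
    proof (rule tendsto_sandwich[OF always_eventually always_eventually tendsto_const])
      show "\<forall>i. hoelder_seminorm \<beta> T (\<lambda>t. approx_path (\<delta> i) \<omega> t - \<omega> t) \<le>
          ennreal (real CARD('m) * (2 * real K * \<delta> i powr (\<gamma> - \<beta>)))"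
      proof (intro allI hoelder_seminorm_le)
        fix i s t assume st: "- T \<le> s" "s < t" "t \<le> T"
        have sT: "\<bar>s\<bar> \<le> T" "\<bar>t\<bar> \<le> T" using st by auto
        have "norm ((approx_path (\<delta> i) \<omega> t - \<omega> t) - (approx_path (\<delta> i) \<omega> s - \<omega> s)) \<le>
           real CARD('m) * (2 * real K * (\<delta> i powr (\<gamma> - \<beta>) * (t - s) powr \<beta>))"
        proof (rule norm_vec_le)
          fix k
          have "\<bar>(mean (\<delta> i) (\<lambda>r. \<omega> r $ k) t - mean (\<delta> i) (\<lambda>r. \<omega> r $ k) s) - (\<omega> t $ k - \<omega> s $ k)\<bar> \<le>
            2 * real K * (\<delta> i powr (\<gamma> - \<beta>) * (t - s) powr \<beta>)"
            by (rule mean_incr_error[OF loc_bdd_meas_component[OF c] K \<delta>(1,2) _ b(1) g(1) _ sT _ st(2)]) (use g in auto)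
          then show "\<bar>((approx_path (\<delta> i) \<omega> t - \<omega> t) - (approx_path (\<delta> i) \<omega> s - \<omega> s)) $ k\<bar> \<le>
            2 * real K * (\<delta> i powr (\<gamma> - \<beta>) * (t - s) powr \<beta>)"
            by (simp add: approx_path_component(1)[OF c \<delta>(1)] algebra_simps)
        qed
        then show "norm ((approx_path (\<delta> i) \<omega> t - \<omega> t) - (approx_path (\<delta> i) \<omega> s - \<omega> s)) \<le>
           real CARD('m) * (2 * real K * \<delta> i powr (\<gamma> - \<beta>)) * (t - s) powr \<beta>" by (simp add: mult.assoc)
      qed
      have "(\<lambda>i. ennreal (real CARD('m) * (2 * real K * \<delta> i powr (\<gamma> - \<beta>)))) \<longlonglongrightarrow>
         ennreal (real CARD('m) * (2 * real K * 0 powr (\<gamma> - \<beta>)))"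
        by (intro tendsto_ennrealI tendsto_intros tendsto_powr' \<delta>(3)) (use \<delta>(1) g in \<open>auto intro!: always_eventually less_imp_le\<close>)
      then show "(\<lambda>i. ennreal (real CARD('m) * (2 * real K * \<delta> i powr (\<gamma> - \<beta>)))) \<longlonglongrightarrow> 0" by simp
    qed simp
  qed
qed

text \<open>A Cauchy condition instead of convergence: it mentions no limit, so it can be tested at
  rational times and is visibly stable under shifts.\<close>

definition area_converges :: "(nat \<Rightarrow> real) \<Rightarrow> 'm::finite path \<Rightarrow> bool" where
  "area_converges \<delta> \<omega> \<longleftrightarrow> (\<forall>T>0. \<forall>\<beta>. 0 < \<beta> \<and> \<beta> < 1/2 \<longrightarrow> (\<forall>e>0. \<exists>N. \<forall>p\<ge>N. \<forall>q\<ge>N. \<forall>s t.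
     - T \<le> s \<longrightarrow> s < t \<longrightarrow> t \<le> T \<longrightarrow> norm (approx_area (\<delta> p) \<omega> s t - approx_area (\<delta> q) \<omega> s t) \<le> e * (t - s) powr (2 * \<beta>)))"

lemma area_convergesD:
  assumes "area_converges \<delta> \<omega>" "0 < T" "0 < \<beta>" "\<beta> < 1/2" "0 < e"
  shows "\<exists>N. \<forall>p\<ge>N. \<forall>q\<ge>N. \<forall>s t. - T \<le> s \<longrightarrow> s < t \<longrightarrow> t \<le> T \<longrightarrow>
    norm (approx_area (\<delta> p) \<omega> s t - approx_area (\<delta> q) \<omega> s t) \<le> e * (t - s) powr (2 * \<beta>)"
  using assms unfolding area_converges_def by simp

text \<open>By monotonicity in the exponent, a sequence that increases to \<open>1/2\<close> accounts for all \<open>\<beta> < 1/2\<close>.\<close>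

definition exponent :: "nat \<Rightarrow> real" where "exponent m = 1 / 2 - 1 / (real m + 4)"

lemma exponent: "1 / 4 \<le> exponent m" "exponent m < 1 / 2"
  by (auto simp: exponent_def field_simps)

text \<open>One index \<open>m\<close> serves as radius and as index of the exponent. Lowering the
  exponent from \<open>exponent m\<close> to \<open>\<beta>\<close> costs at most the factor
  \<open>2 * m + 1\<close>, which a large \<open>k\<close> absorbs.\<close>

lemma area_converges_countable:
  fixes \<omega> :: "'m::finite path"
  assumes c: "\<And>m k :: nat. \<exists>N. \<forall>p\<ge>N. \<forall>q\<ge>N. \<forall>s t. - real m \<le> s \<longrightarrow> s < t \<longrightarrow> t \<le> real m \<longrightarrow>
      norm (approx_area (\<delta> p) \<omega> s t - approx_area (\<delta> q) \<omega> s t) \<le> 1 / (real k + 1) * (t - s) powr (2 * exponent m)"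
  shows "area_converges \<delta> \<omega>"
  unfolding area_converges_def
proof (intro allI impI)
  fix T \<beta> e :: real assume T: "0 < T" and b: "0 < \<beta> \<and> \<beta> < 1/2" and e: "0 < e"
  obtain m1 :: nat where m1: "T \<le> real m1" using real_arch_simple by blast
  obtain m2 :: nat where m2: "1 / (1 / 2 - \<beta>) \<le> real m2" using real_arch_simple by blast
  define m where "m = max m1 m2"
  have mT: "T \<le> real m" using m1 by (simp add: m_def)
  have mb: "\<beta> \<le> exponent m"
  proof -
    have "1 / (1 / 2 - \<beta>) \<le> real m + 4" using m2 by (simp add: m_def)
    then have "1 / (real m + 4) \<le> 1 / 2 - \<beta>" using b by (simp add: field_simps)
    then show ?thesis by (simp add: exponent_def)
  qed
  obtain k :: nat where k: "(2 * real m + 1) / e \<le> real k" using real_arch_simple by blast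
  have ke: "(2 * real m + 1) / (real k + 1) \<le> e"
  proof -
    have "(2 * real m + 1) / e \<le> real k + 1" using k by simp
    then show ?thesis using e by (simp add: field_simps)
  qed
  obtain N where N: "\<And>p q s t. N \<le> p \<Longrightarrow> N \<le> q \<Longrightarrow> - real m \<le> s \<Longrightarrow> s < t \<Longrightarrow> t \<le> real m \<Longrightarrow>
      norm (approx_area (\<delta> p) \<omega> s t - approx_area (\<delta> q) \<omega> s t) \<le> 1 / (real k + 1) * (t - s) powr (2 * exponent m)"
    using c[of m k] by blast
  show "\<exists>N. \<forall>p\<ge>N. \<forall>q\<ge>N. \<forall>s t. - T \<le> s \<longrightarrow> s < t \<longrightarrow> t \<le> T \<longrightarrow>
      norm (approx_area (\<delta> p) \<omega> s t - approx_area (\<delta> q) \<omega> s t) \<le> e * (t - s) powr (2 * \<beta>)"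
  proof (intro exI[of _ N] allI impI)
    fix p q s t assume pq: "N \<le> p" "N \<le> q" and st: "- T \<le> s" "s < t" "t \<le> T"
    have "norm (approx_area (\<delta> p) \<omega> s t - approx_area (\<delta> q) \<omega> s t) \<le> 1 / (real k + 1) * (t - s) powr (2 * exponent m)"
      using pq st mT by (intro N) auto
    also have "(t - s) powr (2 * exponent m) = (t - s) powr (2 * (exponent m - \<beta>)) * (t - s) powr (2 * \<beta>)"
      by (simp add: powr_add[symmetric] algebra_simps)
    also have "(t - s) powr (2 * (exponent m - \<beta>)) \<le> (2 * real m + 1) powr (2 * (exponent m - \<beta>))"
      using st mT mb by (intro powr_mono2) auto
    also have "(2 * real m + 1) powr (2 * (exponent m - \<beta>)) \<le> (2 * real m + 1) powr 1"
      using b exponent(2)[of m] by (intro powr_mono) auto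
    also have "1 / (real k + 1) * ((2 * real m + 1) powr 1 * (t - s) powr (2 * \<beta>)) =
        (2 * real m + 1) / (real k + 1) * (t - s) powr (2 * \<beta>)" by simp
    also have "\<dots> \<le> e * (t - s) powr (2 * \<beta>)" by (intro mult_right_mono ke) auto
    finally show "norm (approx_area (\<delta> p) \<omega> s t - approx_area (\<delta> q) \<omega> s t) \<le> e * (t - s) powr (2 * \<beta>)"
      by (simp add: mult_left_mono mult_right_mono divide_right_mono)
  qed
qed

text \<open>At a fixed scale \<open>small_area\<close> has the exponent \<open>1 + 1/4\<close>, more
  than any \<open>2 * \<beta>\<close>; the constant may depend on \<open>\<delta>\<close>.\<close>

lemma approx_area_space:
  fixes \<omega> :: "'m::finite path"
  assumes w: "hoelder_path \<omega>" and d: "0 < \<delta>" "\<delta> \<le> 1" and b: "0 < \<beta>" "\<beta> < 1/2"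
  shows "approx_area \<delta> \<omega> \<in> hoelder_space2 (2 * \<beta>) T"
proof -
  have c: "continuous_on UNIV \<omega>" using w by (simp add: hoelder_path_def)
  obtain K :: nat where K: "\<And>i. hoelder_up_to 0 (T + 2) (1/4) (real K) (\<lambda>r. \<omega> r $ i)"
    by (rule hoelder_path_components[OF w, of "1/4" "T + 2"]) auto
  define C where "C = (real K)\<^sup>2 * (2 * T) powr (1 + 1/4 - 2 * \<beta>) * \<delta> powr (1/4 - 1)"
  show ?thesis
  proof (rule hoelder_space2I)
    fix s t assume st: "- T \<le> s" "s < t" "t \<le> T"
    have sT: "\<bar>s\<bar> \<le> T" "\<bar>t\<bar> \<le> T" using st by auto
    have "norm (approx_area \<delta> \<omega> s t) \<le> (real CARD('m))\<^sup>2 * (C * (t - s) powr (2 * \<beta>))"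
    proof (rule norm_matrix_le)
      fix i j
      have "\<bar>approx_area \<delta> \<omega> s t $ i $ j\<bar> \<le> (real K)\<^sup>2 * (t - s) powr (1 + 1/4) * \<delta> powr (1/4 - 1)"
        unfolding approx_area_component[OF c d(1) less_imp_le[OF st(2)]]
        by (rule small_area[OF loc_bdd_meas_component[OF c] K loc_bdd_meas_component[OF c] K d _ _ sT]) (use st in auto)
      also have "(t - s) powr (1 + 1/4) = (t - s) powr (1 + 1/4 - 2 * \<beta>) * (t - s) powr (2 * \<beta>)"
        by (simp add: powr_add[symmetric])
      also have "(t - s) powr (1 + 1/4 - 2 * \<beta>) \<le> (2 * T) powr (1 + 1/4 - 2 * \<beta>)"
        using st b by (intro powr_mono2) auto
      finally show "\<bar>approx_area \<delta> \<omega> s t $ i $ j\<bar> \<le> C * (t - s) powr (2 * \<beta>)"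
        by (simp add: C_def mult_left_mono mult_right_mono algebra_simps)
    qed
    then show "norm (approx_area \<delta> \<omega> s t) \<le> ((real CARD('m))\<^sup>2 * C) * (t - s) powr (2 * \<beta>)" by (simp add: mult.assoc)
  qed
qed

lemma approx_area_refl: "approx_area \<delta> \<omega> s s = 0"
  by (simp add: approx_area_def)

text \<open>At fixed times the uniform Cauchy condition gives an ordinary Cauchy sequence of
  matrices, so \<open>lim\<close> denotes a genuine limit. At \<open>s = t\<close> all areas
  vanish.\<close>

lemma area_limit:
  fixes \<omega> :: "'m::finite path"
  assumes "area_converges \<delta> \<omega>" "s \<le> t"
  shows "(\<lambda>i. approx_area (\<delta> i) \<omega> s t) \<longlonglongrightarrow> lim (\<lambda>i. approx_area (\<delta> i) \<omega> s t)"
proof (cases "s = t")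
  case False
  then have st: "s < t" using assms by simp
  define T where "T = \<bar>s\<bar> + \<bar>t\<bar> + 1"
  have T: "0 < T" "- T \<le> s" "t \<le> T" unfolding T_def by linarith+
  have "Cauchy (\<lambda>i. approx_area (\<delta> i) \<omega> s t)"
  proof (rule CauchyI)
    fix e :: real assume e: "0 < e"
    define e' where "e' = e / (2 * (t - s) powr (2 * (1/4)))"
    have e': "0 < e'" using e st by (simp add: e'_def)
    have quarter: "0 < (1/4 :: real)" "1/4 < (1/2 :: real)" by auto
    obtain N where N: "\<And>p q. N \<le> p \<Longrightarrow> N \<le> q \<Longrightarrow>
        norm (approx_area (\<delta> p) \<omega> s t - approx_area (\<delta> q) \<omega> s t) \<le> e' * (t - s) powr (2 * (1/4))"
      using area_convergesD[OF assms(1) T(1) quarter e'] T st by blast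
    have "e' * (t - s) powr (2 * (1/4)) < e" using e st by (simp add: e'_def)
    then show "\<exists>M. \<forall>m\<ge>M. \<forall>n\<ge>M. norm (approx_area (\<delta> m) \<omega> s t - approx_area (\<delta> n) \<omega> s t) < e"
      using N by (intro exI[of _ N] allI impI) (meson order_le_less_trans)
  qed
  then show ?thesis by (simp add: Cauchy_convergent_iff convergent_LIMSEQ_iff)
qed (simp add: approx_area_refl)


text \<open>The weak inequality of the Cauchy condition survives the limit in the second
  index.\<close>

lemma area_limit_rate:
  fixes \<omega> :: "'m::finite path"
  assumes conv: "area_converges \<delta> \<omega>" and T: "0 < T" and b: "0 < \<beta>" "\<beta> < 1/2" and e: "0 < e"
  shows "\<exists>N. \<forall>p\<ge>N. \<forall>s t. - T \<le> s \<longrightarrow> s < t \<longrightarrow> t \<le> T \<longrightarrow>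
    norm (approx_area (\<delta> p) \<omega> s t - lim (\<lambda>i. approx_area (\<delta> i) \<omega> s t)) \<le> e * (t - s) powr (2 * \<beta>)"
proof -
  obtain N where N: "\<And>p q s t. N \<le> p \<Longrightarrow> N \<le> q \<Longrightarrow> - T \<le> s \<Longrightarrow> s < t \<Longrightarrow> t \<le> T \<Longrightarrow>
      norm (approx_area (\<delta> p) \<omega> s t - approx_area (\<delta> q) \<omega> s t) \<le> e * (t - s) powr (2 * \<beta>)" using area_convergesD[OF assms] by blast
  show ?thesis
  proof (intro exI[of _ N] allI impI)
    fix p s t assume p: "N \<le> p" and st: "- T \<le> s" "s < t" "t \<le> T"
    show "norm (approx_area (\<delta> p) \<omega> s t - lim (\<lambda>i. approx_area (\<delta> i) \<omega> s t)) \<le> e * (t - s) powr (2 * \<beta>)"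
    proof (rule Lim_bounded)
      show "(\<lambda>q. norm (approx_area (\<delta> p) \<omega> s t - approx_area (\<delta> q) \<omega> s t)) \<longlonglongrightarrow> norm (approx_area (\<delta> p) \<omega> s t - lim (\<lambda>i. approx_area (\<delta> i) \<omega> s t))"
        by (intro tendsto_intros area_limit[OF conv]) (use st in simp)
      show "\<forall>q\<ge>N. norm (approx_area (\<delta> p) \<omega> s t - approx_area (\<delta> q) \<omega> s t) \<le> e * (t - s) powr (2 * \<beta>)"
        using N p st by blast
    qed
  qed
qed

lemma approx_area_converges:
  fixes \<omega> :: "'m::finite path"
  assumes w: "hoelder_path \<omega>" and \<delta>: "\<And>n. 0 < \<delta> n" "\<And>n. \<delta> n \<le> 1"
    and conv: "area_converges \<delta> \<omega>" and T: "0 < T" and b: "0 < \<beta>" "\<beta> < 1/2"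
  shows "hoelder_tendsto2 (2 * \<beta>) T (\<lambda>i. approx_area (\<delta> i) \<omega>) (\<lambda>s t. lim (\<lambda>i. approx_area (\<delta> i) \<omega> s t))"
proof -
  let ?V = "\<lambda>s t. lim (\<lambda>i. approx_area (\<delta> i) \<omega> s t)"
  have sp: "approx_area (\<delta> i) \<omega> \<in> hoelder_space2 (2 * \<beta>) T" for i by (rule approx_area_space[OF w \<delta> b])
  note lim = area_limit_rate[OF conv T b]
  show ?thesis
    unfolding hoelder_tendsto2_def
  proof (intro conjI allI sp)
    \<comment> \<open>A single approximation at distance at most 1 shows that the limit inherits a
      finite seminorm.\<close>
    obtain N where N: "\<And>s t. - T \<le> s \<Longrightarrow> s < t \<Longrightarrow> t \<le> T \<Longrightarrow> norm (approx_area (\<delta> N) \<omega> s t - ?V s t) \<le> 1 * (t - s) powr (2 * \<beta>)"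
      using lim[of 1] by (metis order_refl zero_less_one)
    have "hoelder_seminorm2 (2 * \<beta>) T (approx_area (\<delta> N) \<omega>) < \<infinity>" using sp by (simp add: hoelder_space2_def)
    then obtain c where c: "0 \<le> c" "hoelder_seminorm2 (2 * \<beta>) T (approx_area (\<delta> N) \<omega>) = ennreal c"
      by (cases "hoelder_seminorm2 (2 * \<beta>) T (approx_area (\<delta> N) \<omega>)") auto
    show "?V \<in> hoelder_space2 (2 * \<beta>) T"
    proof (rule hoelder_space2I)
      fix s t assume st: "- T \<le> s" "s < t" "t \<le> T"
      have "ennreal (norm (approx_area (\<delta> N) \<omega> s t) / (t - s) powr (2 * \<beta>)) \<le> ennreal c"
        unfolding c(2)[symmetric] hoelder_seminorm2_def using st by (intro SUP_upper2[of "(s, t)"]) auto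
      then have "norm (approx_area (\<delta> N) \<omega> s t) \<le> c * (t - s) powr (2 * \<beta>)" using c st by (simp add: divide_le_eq)
      moreover have "norm (?V s t) \<le> norm (approx_area (\<delta> N) \<omega> s t) + norm (approx_area (\<delta> N) \<omega> s t - ?V s t)"
        by (metis norm_minus_commute norm_triangle_sub)
      ultimately show "norm (?V s t) \<le> (c + 1) * (t - s) powr (2 * \<beta>)" using N[OF st] by (simp add: distrib_right)
    qed
    show "(\<lambda>i. hoelder_seminorm2 (2 * \<beta>) T (\<lambda>s t. approx_area (\<delta> i) \<omega> s t - ?V s t)) \<longlonglongrightarrow> 0"
    proof (rule ennreal_tendsto_zeroI)
      fix e :: real assume e: "0 < e"
      obtain N where N: "\<And>p s t. N \<le> p \<Longrightarrow> - T \<le> s \<Longrightarrow> s < t \<Longrightarrow> t \<le> T \<Longrightarrow> norm (approx_area (\<delta> p) \<omega> s t - ?V s t) \<le> e * (t - s) powr (2 * \<beta>)"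
        using lim[OF e] by blast
      show "eventually (\<lambda>i. hoelder_seminorm2 (2 * \<beta>) T (\<lambda>s t. approx_area (\<delta> i) \<omega> s t - ?V s t) \<le> ennreal e) sequentially"
        unfolding eventually_sequentially by (intro exI[of _ N] allI impI hoelder_seminorm2_le N)
    qed
  qed
qed

section \<open>Invariance under the Wiener shift\<close>

lemma approx_area_shift:
  fixes \<omega> :: "'m::finite path"
  assumes w: "continuous_on UNIV \<omega>" and d: "0 < \<delta>" and st: "s \<le> t"
  shows "approx_area \<delta> (wiener_shift \<tau> \<omega>) s t = approx_area \<delta> \<omega> (s + \<tau>) (t + \<tau>)"
proof -
  have w': "continuous_on UNIV (wiener_shift \<tau> \<omega>)"
    unfolding wiener_shift_def by (intro continuous_intros continuous_shift w)
  have "approx_area \<delta> (wiener_shift \<tau> \<omega>) s t $ i $ j = approx_area \<delta> \<omega> (s + \<tau>) (t + \<tau>) $ i $ j" for i j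
    unfolding approx_area_component[OF w' d st] approx_area_component[OF w d add_right_mono[OF st]]
    by (simp add: wiener_shift_def smooth_area_shift[OF continuous_on_component[OF w] continuous_on_component[OF w] d])
  then show ?thesis by (simp add: vec_eq_iff)
qed

text \<open>A shift translates both times, so the condition on a radius enlarged by the size of the
  shift is enough.\<close>

lemma area_converges_shift:
  fixes \<omega> :: "'m::finite path"
  assumes w: "continuous_on UNIV \<omega>" and d: "\<And>n. 0 < \<delta> n" and conv: "area_converges \<delta> \<omega>"
  shows "area_converges \<delta> (wiener_shift \<tau> \<omega>)"
  unfolding area_converges_def
proof (intro allI impI)
  fix T \<beta> e :: real assume T: "0 < T" and b: "0 < \<beta> \<and> \<beta> < 1/2" and e: "0 < e"
  have "0 < T + \<bar>\<tau>\<bar>" using T by linarith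
  from area_convergesD[OF conv this _ _ e, of \<beta>] b
  obtain N where N: "\<And>p q s t. N \<le> p \<Longrightarrow> N \<le> q \<Longrightarrow> - (T + \<bar>\<tau>\<bar>) \<le> s \<Longrightarrow> s < t \<Longrightarrow> t \<le> T + \<bar>\<tau>\<bar> \<Longrightarrow>
      norm (approx_area (\<delta> p) \<omega> s t - approx_area (\<delta> q) \<omega> s t) \<le> e * (t - s) powr (2 * \<beta>)" by blast
  show "\<exists>N. \<forall>p\<ge>N. \<forall>q\<ge>N. \<forall>s t. - T \<le> s \<longrightarrow> s < t \<longrightarrow> t \<le> T \<longrightarrow>
      norm (approx_area (\<delta> p) (wiener_shift \<tau> \<omega>) s t - approx_area (\<delta> q) (wiener_shift \<tau> \<omega>) s t) \<le> e * (t - s) powr (2 * \<beta>)"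
  proof (intro exI[of _ N] allI impI)
    fix p q s t assume "N \<le> p" "N \<le> q" "- T \<le> s" "s < t" "t \<le> T"
    then show "norm (approx_area (\<delta> p) (wiener_shift \<tau> \<omega>) s t - approx_area (\<delta> q) (wiener_shift \<tau> \<omega>) s t) \<le> e * (t - s) powr (2 * \<beta>)"
      using N[of p q "s + \<tau>" "t + \<tau>"] by (simp add: approx_area_shift[OF w d] less_imp_le)
  qed
qed

text \<open>Stability under all shifts gives one inclusion. For the other, the opposite shift is an
  inverse because paths vanish at 0.\<close>

lemma shift_invariant_converging:
  fixes \<Omega> :: "'m::finite path set"
  assumes inv: "shift_invariant \<Omega>" and sub: "\<Omega> \<subseteq> C0_paths" and d: "\<And>n. 0 < \<delta> n"
  shows "shift_invariant {\<omega> \<in> \<Omega>. area_converges \<delta> \<omega>}"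
proof -
  let ?G = "{\<omega> \<in> \<Omega>. area_converges \<delta> \<omega>}"
  have sh: "wiener_shift \<tau> \<omega> \<in> ?G" if "\<omega> \<in> ?G" for \<tau> \<omega>
    using that inv sub area_converges_shift[where \<delta>=\<delta> and \<omega>=\<omega> and \<tau>=\<tau>, OF _ d] by (auto simp: shift_invariant_def C0_paths_def)
  have inverse: "wiener_shift \<tau> (wiener_shift (- \<tau>) \<omega>) = \<omega>" if "\<omega> \<in> ?G" for \<tau> \<omega>
  proof -
    have "\<omega> 0 = 0" using that sub by (auto simp: C0_paths_def)
    then show ?thesis by (simp add: wiener_shift_def)
  qed
  show ?thesis
    unfolding shift_invariant_def
  proof (intro allI equalityI subsetI)
    fix \<tau> \<omega> assume "\<omega> \<in> ?G"
    then show "\<omega> \<in> wiener_shift \<tau> ` ?G" using sh[of \<omega> "- \<tau>"] inverse[of \<omega> \<tau>] by (metis image_eqI)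
  qed (use sh in blast)
qed

text \<open>Independence is absent on the diagonal, but integration by parts makes the entry exactly
  half the square of a mean increment. Factoring a difference of squares then reduces the claim to
  \<open>mean_incr_error\<close>.\<close>

lemma diagonal_area_error:
  fixes \<omega> :: "'m::finite path"
  assumes c: "continuous_on UNIV \<omega>" and h: "hoelder_up_to 0 R \<gamma> K (\<lambda>r. \<omega> r $ i)" and d: "0 < \<delta>" "\<delta> \<le> 1" and K: "0 \<le> K"
    and g: "0 < \<beta>" "\<beta> < \<gamma>" "\<gamma> \<le> 1"
    and sT: "\<bar>s\<bar> \<le> T" "\<bar>t\<bar> \<le> T" "T + 2 \<le> R" and st: "s < t"
  shows "\<bar>approx_area \<delta> \<omega> s t $ i $ i - 1/2 * (\<omega> t $ i - \<omega> s $ i)\<^sup>2\<bar> \<le> 2 * K\<^sup>2 * (2 * T + 1) * \<delta> powr (\<gamma> - \<beta>) * (t - s) powr (2 * \<beta>)"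
proof -
  let ?x = "\<lambda>r. \<omega> r $ i"
  have T: "0 \<le> T" using sT by linarith
  have R: "\<bar>s\<bar> + \<delta> \<le> R" "\<bar>t\<bar> + \<delta> \<le> R" "\<bar>s\<bar> \<le> R" "\<bar>t\<bar> \<le> R" using sT d by linarith+
  define a where "a = mean \<delta> ?x t - mean \<delta> ?x s"
  define b where "b = ?x t - ?x s"
  have "smooth_area \<delta> ?x ?x s t + smooth_area \<delta> ?x ?x s t = a * a"
    unfolding a_def using st by (intro smooth_area_by_parts continuous_on_component c d) auto
  then have A: "approx_area \<delta> \<omega> s t $ i $ i = 1/2 * a\<^sup>2"
    using st by (simp add: approx_area_component[OF c d(1)] power2_eq_square)
  have 1: "\<bar>a - b\<bar> \<le> 2 * K * (\<delta> powr (\<gamma> - \<beta>) * (t - s) powr \<beta>)"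
    unfolding a_def b_def by (rule mean_incr_error[OF loc_bdd_meas_component[OF c] h d K g sT st])
  have 2: "\<bar>a\<bar> \<le> K * (t - s) powr \<gamma>"
    unfolding a_def by (rule mean_incr_le[OF loc_bdd_meas_component[OF c] d(1) h _ K _ R(2,1)]) (use st g in auto)
  have 3: "\<bar>b\<bar> \<le> K * (t - s) powr \<gamma>"
    unfolding b_def by (rule hoelder_up_toD[OF h R(4,3) _ _ K]) (use st g in auto)
  \<comment> \<open>Lowering the exponent from \<open>\<gamma>\<close> to \<open>\<beta>\<close>
    costs the factor \<open>2 * T + 1\<close>, as times stay in \<open>[- T, T]\<close>.\<close>
  have "(t - s) powr \<gamma> = (t - s) powr (\<gamma> - \<beta>) * (t - s) powr \<beta>" by (simp add: powr_add[symmetric])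
  also have "(t - s) powr (\<gamma> - \<beta>) \<le> (2 * T + 1) powr (\<gamma> - \<beta>)"
  proof -
    have "t - s \<le> 2 * T + 1" using sT by linarith
    then show ?thesis using st g by (intro powr_mono2) auto
  qed
  also have "(2 * T + 1) powr (\<gamma> - \<beta>) \<le> (2 * T + 1) powr 1" using T g by (intro powr_mono) auto
  finally have 4: "(t - s) powr \<gamma> \<le> (2 * T + 1) * (t - s) powr \<beta>" using T by (simp add: mult_right_mono)
  have "1/2 * a\<^sup>2 - 1/2 * b\<^sup>2 = 1/2 * ((a - b) * (a + b))"
    by (simp add: power2_eq_square algebra_simps)
  then have "\<bar>1/2 * a\<^sup>2 - 1/2 * b\<^sup>2\<bar> = 1/2 * (\<bar>a - b\<bar> * \<bar>a + b\<bar>)"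
    by (simp only: abs_mult abs_numeral abs_one abs_divide)
  also have "\<dots> \<le> 1/2 * (2 * K * (\<delta> powr (\<gamma> - \<beta>) * (t - s) powr \<beta>) * (2 * K * ((2 * T + 1) * (t - s) powr \<beta>)))"
  proof (intro mult_left_mono mult_mono 1)
    have "\<bar>a + b\<bar> \<le> 2 * (K * (t - s) powr \<gamma>)" using 2 3 by linarith
    also have "\<dots> \<le> 2 * (K * ((2 * T + 1) * (t - s) powr \<beta>))" using K 4 by (intro mult_left_mono) auto
    finally show "\<bar>a + b\<bar> \<le> 2 * K * ((2 * T + 1) * (t - s) powr \<beta>)" by simp
  qed (use K in auto)
  also have "\<dots> = 2 * K\<^sup>2 * (2 * T + 1) * \<delta> powr (\<gamma> - \<beta>) * ((t - s) powr \<beta> * (t - s) powr \<beta>)"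
    by (simp add: power2_eq_square)
  also have "(t - s) powr \<beta> * (t - s) powr \<beta> = (t - s) powr (2 * \<beta>)" by (simp add: powr_add[symmetric])
  finally show ?thesis unfolding A b_def by simp
qed

section \<open>Measurability of the set of convergence\<close>

lemma borel_measurable_matrix:
  fixes f :: "'a \<Rightarrow> ((real, 'm::finite) vec, 'm) vec"
  assumes "\<And>i j. (\<lambda>x. f x $ i $ j) \<in> borel_measurable M"
  shows "f \<in> borel_measurable M"
proof (subst borel_measurable_euclidean_space, intro ballI)
  fix b :: "((real, 'm) vec, 'm) vec" assume "b \<in> Basis"
  then obtain i j where "b = axis i (axis j 1)" by (auto simp: Basis_vec_def)
  then show "(\<lambda>x. f x \<bullet> b) \<in> borel_measurable M" using assms by (simp add: inner_axis)
qed

lemma approx_area_continuous: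
  fixes \<omega> :: "'m::finite path"
  assumes "continuous_on UNIV \<omega>" "0 < \<delta>"
  shows "continuous_on {(s, t). s \<le> t} (\<lambda>(s, t). approx_area \<delta> \<omega> s t)"
proof -
  have "continuous_on {(s, t). s \<le> t} (\<lambda>z. \<chi> i j. smooth_area \<delta> (\<lambda>r. \<omega> r $ i) (\<lambda>r. \<omega> r $ j) (fst z) (snd z))"
    using smooth_area_continuous[OF continuous_on_component[OF assms(1)] continuous_on_component[OF assms(1)] assms(2)]
    by (intro continuous_on_vec_lambda) (simp add: case_prod_unfold)
  then show ?thesis
    by (rule continuous_on_cong[THEN iffD1, rotated -1])
       (auto simp: vec_eq_iff approx_area_component[OF assms])
qed

lemma pair_sequence_tendsto:
  assumes c: "continuous_on {(s, t). s \<le> t} (\<lambda>(s, t). f s t)" and st: "s \<le> t"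
  shows "(\<lambda>n. f (real_of_rat (rat_below s n)) (real_of_rat (rat_below t n))) \<longlonglongrightarrow> f s (t :: real)"
proof -
  have "(\<lambda>n. (\<lambda>(s, t). f s t) (real_of_rat (rat_below s n), real_of_rat (rat_below t n))) \<longlonglongrightarrow> (\<lambda>(s, t). f s t) (s, t)"
    by (rule continuous_on_tendsto_compose[OF c])
       (use st in \<open>auto intro!: tendsto_Pair rat_below_tendsto always_eventually rat_below_mono simp: of_rat_less_eq\<close>)
  then show ?thesis by simp
qed

text \<open>For fixed indices both sides are continuous in the times, so the condition extends from
  rational to real times, leaving countably many measurable conditions.\<close>

lemma area_converges_rational:
  fixes \<omega> :: "'m::finite path"
  assumes w: "continuous_on UNIV \<omega>" and d: "\<And>n. 0 < \<delta> n"
    and r: "\<forall>m k :: nat. \<exists>N. \<forall>p\<ge>N. \<forall>q\<ge>N. \<forall>(s :: rat) (t :: rat). - real m \<le> of_rat s \<longrightarrow> s < t \<longrightarrow> of_rat t \<le> real m \<longrightarrow>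
      norm (approx_area (\<delta> p) \<omega> (of_rat s) (of_rat t) - approx_area (\<delta> q) \<omega> (of_rat s) (of_rat t)) \<le>
        1 / (real k + 1) * (of_rat t - of_rat s) powr (2 * exponent m)"
  shows "area_converges \<delta> \<omega>"
proof (rule area_converges_countable)
  fix m k :: nat
  obtain N where N: "\<And>p q (s :: rat) (t :: rat). N \<le> p \<Longrightarrow> N \<le> q \<Longrightarrow> - real m \<le> of_rat s \<Longrightarrow> s < t \<Longrightarrow> of_rat t \<le> real m \<Longrightarrow>
      norm (approx_area (\<delta> p) \<omega> (of_rat s) (of_rat t) - approx_area (\<delta> q) \<omega> (of_rat s) (of_rat t)) \<le>
        1 / (real k + 1) * (of_rat t - of_rat s) powr (2 * exponent m)"
    using r by blast
  show "\<exists>N. \<forall>p\<ge>N. \<forall>q\<ge>N. \<forall>s t. - real m \<le> s \<longrightarrow> s < t \<longrightarrow> t \<le> real m \<longrightarrow>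
      norm (approx_area (\<delta> p) \<omega> s t - approx_area (\<delta> q) \<omega> s t) \<le> 1 / (real k + 1) * (t - s) powr (2 * exponent m)"
  proof (intro exI[of _ N] allI impI)
    fix p q s t assume pq: "N \<le> p" "N \<le> q" and st: "- real m \<le> s" "s < t" "t \<le> real m"
    let ?s = "\<lambda>n. real_of_rat (rat_below s n)" and ?t = "\<lambda>n. real_of_rat (rat_below t n)"
    have b: "\<bar>?s n\<bar> \<le> real m" "\<bar>?t n\<bar> \<le> real m" for n
    proof -
      show "\<bar>?s n\<bar> \<le> real m" by (rule rat_below_bound) (use st in auto)
      show "\<bar>?t n\<bar> \<le> real m" by (rule rat_below_bound) (use st in auto)
    qed
    \<comment> \<open>Rounding could merge the two times; since \<open>s < t\<close>, this happens
      only finitely often.\<close>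
    have "eventually (\<lambda>n. 0 < ?t n - ?s n) sequentially"
      by (rule order_tendstoD(1)[where y="t - s"]) (use st in \<open>auto intro!: tendsto_diff rat_below_tendsto\<close>)
    then have ev: "eventually (\<lambda>n. norm (approx_area (\<delta> p) \<omega> (?s n) (?t n) - approx_area (\<delta> q) \<omega> (?s n) (?t n)) \<le>
        1 / (real k + 1) * (?t n - ?s n) powr (2 * exponent m)) sequentially"
    proof eventually_elim
      case (elim n)
      have "rat_below s n < rat_below t n" using elim by (simp add: of_rat_less)
      moreover have "- real m \<le> ?s n" "?t n \<le> real m" using b[of n] by linarith+
      ultimately show ?case by (intro N pq)
    qed
    show "norm (approx_area (\<delta> p) \<omega> s t - approx_area (\<delta> q) \<omega> s t) \<le> 1 / (real k + 1) * (t - s) powr (2 * exponent m)"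
    proof (rule tendsto_le[OF _ _ _ ev])
      show "(\<lambda>n. norm (approx_area (\<delta> p) \<omega> (?s n) (?t n) - approx_area (\<delta> q) \<omega> (?s n) (?t n))) \<longlonglongrightarrow>
          norm (approx_area (\<delta> p) \<omega> s t - approx_area (\<delta> q) \<omega> s t)"
        by (intro tendsto_norm tendsto_diff pair_sequence_tendsto[OF approx_area_continuous[OF w d]] less_imp_le st)
      show "(\<lambda>n. 1 / (real k + 1) * (?t n - ?s n) powr (2 * exponent m)) \<longlonglongrightarrow> 1 / (real k + 1) * (t - s) powr (2 * exponent m)"
        using st by (intro tendsto_mult tendsto_const tendsto_powr tendsto_diff rat_below_tendsto) auto
    qed simp
  qed
qed

context wiener
begin

lemma approx_area_measurable:
  assumes "0 < \<delta>" "\<delta> \<le> 1" "s \<le> t"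
  shows "(\<lambda>\<omega>. approx_area \<delta> \<omega> s t) \<in> borel_measurable W"
proof (rule borel_measurable_matrix)
  fix i j
  show "(\<lambda>\<omega>. approx_area \<delta> \<omega> s t $ i $ j) \<in> borel_measurable W"
    using smooth_area_measurable[OF assms(1,2)]
    by (subst measurable_cong[OF approx_area_component]) (auto simp: space_W assms)
qed

lemma area_converges_sets:
  assumes \<delta>: "\<And>n. 0 < \<delta> n" "\<And>n. \<delta> n \<le> 1"
  shows "{\<omega> \<in> space W. area_converges \<delta> \<omega>} \<in> sets W"
proof -
  \<comment> \<open>Measurability of the area is available for ordered times only; the value 0
    elsewhere makes the expression measurable for all pairs of rationals.\<close>
  define f where "f p \<omega> s t = (if s < t then approx_area (\<delta> p) \<omega> s t else 0)" for p and \<omega> :: "'m path" and s t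
  have [measurable]: "(\<lambda>\<omega>. f p \<omega> s t) \<in> borel_measurable W" for p s t
    unfolding f_def by (cases "s < t") (auto intro!: approx_area_measurable \<delta>)
  have "{\<omega> \<in> space W. area_converges \<delta> \<omega>} = {\<omega> \<in> space W. \<forall>m k :: nat. \<exists>N. \<forall>p\<ge>N. \<forall>q\<ge>N. \<forall>(s :: rat) (t :: rat).
      - real m \<le> of_rat s \<longrightarrow> s < t \<longrightarrow> of_rat t \<le> real m \<longrightarrow>
      norm (f p \<omega> (of_rat s) (of_rat t) - f q \<omega> (of_rat s) (of_rat t)) \<le>
        1 / (real k + 1) * (of_rat t - of_rat s) powr (2 * exponent m)}" (is "_ = ?B")
  proof (intro equalityI subsetI)
    fix \<omega> assume w: "\<omega> \<in> {\<omega> \<in> space W. area_converges \<delta> \<omega>}"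
    have *: "\<exists>N. \<forall>p\<ge>N. \<forall>q\<ge>N. \<forall>s t. - real m \<le> s \<longrightarrow> s < t \<longrightarrow> t \<le> real m \<longrightarrow>
      norm (approx_area (\<delta> p) \<omega> s t - approx_area (\<delta> q) \<omega> s t) \<le> 1 / (real k + 1) * (t - s) powr (2 * exponent m)" for m k :: nat
    proof (cases "m = 0")
      case False
      have "0 < exponent m" "0 < 1 / (real k + 1)" using exponent(1)[of m] by auto
      then show ?thesis
        using w False exponent(2)[of m] by (intro area_convergesD) auto
    qed auto
    show "\<omega> \<in> ?B"
    proof (intro CollectI conjI allI)
      fix m k :: nat
      obtain N where N: "\<And>p q s t. N \<le> p \<Longrightarrow> N \<le> q \<Longrightarrow> - real m \<le> s \<Longrightarrow> s < t \<Longrightarrow> t \<le> real m \<Longrightarrow>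
        norm (approx_area (\<delta> p) \<omega> s t - approx_area (\<delta> q) \<omega> s t) \<le> 1 / (real k + 1) * (t - s) powr (2 * exponent m)"
        using *[of m k] by blast
      show "\<exists>N. \<forall>p\<ge>N. \<forall>q\<ge>N. \<forall>(s :: rat) (t :: rat). - real m \<le> of_rat s \<longrightarrow> s < t \<longrightarrow> of_rat t \<le> real m \<longrightarrow>
        norm (f p \<omega> (of_rat s) (of_rat t) - f q \<omega> (of_rat s) (of_rat t)) \<le>
          1 / (real k + 1) * (of_rat t - of_rat s) powr (2 * exponent m)"
      proof (intro exI[of _ N] allI impI)
        fix p q and s t :: rat
        assume "N \<le> p" "N \<le> q" "- real m \<le> of_rat s" "s < t" "of_rat t \<le> real m"
        then show "norm (f p \<omega> (of_rat s) (of_rat t) - f q \<omega> (of_rat s) (of_rat t)) \<le>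
          1 / (real k + 1) * (of_rat t - of_rat s) powr (2 * exponent m)"
          using N[of p q "of_rat s" "of_rat t"] by (simp add: f_def of_rat_less)
      qed
    qed (use w in simp)
  next
    fix \<omega> assume w: "\<omega> \<in> ?B"
    have "area_converges \<delta> \<omega>"
    proof (rule area_converges_rational[OF _ \<delta>(1)])
      show "continuous_on UNIV \<omega>" using w by (simp add: space_W)
      show "\<forall>m k :: nat. \<exists>N. \<forall>p\<ge>N. \<forall>q\<ge>N. \<forall>(s :: rat) (t :: rat). - real m \<le> of_rat s \<longrightarrow> s < t \<longrightarrow> of_rat t \<le> real m \<longrightarrow>
        norm (approx_area (\<delta> p) \<omega> (of_rat s) (of_rat t) - approx_area (\<delta> q) \<omega> (of_rat s) (of_rat t)) \<le>
        1 / (real k + 1) * (of_rat t - of_rat s) powr (2 * exponent m)"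
        using w by (simp add: f_def of_rat_less)
    qed
    then show "\<omega> \<in> {\<omega> \<in> space W. area_converges \<delta> \<omega>}" using w by simp
  qed
  also have "\<dots> \<in> sets W" by measurable
  finally show ?thesis .
qed

text \<open>Off the diagonal the probabilistic estimate is used, on it the deterministic one; a
  maximum over the finitely many entries then gives the matrix norm.\<close>

lemma AE_area_converges:
  assumes h: "AE \<omega> in W. hoelder_path \<omega>" and \<delta>: "\<And>n. 0 < \<delta> n" "\<And>n. \<delta> n \<le> 1" "sufficiently_fast \<delta>"
  shows "AE \<omega> in W. area_converges \<delta> \<omega>"
proof -
  have \<delta>0: "\<delta> \<longlonglongrightarrow> 0" using \<delta>(3) by (simp add: sufficiently_fast_def)
  define \<gamma> where "\<gamma> m = (exponent m + 1/2) / 2" for m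
  have g: "exponent m < \<gamma> m" "\<gamma> m < 1/2" "0 < \<gamma> m" for m using exponent[of m] by (auto simp: \<gamma>_def)
  define G where "G \<omega> i j m e \<longleftrightarrow> (\<exists>N. \<forall>p\<ge>N. \<forall>q\<ge>N. \<forall>s t. \<bar>s\<bar> \<le> real m \<longrightarrow> \<bar>t\<bar> \<le> real m \<longrightarrow> s < t \<longrightarrow>
     \<bar>smooth_area (\<delta> p) (\<lambda>r. \<omega> r $ i) (\<lambda>r. \<omega> r $ j) s t - smooth_area (\<delta> q) (\<lambda>r. \<omega> r $ i) (\<lambda>r. \<omega> r $ j) s t\<bar>
       \<le> e * (t - s) powr (2 * exponent m))" for \<omega> :: "'m path" and i j and m :: nat and e :: real
  \<comment> \<open>Countably many radii and Hoelder constants and finitely many entries share one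
    null set. Almost every path has some constant \<open>K\<close>, so the truncation is removed
    afterwards.\<close>
  have "AE \<omega> in W. \<forall>m K :: nat. \<forall>i\<in>UNIV. \<forall>j\<in>UNIV. i \<noteq> j \<longrightarrow> \<omega> \<in> hoelder_paths (real (m + 2)) (\<gamma> m) (real K) \<longrightarrow> (\<forall>e>0. G \<omega> i j m e)"
    unfolding G_def AE_all_countable
  proof (intro allI AE_finite_allI finite)
    fix m K :: nat and i j :: 'm
    show "AE \<omega> in W. i \<noteq> j \<longrightarrow> \<omega> \<in> hoelder_paths (real (m + 2)) (\<gamma> m) (real K) \<longrightarrow> (\<forall>e>0. \<exists>N. \<forall>p\<ge>N. \<forall>q\<ge>N. \<forall>s t. \<bar>s\<bar> \<le> real m \<longrightarrow> \<bar>t\<bar> \<le> real m \<longrightarrow> s < t \<longrightarrow>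
     \<bar>smooth_area (\<delta> p) (\<lambda>r. \<omega> r $ i) (\<lambda>r. \<omega> r $ j) s t - smooth_area (\<delta> q) (\<lambda>r. \<omega> r $ i) (\<lambda>r. \<omega> r $ j) s t\<bar>
       \<le> e * (t - s) powr (2 * exponent m))"
    proof (cases "i = j")
      case False
      show ?thesis
        by (rule AE_mp[OF area_cauchy_component[OF False _ exponent(1) g(1,2) _ _ \<delta>, of "real K" "real m" "m + 2" m]])
           (auto intro!: AE_I2)
    qed simp
  qed
  then show ?thesis
    using h AE_space
  proof eventually_elim
    case (elim \<omega>)
    have c: "continuous_on UNIV \<omega>" using elim(2) by (simp add: hoelder_path_def)
    show ?case
    proof (rule area_converges_countable)
      fix m k :: nat
      define \<beta> where "\<beta> = exponent m"
      \<comment> \<open>The factor cancels the number of entries lost in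
        \<open>norm_matrix_le\<close>.\<close>
      define e where "e = 1 / ((real k + 1) * (real CARD('m))\<^sup>2)"
      have e: "0 < e" by (simp add: e_def)
      obtain K :: nat where K: "\<And>i. hoelder_up_to 0 (real (m + 2)) (\<gamma> m) (real K) (\<lambda>r. \<omega> r $ i)"
        by (rule hoelder_path_components[OF elim(2) g(3,2), of "real (m + 2)" m]) auto
      have off: "G \<omega> i j m e" if "i \<noteq> j" for i j
        using elim(1,3) K that e unfolding hoelder_paths_def by blast
      have diag: "G \<omega> i i m e" for i
      proof -
        define D where "D = 2 * (real K)\<^sup>2 * (2 * real m + 1)"
        have "(\<lambda>n. D * \<delta> n powr (\<gamma> m - \<beta>)) \<longlonglongrightarrow> D * 0 powr (\<gamma> m - \<beta>)"
          by (intro tendsto_intros tendsto_powr' \<delta>0)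
             (use \<delta>(1) g(1)[of m] in \<open>auto intro!: always_eventually less_imp_le simp: \<beta>_def\<close>)
        then have "eventually (\<lambda>n. D * \<delta> n powr (\<gamma> m - \<beta>) < e / 2) sequentially"
          by (rule order_tendstoD(2)) (use e in simp)
        then obtain N where N: "\<And>n. N \<le> n \<Longrightarrow> D * \<delta> n powr (\<gamma> m - \<beta>) < e / 2" unfolding eventually_sequentially by blast
        show ?thesis unfolding G_def
        proof (intro exI[of _ N] allI impI)
          fix p q s t assume pq: "N \<le> p" "N \<le> q" and st: "\<bar>s\<bar> \<le> real m" "\<bar>t\<bar> \<le> real m" "s < t"
          have err: "\<bar>smooth_area (\<delta> n) (\<lambda>r. \<omega> r $ i) (\<lambda>r. \<omega> r $ i) s t - 1/2 * (\<omega> t $ i - \<omega> s $ i)\<^sup>2\<bar> \<le> e / 2 * (t - s) powr (2 * \<beta>)"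
            if n: "N \<le> n" for n
          proof -
            have "\<bar>approx_area (\<delta> n) \<omega> s t $ i $ i - 1/2 * (\<omega> t $ i - \<omega> s $ i)\<^sup>2\<bar> \<le> D * \<delta> n powr (\<gamma> m - \<beta>) * (t - s) powr (2 * \<beta>)"
              unfolding D_def
              by (rule diagonal_area_error[OF c K \<delta>(1,2) _ _ _ _ st(1,2) _ st(3)])
                 (use g[of m] exponent(1)[of m] in \<open>auto simp: \<beta>_def\<close>)
            also have "\<dots> \<le> e / 2 * (t - s) powr (2 * \<beta>)" using N[OF n] by (intro mult_right_mono) auto
            finally show ?thesis using st by (simp add: approx_area_component[OF c \<delta>(1)])
          qed
          show "\<bar>smooth_area (\<delta> p) (\<lambda>r. \<omega> r $ i) (\<lambda>r. \<omega> r $ i) s t - smooth_area (\<delta> q) (\<lambda>r. \<omega> r $ i) (\<lambda>r. \<omega> r $ i) s t\<bar>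
            \<le> e * (t - s) powr (2 * exponent m)"
            using err[OF pq(1)] err[OF pq(2)] unfolding \<beta>_def by linarith
        qed
      qed
      have "\<forall>z\<in>UNIV. \<exists>N. \<forall>p\<ge>N. \<forall>q\<ge>N. \<forall>s t. \<bar>s\<bar> \<le> real m \<longrightarrow> \<bar>t\<bar> \<le> real m \<longrightarrow> s < t \<longrightarrow>
        \<bar>smooth_area (\<delta> p) (\<lambda>r. \<omega> r $ fst z) (\<lambda>r. \<omega> r $ snd z) s t - smooth_area (\<delta> q) (\<lambda>r. \<omega> r $ fst z) (\<lambda>r. \<omega> r $ snd z) s t\<bar>
       \<le> e * (t - s) powr (2 * exponent m)"
        using off diag unfolding G_def by metis
      then obtain N where N: "\<And>z p q s t. N z \<le> p \<Longrightarrow> N z \<le> q \<Longrightarrow> \<bar>s\<bar> \<le> real m \<Longrightarrow> \<bar>t\<bar> \<le> real m \<Longrightarrow> s < t \<Longrightarrow>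
        \<bar>smooth_area (\<delta> p) (\<lambda>r. \<omega> r $ fst z) (\<lambda>r. \<omega> r $ snd z) s t - smooth_area (\<delta> q) (\<lambda>r. \<omega> r $ fst z) (\<lambda>r. \<omega> r $ snd z) s t\<bar>
       \<le> e * (t - s) powr (2 * exponent m)"
        by (metis UNIV_I)
      define M where "M = Max (range N)"
      have M: "N z \<le> M" for z unfolding M_def by (intro Max_ge) auto
      show "\<exists>N. \<forall>p\<ge>N. \<forall>q\<ge>N. \<forall>s t. - real m \<le> s \<longrightarrow> s < t \<longrightarrow> t \<le> real m \<longrightarrow>
        norm (approx_area (\<delta> p) \<omega> s t - approx_area (\<delta> q) \<omega> s t) \<le> 1 / (real k + 1) * (t - s) powr (2 * exponent m)"
      proof (intro exI[of _ M] allI impI)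
        fix p q s t assume pq: "M \<le> p" "M \<le> q" and st: "- real m \<le> s" "s < t" "t \<le> real m"
        have "norm (approx_area (\<delta> p) \<omega> s t - approx_area (\<delta> q) \<omega> s t) \<le> (real CARD('m))\<^sup>2 * (e * (t - s) powr (2 * exponent m))"
        proof (rule norm_matrix_le)
          fix i j
          show "\<bar>(approx_area (\<delta> p) \<omega> s t - approx_area (\<delta> q) \<omega> s t) $ i $ j\<bar> \<le> e * (t - s) powr (2 * exponent m)"
            using N[of "(i, j)" p q s t] M[of "(i, j)"] pq st
            by (simp add: approx_area_component[OF c \<delta>(1)] less_imp_le abs_le_iff)
        qed
        also have "\<dots> = 1 / (real k + 1) * (t - s) powr (2 * exponent m)" by (simp add: e_def)
        finally show "norm (approx_area (\<delta> p) \<omega> s t - approx_area (\<delta> q) \<omega> s t) \<le> 1 / (real k + 1) * (t - s) powr (2 * exponent m)" .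
      qed
    qed
  qed
qed

text \<open>The expected sum of high powers of the truncated errors is finite, so these powers are
  almost surely summable and the errors tend to zero. The partitions are tied to the scales by the
  mesh condition.\<close>

lemma stieltjes_tendsto_area:
  assumes h: "AE \<omega> in W. hoelder_path \<omega>" and \<delta>: "\<And>n. 0 < \<delta> n" "\<And>n. \<delta> n \<le> 1" "sufficiently_fast \<delta>"
    and ij: "i \<noteq> j" and st: "s < t"
    and p: "\<And>n. partition_of s t (l n) (\<pi> n)" "\<And>n k. k < l n \<Longrightarrow> \<pi> n (Suc k) - \<pi> n k \<le> \<delta> n"
  shows "AE \<omega> in W. (\<lambda>n. smooth_area (\<delta> n) (\<lambda>r. \<omega> r $ i) (\<lambda>r. \<omega> r $ j) s t -
      stieltjes_sum (l n) (\<pi> n) (\<lambda>r. \<omega> r $ i) (\<lambda>r. \<omega> r $ j)) \<longlonglongrightarrow> 0"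
proof -
  obtain q where q: "0 < q" "summable (\<lambda>n. \<delta> n powr q)" and \<delta>0: "\<delta> \<longlonglongrightarrow> 0"
    using \<delta>(3) unfolding sufficiently_fast_def by blast
  \<comment> \<open>At Hoelder exponent 1/4 the moment of order \<open>2 * p'\<close> is of order
    \<open>\<delta> powr (p' / 2)\<close>, which is at most \<open>\<delta> powr q\<close>.\<close>
  obtain p' :: nat where p': "2 * q \<le> real p'" using real_arch_simple by blast
  obtain R :: nat where R: "\<bar>s\<bar> + \<bar>t\<bar> + 2 \<le> real R" using real_arch_simple by blast
  \<comment> \<open>The moment bound requires \<open>\<delta> n \<le> t - s\<close>; finitely many
    indices are dropped for this.\<close>
  have "eventually (\<lambda>n. \<delta> n < t - s) sequentially" using \<delta>0 st by (intro order_tendstoD(2)[where y=0]) auto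
  then obtain N where N: "\<And>n. N \<le> n \<Longrightarrow> \<delta> n < t - s" unfolding eventually_sequentially by blast
  define d where "d n \<omega> = smooth_area (\<delta> (n + N)) (\<lambda>r. \<omega> r $ i) (\<lambda>r. \<omega> r $ j) s t -
      stieltjes_sum (l (n + N)) (\<pi> (n + N)) (\<lambda>r. \<omega> r $ i) (\<lambda>r. \<omega> r $ j)" for n and \<omega> :: "'m path"
  have [measurable]: "d n \<in> borel_measurable W" for n
    unfolding d_def by (intro borel_measurable_diff smooth_area_measurable stieltjes_measurable \<delta>)
  have K: "AE \<omega> in W. \<forall>K :: nat. \<omega> \<in> hoelder_paths (real R) (1/4) (real K) \<longrightarrow> (\<lambda>n. d n \<omega>) \<longlonglongrightarrow> 0"
    unfolding AE_all_countable
  proof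
    fix K :: nat
    let ?H = "hoelder_paths (real R) (1/4) (real K)"
    have [measurable]: "?H \<in> sets W" by (rule hoelder_paths_sets) simp
    define C where "C = 4 * fact (2 * p') * (80 * (real K)\<^sup>2 * (t - s)) ^ p'"
    have C0: "0 \<le> C" unfolding C_def using st by simp
    have "(\<integral>\<^sup>+\<omega>. (\<Sum>n. indicator ?H \<omega> * ennreal (d n \<omega> ^ (2 * p'))) \<partial>W) = (\<Sum>n. \<integral>\<^sup>+\<omega>. indicator ?H \<omega> * ennreal (d n \<omega> ^ (2 * p')) \<partial>W)"
      by (rule nn_integral_suminf) measurable
    also have "\<dots> \<le> (\<Sum>n. ennreal (C * \<delta> (n + N) powr q))"
    proof (intro suminf_le allI)
      fix n
      have "(\<integral>\<^sup>+\<omega>. indicator ?H \<omega> * ennreal (d n \<omega> ^ (2 * p')) \<partial>W) \<le>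
        ennreal (4 * fact (2 * p') * (80 * (real K)\<^sup>2 * \<delta> (n + N) powr (2 * (1/4)) * (t - s)) ^ p')"
        unfolding d_def
        by (rule area_error_moment[OF ij \<delta>(1,2) _ _ _ _ _ _ _ p, where T="\<bar>s\<bar> + \<bar>t\<bar>"]) (use N[of "n + N"] R in auto)
      also have "\<dots> \<le> ennreal (C * \<delta> (n + N) powr q)"
      proof (rule ennreal_leI)
        have "(\<delta> (n + N) powr (2 * (1/4))) ^ p' = \<delta> (n + N) powr (1/2 * real p')"
          using \<delta>(1)[of "n + N"] by (simp add: powr_realpow[symmetric] powr_powr)
        also have "\<dots> \<le> \<delta> (n + N) powr q" using \<delta>(1)[of "n + N"] \<delta>(2)[of "n + N"] p' by (intro powr_mono') (auto intro: less_imp_le)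
        finally have "C * (\<delta> (n + N) powr (2 * (1/4))) ^ p' \<le> C * \<delta> (n + N) powr q" using C0 by (rule mult_left_mono)
        then show "4 * fact (2 * p') * (80 * (real K)\<^sup>2 * \<delta> (n + N) powr (2 * (1/4)) * (t - s)) ^ p' \<le> C * \<delta> (n + N) powr q"
          by (simp add: C_def power_mult_distrib mult.assoc mult.left_commute mult.commute)
      qed
      finally show "(\<integral>\<^sup>+\<omega>. indicator ?H \<omega> * ennreal (d n \<omega> ^ (2 * p')) \<partial>W) \<le> ennreal (C * \<delta> (n + N) powr q)" .
    qed auto
    also have "\<dots> < \<infinity>"
    proof -
      have "summable (\<lambda>n. C * \<delta> (n + N) powr q)" using summable_ignore_initial_segment[OF q(2), of N] by (intro summable_mult) simp
      then show ?thesis using C0 by (subst suminf_ennreal2) auto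
    qed
    finally have "AE \<omega> in W. (\<Sum>n. indicator ?H \<omega> * ennreal (d n \<omega> ^ (2 * p'))) \<noteq> \<infinity>"
      by (intro nn_integral_PInf_AE) auto
    then show "AE \<omega> in W. \<omega> \<in> ?H \<longrightarrow> (\<lambda>n. d n \<omega>) \<longlonglongrightarrow> 0"
    proof (eventually_elim, intro impI)
      case (elim \<omega>)
      assume "\<omega> \<in> ?H"
      then have "(\<Sum>n. ennreal (d n \<omega> ^ (2 * p'))) \<noteq> top" using elim by simp
      then have "summable (\<lambda>n. d n \<omega> ^ (2 * p'))" by (intro summable_suminf_not_top) auto
      then have lim: "(\<lambda>n. d n \<omega> ^ (2 * p')) \<longlonglongrightarrow> 0" by (rule summable_LIMSEQ_zero)
      have p0: "0 < 2 * p'" using p' q(1) by (cases p') auto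
      have "(\<lambda>n. root (2 * p') (d n \<omega> ^ (2 * p'))) \<longlonglongrightarrow> root (2 * p') 0" by (intro tendsto_real_root lim)
      moreover have "root (2 * p') (d n \<omega> ^ (2 * p')) = \<bar>d n \<omega>\<bar>" for n
        using p0 real_root_power_cancel[OF p0, of "\<bar>d n \<omega>\<bar>"] by (simp add: power_even_abs)
      ultimately show "(\<lambda>n. d n \<omega>) \<longlonglongrightarrow> 0" by (simp add: tendsto_rabs_zero_iff)
    qed
  qed
  show ?thesis
    using K h AE_space
  proof eventually_elim
    case (elim \<omega>)
    obtain K :: nat where "\<And>i. hoelder_up_to 0 (real R) (1/4) (real K) (\<lambda>r. \<omega> r $ i)"
      by (rule hoelder_path_components[OF elim(2), of "1/4" "real R"]) auto
    then have "\<omega> \<in> hoelder_paths (real R) (1/4) (real K)" using elim(3) by (simp add: hoelder_paths_def)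
    then have "(\<lambda>n. d n \<omega>) \<longlonglongrightarrow> 0" using elim(1) by blast
    then show ?case unfolding d_def by (rule LIMSEQ_offset)
  qed
qed

text \<open>The limit is also the almost sure limit of auxiliary Stieltjes sums of mesh below
  \<open>\<delta> m\<close>. The mean square bound between two Stieltjes sums of mesh below
  \<open>\<eta>\<close> therefore passes to the limit by Fatou's lemma.\<close>

lemma limit_area_L2:
  assumes h: "AE \<omega> in W. hoelder_path \<omega>" and \<delta>: "\<And>n. 0 < \<delta> n" "\<And>n. \<delta> n \<le> 1" "sufficiently_fast \<delta>"
    and ij: "i \<noteq> j" and st: "s \<le> t" and \<eta>: "0 < \<eta>"
    and V: "AE \<omega> in W. (\<lambda>n. smooth_area (\<delta> n) (\<lambda>r. \<omega> r $ i) (\<lambda>r. \<omega> r $ j) s t) \<longlonglongrightarrow> V \<omega>"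
    and p: "partition_of s t n \<pi>" "\<And>k. k < n \<Longrightarrow> \<pi> (Suc k) - \<pi> k < \<eta>"
  shows "(\<integral>\<^sup>+\<omega>. ennreal ((stieltjes_sum n \<pi> (\<lambda>r. \<omega> r $ i) (\<lambda>r. \<omega> r $ j) - V \<omega>)\<^sup>2) \<partial>W) \<le> ennreal (64 * \<eta> * (t - s))"
proof (cases "s = t")
  case True
  have z: "smooth_area d x y s s = 0" for d x y
  proof -
    have "smooth_area d x y s s = (LBINT r:{s..s}. 0)"
      unfolding smooth_area_def by (intro set_lebesgue_integral_cong) auto
    then show ?thesis by simp
  qed
  have "AE \<omega> in W. V \<omega> = 0" using V unfolding True[symmetric] z
    by eventually_elim (simp add: LIMSEQ_const_iff)
  moreover have "stieltjes_sum n \<pi> x y = 0" for x y :: "real \<Rightarrow> real"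
  proof -
    have "\<pi> k = s" if "k \<le> n" for k using partition_mem[OF p(1) that] True by simp
    then show ?thesis unfolding stieltjes_sum_def by (intro sum.neutral) auto
  qed
  ultimately have "(\<integral>\<^sup>+\<omega>. ennreal ((stieltjes_sum n \<pi> (\<lambda>r. \<omega> r $ i) (\<lambda>r. \<omega> r $ j) - V \<omega>)\<^sup>2) \<partial>W) = (\<integral>\<^sup>+\<omega>. 0 \<partial>W)"
    by (intro nn_integral_cong_AE) auto
  then show ?thesis by simp
next
  case False
  \<comment> \<open>The mesh is below \<open>\<eta>\<close> for the mean square bound and below
    \<open>\<delta> m\<close> for convergence to the limit area.\<close>
  have "\<forall>m. \<exists>l \<pi>'. partition_of s t l \<pi>' \<and> (\<forall>k<l. \<pi>' (Suc k) - \<pi>' k < min \<eta> (\<delta> m))"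
    using fine_partition[OF st] \<eta> \<delta>(1) by (metis min_less_iff_conj)
  then obtain l \<pi>' where l: "\<And>m. partition_of s t (l m) (\<pi>' m)" "\<And>m k. k < l m \<Longrightarrow> \<pi>' m (Suc k) - \<pi>' m k < min \<eta> (\<delta> m)"
    by metis
  let ?S = "\<lambda>n \<pi> \<omega>. stieltjes_sum n \<pi> (\<lambda>r. \<omega> r $ i) (\<lambda>r. \<omega> r $ j)"
  have "AE \<omega> in W. (\<lambda>m. smooth_area (\<delta> m) (\<lambda>r. \<omega> r $ i) (\<lambda>r. \<omega> r $ j) s t - ?S (l m) (\<pi>' m) \<omega>) \<longlonglongrightarrow> 0"
    by (rule stieltjes_tendsto_area[OF h \<delta> ij _ l(1)]) (use False st l(2) in \<open>auto intro: less_imp_le\<close>)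
  with V have "AE \<omega> in W. ennreal ((?S n \<pi> \<omega> - V \<omega>)\<^sup>2) = liminf (\<lambda>m. ennreal ((?S n \<pi> \<omega> - ?S (l m) (\<pi>' m) \<omega>)\<^sup>2))"
  proof eventually_elim
    case (elim \<omega>)
    have "(\<lambda>m. ?S (l m) (\<pi>' m) \<omega>) \<longlonglongrightarrow> V \<omega> - 0"
      using tendsto_diff[OF elim] by simp
    then have "(\<lambda>m. ennreal ((?S n \<pi> \<omega> - ?S (l m) (\<pi>' m) \<omega>)\<^sup>2)) \<longlonglongrightarrow> ennreal ((?S n \<pi> \<omega> - V \<omega>)\<^sup>2)"
      by (intro tendsto_ennrealI tendsto_power tendsto_diff tendsto_const) simp
    then show ?case by (intro lim_imp_Liminf[symmetric]) auto
  qed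
  then have "(\<integral>\<^sup>+\<omega>. ennreal ((?S n \<pi> \<omega> - V \<omega>)\<^sup>2) \<partial>W) = (\<integral>\<^sup>+\<omega>. liminf (\<lambda>m. ennreal ((?S n \<pi> \<omega> - ?S (l m) (\<pi>' m) \<omega>)\<^sup>2)) \<partial>W)"
    by (rule nn_integral_cong_AE)
  also have "\<dots> \<le> liminf (\<lambda>m. \<integral>\<^sup>+\<omega>. ennreal ((?S n \<pi> \<omega> - ?S (l m) (\<pi>' m) \<omega>)\<^sup>2) \<partial>W)"
    by (rule nn_integral_liminf) measurable
  also have "\<dots> \<le> liminf (\<lambda>m. ennreal (64 * \<eta> * (t - s)))"
    by (intro Liminf_mono always_eventually allI stieltjes_L2[OF ij st \<eta> p l(1)]) (use l(2) in auto)
  also have "\<dots> = ennreal (64 * \<eta> * (t - s))" by (simp add: Liminf_const)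
  finally show ?thesis .
qed

end

section \<open>The limit is a version of the area\<close>

lemma L2_stieltjes_limit_unique:
  fixes P :: "'m::finite path measure"
  assumes X: "L2_stieltjes_limit P s t i j X" "X \<in> borel_measurable P"
    and Y: "L2_stieltjes_limit P s t i j Y" "Y \<in> borel_measurable P"
    and coord[measurable]: "\<And>r k. (\<lambda>\<omega>. \<omega> r $ k) \<in> borel_measurable P" and st: "s \<le> t"
  shows "AE \<omega> in P. X \<omega> = Y \<omega>"
proof -
  note [measurable] = X(2) Y(2)
  have "(\<integral>\<^sup>+\<omega>. ennreal ((X \<omega> - Y \<omega>)\<^sup>2) \<partial>P) \<le> 0"
  proof (rule ennreal_le_epsilon)
    fix e :: real assume e: "0 < e"
    then have e4: "0 < e / 4" by simp
    obtain \<eta>1 where \<eta>1: "0 < \<eta>1" "\<And>n \<pi>. partition_of s t n \<pi> \<and> (\<forall>k<n. \<pi> (Suc k) - \<pi> k < \<eta>1) \<longrightarrow>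
        (\<integral>\<^sup>+\<omega>. ennreal ((stieltjes_sum n \<pi> (\<lambda>r. \<omega> r $ i) (\<lambda>r. \<omega> r $ j) - X \<omega>)\<^sup>2) \<partial>P) < ennreal (e / 4)"
      using X(1) e4 unfolding L2_stieltjes_limit_def by blast
    obtain \<eta>2 where \<eta>2: "0 < \<eta>2" "\<And>n \<pi>. partition_of s t n \<pi> \<and> (\<forall>k<n. \<pi> (Suc k) - \<pi> k < \<eta>2) \<longrightarrow>
        (\<integral>\<^sup>+\<omega>. ennreal ((stieltjes_sum n \<pi> (\<lambda>r. \<omega> r $ i) (\<lambda>r. \<omega> r $ j) - Y \<omega>)\<^sup>2) \<partial>P) < ennreal (e / 4)"
      using Y(1) e4 unfolding L2_stieltjes_limit_def by blast
    obtain n \<pi> where p: "partition_of s t n \<pi>" "\<And>k. k < n \<Longrightarrow> \<pi> (Suc k) - \<pi> k < min \<eta>1 \<eta>2"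
      using fine_partition[OF st, of "min \<eta>1 \<eta>2"] \<eta>1(1) \<eta>2(1) by auto
    let ?S = "\<lambda>\<omega>. stieltjes_sum n \<pi> (\<lambda>r. \<omega> r $ i) (\<lambda>r. \<omega> r $ j)"
    have [measurable]: "?S \<in> borel_measurable P" unfolding stieltjes_sum_def by measurable
    have SX: "(\<integral>\<^sup>+\<omega>. ennreal ((?S \<omega> - X \<omega>)\<^sup>2) \<partial>P) \<le> ennreal (e / 4)" using \<eta>1(2)[of n \<pi>] p by auto
    have SY: "(\<integral>\<^sup>+\<omega>. ennreal ((?S \<omega> - Y \<omega>)\<^sup>2) \<partial>P) \<le> ennreal (e / 4)" using \<eta>2(2)[of n \<pi>] p by auto
    have "(\<integral>\<^sup>+\<omega>. ennreal ((X \<omega> - Y \<omega>)\<^sup>2) \<partial>P) \<le>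
      (\<integral>\<^sup>+\<omega>. 2 * ennreal ((?S \<omega> - X \<omega>)\<^sup>2) + 2 * ennreal ((?S \<omega> - Y \<omega>)\<^sup>2) \<partial>P)"
    proof (intro nn_integral_mono)
      fix \<omega>
      have "(X \<omega> - Y \<omega>)\<^sup>2 \<le> 2 * (?S \<omega> - X \<omega>)\<^sup>2 + 2 * (?S \<omega> - Y \<omega>)\<^sup>2"
        using zero_le_power2[of "(?S \<omega> - X \<omega>) + (?S \<omega> - Y \<omega>)"] by (simp add: power2_eq_square algebra_simps)
      then have "ennreal ((X \<omega> - Y \<omega>)\<^sup>2) \<le> ennreal (2 * (?S \<omega> - X \<omega>)\<^sup>2 + 2 * (?S \<omega> - Y \<omega>)\<^sup>2)" by (rule ennreal_leI)
      then show "ennreal ((X \<omega> - Y \<omega>)\<^sup>2) \<le> 2 * ennreal ((?S \<omega> - X \<omega>)\<^sup>2) + 2 * ennreal ((?S \<omega> - Y \<omega>)\<^sup>2)"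
        by (simp add: ennreal_plus ennreal_mult)
    qed
    also have "\<dots> = 2 * (\<integral>\<^sup>+\<omega>. ennreal ((?S \<omega> - X \<omega>)\<^sup>2) \<partial>P) + 2 * (\<integral>\<^sup>+\<omega>. ennreal ((?S \<omega> - Y \<omega>)\<^sup>2) \<partial>P)"
      by (simp add: nn_integral_add nn_integral_cmult)
    also have "\<dots> \<le> 2 * ennreal (e / 4) + 2 * ennreal (e / 4)" by (intro add_mono mult_left_mono SX SY) auto
    also have "\<dots> = ennreal e"
    proof -
      have "2 * ennreal (e / 4) = ennreal (e / 2)"
        using e by (simp add: ennreal_mult[of 2, symmetric] flip: ennreal_numeral)
      then show ?thesis using e by (simp add: ennreal_plus[symmetric] del: ennreal_plus)
    qed
    finally show "(\<integral>\<^sup>+\<omega>. ennreal ((X \<omega> - Y \<omega>)\<^sup>2) \<partial>P) \<le> 0 + ennreal e" by simp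
  qed
  then have "AE \<omega> in P. ennreal ((X \<omega> - Y \<omega>)\<^sup>2) = 0"
    by (subst nn_integral_0_iff_AE[symmetric]) auto
  then show ?thesis by eventually_elim simp
qed

lemma levy_areaD:
  assumes "levy_area P A"
  shows "s \<le> t \<Longrightarrow> (\<lambda>\<omega>. A \<omega> s t) \<in> borel_measurable P"
    and "s \<le> t \<Longrightarrow> 0 \<le> s \<or> t \<le> 0 \<Longrightarrow> i < j \<Longrightarrow> L2_stieltjes_limit P s t i j (\<lambda>\<omega>. A \<omega> s t $ i $ j)"
    and "s \<le> t \<Longrightarrow> 0 \<le> s \<or> t \<le> 0 \<Longrightarrow> AE \<omega> in P. A \<omega> s t $ i $ i = 1/2 * (\<omega> t $ i - \<omega> s $ i)\<^sup>2"
    and "s \<le> t \<Longrightarrow> 0 \<le> s \<or> t \<le> 0 \<Longrightarrow> i < j \<Longrightarrow> AE \<omega> in P.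
      A \<omega> s t $ j $ i = - A \<omega> s t $ i $ j + (\<omega> t $ i - \<omega> s $ i) * (\<omega> t $ j - \<omega> s $ j)"
    and "s < 0 \<Longrightarrow> 0 < t \<Longrightarrow> AE \<omega> in P.
      A \<omega> s t $ i $ j = A \<omega> s 0 $ i $ j + A \<omega> 0 t $ i $ j - \<omega> s $ i * \<omega> t $ j"
  using assms unfolding levy_area_def by blast+

text \<open>The order of \<open>'m\<close> singles out the entries fixed by the mean square limit.
  The diagonal is explicit, the transposed entries follow from the symmetric part, and times on both
  sides of 0 follow from the one-sided ones. The exceptional null set depends on the times.\<close>

lemma levy_area_unique:
  fixes P :: "('m::{finite,linorder}) path measure"
  assumes A: "levy_area P A" and B: "levy_area P B"
    and coord: "\<And>r k. (\<lambda>\<omega>. \<omega> r $ k) \<in> borel_measurable P" and st: "s \<le> t"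
  shows "AE \<omega> in P. A \<omega> s t = B \<omega> s t"
proof -
  have m: "(\<lambda>\<omega>. C \<omega> s t $ i $ j) \<in> borel_measurable P" if "levy_area P C" "s \<le> t" for C s t i j
  proof -
    have [measurable]: "(\<lambda>\<omega>. C \<omega> s t) \<in> borel_measurable P" using that by (rule levy_areaD)
    have "continuous_on UNIV (\<lambda>v :: ((real, 'm) vec, 'm) vec. v $ i $ j)" by (intro continuous_intros)
    then have [measurable]: "(\<lambda>v :: ((real, 'm) vec, 'm) vec. v $ i $ j) \<in> borel_measurable borel"
      by (rule borel_measurable_continuous_onI)
    show ?thesis by measurable
  qed
  have ord: "AE \<omega> in P. A \<omega> s t $ i $ j = B \<omega> s t $ i $ j" if st: "s \<le> t" "0 \<le> s \<or> t \<le> 0" for s t i j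
  proof -
    have lt: "AE \<omega> in P. A \<omega> s t $ i $ j = B \<omega> s t $ i $ j" if "i < j" for i j
      by (rule L2_stieltjes_limit_unique[OF levy_areaD(2)[OF A st that] m[OF A st(1)] levy_areaD(2)[OF B st that] m[OF B st(1)] coord st(1)])
    consider "i < j" | "i = j" | "j < i" by (rule linorder_cases)
    then show ?thesis
    proof cases
      case 1
      then show ?thesis by (rule lt)
    next
      case 2
      have "AE \<omega> in P. A \<omega> s t $ i $ i = 1/2 * (\<omega> t $ i - \<omega> s $ i)\<^sup>2" "AE \<omega> in P. B \<omega> s t $ i $ i = 1/2 * (\<omega> t $ i - \<omega> s $ i)\<^sup>2"
        by (rule levy_areaD(3)[OF A st] levy_areaD(3)[OF B st])+
      then show ?thesis unfolding 2[symmetric] by eventually_elim simp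
    next
      case 3
      have "AE \<omega> in P. A \<omega> s t $ i $ j = - A \<omega> s t $ j $ i + (\<omega> t $ j - \<omega> s $ j) * (\<omega> t $ i - \<omega> s $ i)"
        "AE \<omega> in P. B \<omega> s t $ i $ j = - B \<omega> s t $ j $ i + (\<omega> t $ j - \<omega> s $ j) * (\<omega> t $ i - \<omega> s $ i)"
        by (rule levy_areaD(4)[OF A st 3] levy_areaD(4)[OF B st 3])+
      with lt[OF 3] show ?thesis by eventually_elim simp
    qed
  qed
  have comp: "AE \<omega> in P. A \<omega> s t $ i $ j = B \<omega> s t $ i $ j" for i j
  proof (cases "0 \<le> s \<or> t \<le> 0")
    case True
    then show ?thesis by (rule ord[OF st])
  next
    case False
    then have st0: "s < 0" "0 < t" by auto
    have "AE \<omega> in P. A \<omega> s t $ i $ j = A \<omega> s 0 $ i $ j + A \<omega> 0 t $ i $ j - \<omega> s $ i * \<omega> t $ j"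
      "AE \<omega> in P. B \<omega> s t $ i $ j = B \<omega> s 0 $ i $ j + B \<omega> 0 t $ i $ j - \<omega> s $ i * \<omega> t $ j"
      by (rule levy_areaD(5)[OF A st0] levy_areaD(5)[OF B st0])+
    moreover have "AE \<omega> in P. A \<omega> s 0 $ i $ j = B \<omega> s 0 $ i $ j" "AE \<omega> in P. A \<omega> 0 t $ i $ j = B \<omega> 0 t $ i $ j"
      using False by (auto intro!: ord)
    ultimately show ?thesis by eventually_elim simp
  qed
  have "AE \<omega> in P. \<forall>i\<in>UNIV. \<forall>j\<in>UNIV. A \<omega> s t $ i $ j = B \<omega> s t $ i $ j"
    by (intro AE_finite_allI finite comp)
  then show ?thesis by eventually_elim (simp add: vec_eq_iff)
qed

text \<open>The Hoelder rate bounds the error by a multiple of the square root of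
  \<open>t - s\<close>, so convergence is uniform on a bounded set of times, up to and including the
  diagonal.\<close>

lemma limit_area_continuous:
  fixes \<omega> :: "'m::finite path"
  assumes w: "continuous_on UNIV \<omega>" and d: "\<And>n. 0 < \<delta> n" and conv: "area_converges \<delta> \<omega>"
    and V: "\<And>s t. s \<le> t \<Longrightarrow> V s t = lim (\<lambda>i. approx_area (\<delta> i) \<omega> s t)"
  shows "continuous_on {(s, t). - real m \<le> s \<and> s \<le> t \<and> t \<le> real m} (\<lambda>(s, t). V s t)"
proof (rule uniform_limit_theorem)
  let ?K = "{(s, t). - real m \<le> s \<and> s \<le> t \<and> t \<le> real m}"
  show "\<forall>\<^sub>F p in sequentially. continuous_on ?K (\<lambda>(s, t). approx_area (\<delta> p) \<omega> s t)"
    by (intro always_eventually allI continuous_on_subset[OF approx_area_continuous[OF w d]]) auto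
  show "uniform_limit ?K (\<lambda>p (s, t). approx_area (\<delta> p) \<omega> s t) (\<lambda>(s, t). V s t) sequentially"
  proof (rule uniform_limitI)
    fix e :: real assume e: "0 < e"
    define e' where "e' = e / (2 * (2 * real m + 2))"
    have e': "0 < e'" using e by (simp add: e'_def)
    have quarter: "0 < (1/4 :: real)" "1/4 < (1/2 :: real)" by auto
    \<comment> \<open>The radius is enlarged by 1 because \<open>m\<close> may be 0 and the rate
      needs a positive radius.\<close>
    have "0 < real m + 1" by simp
    from area_limit_rate[OF conv this quarter e']
    obtain N where N: "\<And>p s t. N \<le> p \<Longrightarrow> - (real m + 1) \<le> s \<Longrightarrow> s < t \<Longrightarrow> t \<le> real m + 1 \<Longrightarrow>
      norm (approx_area (\<delta> p) \<omega> s t - lim (\<lambda>i. approx_area (\<delta> i) \<omega> s t)) \<le> e' * (t - s) powr (2 * (1/4))" by blast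
    show "\<forall>\<^sub>F p in sequentially. \<forall>z\<in>?K. dist (case z of (s, t) \<Rightarrow> approx_area (\<delta> p) \<omega> s t) (case z of (s, t) \<Rightarrow> V s t) < e"
      unfolding eventually_sequentially
    proof (intro exI[of _ N] allI impI ballI)
      fix p z assume p: "N \<le> p" and z: "z \<in> ?K"
      obtain s t where st: "z = (s, t)" "- real m \<le> s" "s \<le> t" "t \<le> real m" using z by auto
      have "norm (approx_area (\<delta> p) \<omega> s t - V s t) < e"
      proof (cases "s = t")
        case True
        then show ?thesis using e by (simp add: V approx_area_refl)
      next
        case False
        have "norm (approx_area (\<delta> p) \<omega> s t - V s t) \<le> e' * (t - s) powr (2 * (1/4))"
          unfolding V[OF st(3)] using p st False by (intro N) auto
        also have "\<dots> \<le> e' * (2 * real m + 2) powr 1"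
        proof (intro mult_left_mono)
          have "(t - s) powr (2 * (1/4)) \<le> (2 * real m + 2) powr (2 * (1/4))" using st by (intro powr_mono2) auto
          also have "\<dots> \<le> (2 * real m + 2) powr 1" by (intro powr_mono) auto
          finally show "(t - s) powr (2 * (1/4)) \<le> (2 * real m + 2) powr 1" .
        qed (use e' in simp)
        also have "\<dots> = e / 2"
        proof -
          have "(2 * real m + 2) powr 1 = 2 * real m + 2" by simp
          then show ?thesis unfolding e'_def by (simp add: field_simps)
        qed
        finally show ?thesis using e by simp
      qed
      then show "dist (case z of (s, t) \<Rightarrow> approx_area (\<delta> p) \<omega> s t) (case z of (s, t) \<Rightarrow> V s t) < e"
        by (simp add: st(1) dist_norm)
    qed
  qed
qed simp

section \<open>The invariant set of full measure and the version on it\<close>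

locale converging_areas = wiener W for W :: "('m::{finite,linorder}) path measure" +
  fixes \<Omega> :: "'m path set" and P :: "'m path measure" and \<delta> :: "nat \<Rightarrow> real"
  assumes path_set: "canonical_path_set W \<Omega>"
    and P_def: "P = restrict_space W \<Omega>"
    and scale: "\<And>i. 0 < \<delta> i" "\<And>i. \<delta> i \<le> 1" "sufficiently_fast \<delta>"
begin

text \<open>The set to be exhibited as \<open>\<Omega>'\<close> in the theorem.\<close>

definition good :: "'m path set" where
  "good = {\<omega> \<in> \<Omega>. area_converges \<delta> \<omega>}"

lemma scale_tendsto: "\<delta> \<longlonglongrightarrow> 0"
  using scale(3) by (simp add: sufficiently_fast_def)

lemma path_set_sets: "\<Omega> \<in> sets W" "\<Omega> \<inter> space W \<in> sets W"
  using path_set by (auto simp: canonical_path_set_def)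

lemma path_set_hoelder: "\<omega> \<in> \<Omega> \<Longrightarrow> hoelder_path \<omega>"
  using path_set by (auto simp: canonical_path_set_def hoelder_path_def C0_paths_def)

lemma AE_path_set: "AE \<omega> in W. \<omega> \<in> \<Omega>"
  using path_set prob_eq_1[OF path_set_sets(1)] by (simp add: canonical_path_set_def)

lemma AE_hoelder: "AE \<omega> in W. hoelder_path \<omega>"
  using AE_path_set by eventually_elim (rule path_set_hoelder)

lemma good_sets: "good \<in> sets W"
proof -
  have "good = \<Omega> \<inter> {\<omega> \<in> space W. area_converges \<delta> \<omega>}"
    using sets.sets_into_space[OF path_set_sets(1)] by (auto simp: good_def)
  then show ?thesis using path_set_sets(1) area_converges_sets[OF scale(1,2)] by simp
qed

lemma AE_good: "AE \<omega> in W. \<omega> \<in> good"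
  using AE_path_set AE_area_converges[OF AE_hoelder scale] by eventually_elim (simp add: good_def)

lemma AE_P: "(AE \<omega> in W. Q \<omega>) \<Longrightarrow> AE \<omega> in P. Q \<omega>"
  unfolding P_def by (subst AE_restrict_space_iff[OF path_set_sets(2)]) auto

lemma measurable_P: "f \<in> borel_measurable W \<Longrightarrow> f \<in> borel_measurable P"
  unfolding P_def by (rule measurable_restrict_space1)

lemma nn_integral_P: "(\<integral>\<^sup>+\<omega>. f \<omega> \<partial>P) = (\<integral>\<^sup>+\<omega>. f \<omega> \<partial>W)"
proof -
  have "(\<integral>\<^sup>+\<omega>. f \<omega> \<partial>P) = (\<integral>\<^sup>+\<omega>. f \<omega> * indicator \<Omega> \<omega> \<partial>W)"
    unfolding P_def by (rule nn_integral_restrict_space[OF path_set_sets(2)])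
  also have "\<dots> = (\<integral>\<^sup>+\<omega>. f \<omega> \<partial>W)"
    by (rule nn_integral_cong_AE) (use AE_path_set in eventually_elim, simp)
  finally show ?thesis .
qed

lemma area_version_tendsto:
  assumes "\<omega> \<in> good" "s \<le> t"
  shows "(\<lambda>n. approx_area (\<delta> n) \<omega> s t) \<longlonglongrightarrow> area_version \<delta> good \<omega> s t"
  using assms area_limit[of \<delta> \<omega> s t] by (simp add: area_version_def good_def)

lemma area_version_component_tendsto:
  assumes "\<omega> \<in> good" "s \<le> t"
  shows "(\<lambda>n. smooth_area (\<delta> n) (\<lambda>r. \<omega> r $ i) (\<lambda>r. \<omega> r $ j) s t) \<longlonglongrightarrow> area_version \<delta> good \<omega> s t $ i $ j"
proof -
  have c: "continuous_on UNIV \<omega>" using assms path_set_hoelder by (auto simp: good_def hoelder_path_def)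
  have "(\<lambda>n. approx_area (\<delta> n) \<omega> s t $ i $ j) \<longlonglongrightarrow> area_version \<delta> good \<omega> s t $ i $ j"
    by (intro tendsto_vec_nth area_version_tendsto assms)
  then show ?thesis by (simp add: approx_area_component[OF c scale(1) assms(2)])
qed

text \<open>Integration by parts for the smooth areas in the limit; it supplies the diagonal and the
  transposed entries of the area.\<close>

lemma area_version_by_parts:
  assumes "\<omega> \<in> good" "s \<le> t"
  shows "area_version \<delta> good \<omega> s t $ i $ j + area_version \<delta> good \<omega> s t $ j $ i = (\<omega> t $ i - \<omega> s $ i) * (\<omega> t $ j - \<omega> s $ j)"
proof (rule LIMSEQ_unique)
  have h: "hoelder_path \<omega>" using assms path_set_hoelder by (auto simp: good_def)
  then have c: "continuous_on UNIV \<omega>" by (simp add: hoelder_path_def)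
  show "(\<lambda>n. smooth_area (\<delta> n) (\<lambda>r. \<omega> r $ i) (\<lambda>r. \<omega> r $ j) s t + smooth_area (\<delta> n) (\<lambda>r. \<omega> r $ j) (\<lambda>r. \<omega> r $ i) s t)
    \<longlonglongrightarrow> area_version \<delta> good \<omega> s t $ i $ j + area_version \<delta> good \<omega> s t $ j $ i"
    by (intro tendsto_add area_version_component_tendsto assms)
  show "(\<lambda>n. smooth_area (\<delta> n) (\<lambda>r. \<omega> r $ i) (\<lambda>r. \<omega> r $ j) s t + smooth_area (\<delta> n) (\<lambda>r. \<omega> r $ j) (\<lambda>r. \<omega> r $ i) s t)
    \<longlonglongrightarrow> (\<omega> t $ i - \<omega> s $ i) * (\<omega> t $ j - \<omega> s $ j)"
    unfolding smooth_area_by_parts[OF continuous_on_component[OF c] continuous_on_component[OF c] scale(1) assms(2)]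
    by (intro tendsto_mult mean_incr_tendsto h scale(1,2) scale_tendsto assms(2))
qed

lemma area_version_chen:
  assumes "\<omega> \<in> good" "s \<le> u" "u \<le> t"
  shows "area_version \<delta> good \<omega> s t $ i $ j = area_version \<delta> good \<omega> s u $ i $ j + area_version \<delta> good \<omega> u t $ i $ j +
    (\<omega> u $ i - \<omega> s $ i) * (\<omega> t $ j - \<omega> u $ j)"
proof (rule LIMSEQ_unique)
  have h: "hoelder_path \<omega>" using assms path_set_hoelder by (auto simp: good_def)
  then have c: "continuous_on UNIV \<omega>" by (simp add: hoelder_path_def)
  show "(\<lambda>n. smooth_area (\<delta> n) (\<lambda>r. \<omega> r $ i) (\<lambda>r. \<omega> r $ j) s t) \<longlonglongrightarrow> area_version \<delta> good \<omega> s t $ i $ j"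
    using assms by (intro area_version_component_tendsto) auto
  show "(\<lambda>n. smooth_area (\<delta> n) (\<lambda>r. \<omega> r $ i) (\<lambda>r. \<omega> r $ j) s t) \<longlonglongrightarrow> area_version \<delta> good \<omega> s u $ i $ j +
    area_version \<delta> good \<omega> u t $ i $ j + (\<omega> u $ i - \<omega> s $ i) * (\<omega> t $ j - \<omega> u $ j)"
    unfolding smooth_area_chen[OF continuous_on_component[OF c] continuous_on_component[OF c] scale(1) assms(2,3)]
    by (intro tendsto_add tendsto_mult mean_incr_tendsto h scale(1,2) scale_tendsto area_version_component_tendsto assms)
qed

lemma area_version_measurable:
  assumes "s \<le> t" shows "(\<lambda>\<omega>. area_version \<delta> good \<omega> s t) \<in> borel_measurable W"
proof (rule borel_measurable_LIMSEQ_metric)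
  \<comment> \<open>The approximations are set to 0 outside \<open>good\<close>, so that they
    converge at every path, as the measurability of a limit requires.\<close>
  show "(\<lambda>\<omega>. if \<omega> \<in> good then approx_area (\<delta> n) \<omega> s t else 0) \<in> borel_measurable W" for n
    using good_sets approx_area_measurable[OF scale(1,2) assms]
    by (intro measurable_If_set) (auto simp: sets.Int_space_eq2)
  fix \<omega>
  show "(\<lambda>n. if \<omega> \<in> good then approx_area (\<delta> n) \<omega> s t else 0) \<longlonglongrightarrow> area_version \<delta> good \<omega> s t"
    using area_version_tendsto[OF _ assms] by (cases "\<omega> \<in> good") (simp_all add: area_version_def)
qed

lemma area_version_L2:
  assumes ij: "i \<noteq> j" and st: "s \<le> t"
  shows "L2_stieltjes_limit P s t i j (\<lambda>\<omega>. area_version \<delta> good \<omega> s t $ i $ j)"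
  unfolding L2_stieltjes_limit_def
proof (intro allI impI)
  fix \<epsilon> :: real assume e: "0 < \<epsilon>"
  \<comment> \<open>With this choice
    \<open>64 * \<eta> * (t - s) = \<epsilon> - 64 * \<eta>\<close>; the added 64 also covers
    \<open>s = t\<close>.\<close>
  define \<eta> where "\<eta> = \<epsilon> / (64 * (t - s) + 64)"
  have pos: "0 < 64 * (t - s) + 64" using st by simp
  have \<eta>: "0 < \<eta>" using e pos by (simp add: \<eta>_def)
  have small: "64 * \<eta> * (t - s) < \<epsilon>"
  proof -
    have "64 * \<eta> * (t - s) = \<epsilon> - 64 * \<eta>" unfolding \<eta>_def using pos by (simp add: field_simps)
    then show ?thesis using \<eta> by simp
  qed
  have V: "AE \<omega> in W. (\<lambda>n. smooth_area (\<delta> n) (\<lambda>r. \<omega> r $ i) (\<lambda>r. \<omega> r $ j) s t) \<longlonglongrightarrow> area_version \<delta> good \<omega> s t $ i $ j"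
    using AE_good by eventually_elim (rule area_version_component_tendsto[OF _ st])
  show "\<exists>\<eta>>0. \<forall>n \<pi>. partition_of s t n \<pi> \<and> (\<forall>k<n. \<pi> (Suc k) - \<pi> k < \<eta>) \<longrightarrow>
     (\<integral>\<^sup>+\<omega>. ennreal ((stieltjes_sum n \<pi> (\<lambda>r. \<omega> r $ i) (\<lambda>r. \<omega> r $ j) - area_version \<delta> good \<omega> s t $ i $ j)\<^sup>2) \<partial>P) < ennreal \<epsilon>"
  proof (intro exI[of _ \<eta>] conjI allI impI \<eta>)
    fix n \<pi> assume p: "partition_of s t n \<pi> \<and> (\<forall>k<n. \<pi> (Suc k) - \<pi> k < \<eta>)"
    have "(\<integral>\<^sup>+\<omega>. ennreal ((stieltjes_sum n \<pi> (\<lambda>r. \<omega> r $ i) (\<lambda>r. \<omega> r $ j) - area_version \<delta> good \<omega> s t $ i $ j)\<^sup>2) \<partial>P) \<le>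
      ennreal (64 * \<eta> * (t - s))"
      unfolding nn_integral_P by (rule limit_area_L2[OF AE_hoelder scale ij st \<eta> V]) (use p in auto)
    also have "\<dots> < ennreal \<epsilon>" using small \<eta> st by (intro ennreal_lessI e) auto
    finally show "(\<integral>\<^sup>+\<omega>. ennreal ((stieltjes_sum n \<pi> (\<lambda>r. \<omega> r $ i) (\<lambda>r. \<omega> r $ j) - area_version \<delta> good \<omega> s t $ i $ j)\<^sup>2) \<partial>P) < ennreal \<epsilon>" .
  qed
qed

lemma levy_area_version: "levy_area P (area_version \<delta> good)"
  unfolding levy_area_def
proof (intro conjI allI impI)
  show "(\<lambda>\<omega>. area_version \<delta> good \<omega> s t) \<in> borel_measurable P" if "s \<le> t" for s t
    by (intro measurable_P area_version_measurable that)
  fix s t and i j :: 'm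
  show "L2_stieltjes_limit P s t i j (\<lambda>\<omega>. area_version \<delta> good \<omega> s t $ i $ j)" if "s \<le> t \<and> (0 \<le> s \<or> t \<le> 0)" "i < j"
    using that by (intro area_version_L2) auto
  show "AE \<omega> in P. area_version \<delta> good \<omega> s t $ i $ i = 1/2 * (\<omega> t $ i - \<omega> s $ i)\<^sup>2" if "s \<le> t \<and> (0 \<le> s \<or> t \<le> 0)"
    using AE_P[OF AE_good]
  proof eventually_elim
    case (elim \<omega>)
    then show ?case using area_version_by_parts[OF elim, of s t i i] that by (simp add: power2_eq_square)
  qed
  show "AE \<omega> in P. area_version \<delta> good \<omega> s t $ j $ i = - area_version \<delta> good \<omega> s t $ i $ j + (\<omega> t $ i - \<omega> s $ i) * (\<omega> t $ j - \<omega> s $ j)"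
    if "s \<le> t \<and> (0 \<le> s \<or> t \<le> 0)" "i < j"
    using AE_P[OF AE_good]
  proof eventually_elim
    case (elim \<omega>)
    then show ?case using area_version_by_parts[OF elim, of s t i j] that by simp
  qed
  \<comment> \<open>Chen's relation at the intermediate time 0, where the path vanishes, produces
    exactly the term \<open>- \<omega> s $ i * \<omega> t $ j\<close>.\<close>
  show "AE \<omega> in P. area_version \<delta> good \<omega> s t $ i $ j = area_version \<delta> good \<omega> s 0 $ i $ j + area_version \<delta> good \<omega> 0 t $ i $ j - \<omega> s $ i * \<omega> t $ j"
    if "s < 0 \<and> 0 < t"
    using AE_P[OF AE_good] AE_P[OF AE_space]
  proof eventually_elim
    case (elim \<omega>)
    then show ?case using area_version_chen[OF elim(1), of s 0 t i j] that space_W(2)[OF elim(2)] by simp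
  qed
qed

text \<open>Two areas agree at fixed times outside a null set depending on the times. Rational pairs
  need only one null set, and continuity of both areas on ordered pairs extends the equality to all
  times.\<close>

lemma indistinguishable_area_version: "indistinguishable_area P (area_version \<delta> good)"
  unfolding indistinguishable_area_def
proof (intro conjI allI impI levy_area_version)
  fix A assume A: "levy_area P A \<and> (AE \<omega> in P. continuous_on {(s, t). s \<le> t} (\<lambda>(s, t). A \<omega> s t))"
  have "AE \<omega> in P. \<forall>(s :: rat) (t :: rat). s \<le> t \<longrightarrow> area_version \<delta> good \<omega> (of_rat s) (of_rat t) = A \<omega> (of_rat s) (of_rat t)"
    unfolding AE_all_countable
  proof (intro allI)
    fix s t :: rat
    show "AE \<omega> in P. s \<le> t \<longrightarrow> area_version \<delta> good \<omega> (of_rat s) (of_rat t) = A \<omega> (of_rat s) (of_rat t)"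
    proof (cases "s \<le> t")
      case True
      have "AE \<omega> in P. area_version \<delta> good \<omega> (of_rat s) (of_rat t) = A \<omega> (of_rat s) (of_rat t)"
        by (rule levy_area_unique[OF levy_area_version _ measurable_P[OF measurable_coord]])
           (use A True in \<open>auto simp: of_rat_less_eq\<close>)
      then show ?thesis by eventually_elim simp
    qed simp
  qed
  moreover have "AE \<omega> in P. continuous_on {(s, t). s \<le> t} (\<lambda>(s, t). A \<omega> s t)" using A by blast
  ultimately show "AE \<omega> in P. \<forall>s t. s \<le> t \<longrightarrow> area_version \<delta> good \<omega> s t = A \<omega> s t"
    using AE_P[OF AE_good]
  proof eventually_elim
    case (elim \<omega>)
    show ?case
    proof (intro allI impI)
      fix s t :: real assume st: "s \<le> t"
      let ?s = "\<lambda>n. real_of_rat (rat_below s n)" and ?t = "\<lambda>n. real_of_rat (rat_below t n)"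
      obtain m :: nat where m: "max \<bar>s\<bar> \<bar>t\<bar> \<le> real m" using real_arch_simple by blast
      let ?K = "{(s, t). - real m \<le> s \<and> s \<le> t \<and> t \<le> real m}"
      have c: "continuous_on UNIV \<omega>" using elim(3) path_set_hoelder by (auto simp: good_def hoelder_path_def)
      have "continuous_on ?K (\<lambda>(s, t). area_version \<delta> good \<omega> s t)"
        by (rule limit_area_continuous[OF c scale(1)]) (use elim(3) in \<open>auto simp: good_def area_version_def\<close>)
      then have "(\<lambda>n. (\<lambda>(s, t). area_version \<delta> good \<omega> s t) (?s n, ?t n)) \<longlonglongrightarrow> (\<lambda>(s, t). area_version \<delta> good \<omega> s t) (s, t)"
      proof (rule continuous_on_tendsto_compose)
        show "(\<lambda>n. (?s n, ?t n)) \<longlonglongrightarrow> (s, t)" by (intro tendsto_Pair rat_below_tendsto)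
        show "(s, t) \<in> ?K" using st m by auto
        show "\<forall>\<^sub>F n in sequentially. (?s n, ?t n) \<in> ?K"
        proof (intro always_eventually allI)
          fix n
          have "\<bar>?s n\<bar> \<le> real m" by (rule rat_below_bound) (use m in simp)
          moreover have "\<bar>?t n\<bar> \<le> real m" by (rule rat_below_bound) (use m in simp)
          moreover have "?s n \<le> ?t n" using rat_below_mono[OF st] by (simp add: of_rat_less_eq)
          ultimately show "(?s n, ?t n) \<in> ?K" unfolding abs_le_iff by simp
        qed
      qed
      moreover have "area_version \<delta> good \<omega> (?s n) (?t n) = A \<omega> (?s n) (?t n)" for n
        using elim(1) rat_below_mono[OF st] by blast
      ultimately have "(\<lambda>n. A \<omega> (?s n) (?t n)) \<longlonglongrightarrow> area_version \<delta> good \<omega> s t" by simp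
      then show "area_version \<delta> good \<omega> s t = A \<omega> s t"
        using pair_sequence_tendsto[OF elim(2) st] by (rule LIMSEQ_unique)
    qed
  qed
qed

text \<open>Outside \<open>good\<close> the path is replaced by zero, and its approximations are
  then zero as well, so convergence holds there trivially.\<close>

lemma approx_zero: "approx_path d (\<lambda>_. 0) = (\<lambda>_. 0 :: (real, 'm) vec)" "approx_area d (\<lambda>_. 0 :: (real, 'm) vec) = (\<lambda>_ _. 0)"
proof -
  show p: "approx_path d (\<lambda>_. 0) = (\<lambda>_. 0 :: (real, 'm) vec)" for d
    by (simp add: approx_path_def fun_eq_iff)
  have "tensor 0 v = 0" for v :: "(real, 'm) vec" by (simp add: tensor_def vec_eq_iff)
  then show "approx_area d (\<lambda>_. 0 :: (real, 'm) vec) = (\<lambda>_ _. 0)"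
    by (simp add: approx_area_def fun_eq_iff p)
qed

lemma converges:
  assumes T: "0 < T" and w: "\<omega> \<in> \<Omega>" and b: "0 < \<beta>" "\<beta> < 1/2"
  shows "hoelder_tendsto \<beta> T (\<lambda>i. approx_path (\<delta> i) (path_version good \<omega>)) (path_version good \<omega>)"
    and "hoelder_tendsto2 (2 * \<beta>) T (\<lambda>i. approx_area (\<delta> i) (path_version good \<omega>)) (area_version \<delta> good \<omega>)"
proof -
  have h: "hoelder_path \<omega>" by (rule path_set_hoelder[OF w])
  have "hoelder_tendsto \<beta> T (\<lambda>i. approx_path (\<delta> i) (path_version good \<omega>)) (path_version good \<omega>) \<and>
    hoelder_tendsto2 (2 * \<beta>) T (\<lambda>i. approx_area (\<delta> i) (path_version good \<omega>)) (area_version \<delta> good \<omega>)"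
  proof (cases "\<omega> \<in> good")
    case True
    then have conv: "area_converges \<delta> \<omega>" by (simp add: good_def)
    have "path_version good \<omega> = \<omega>" "area_version \<delta> good \<omega> = (\<lambda>s t. lim (\<lambda>i. approx_area (\<delta> i) \<omega> s t))"
      using True by (simp_all add: path_version_def area_version_def fun_eq_iff)
    then show ?thesis
      using approx_path_converges[OF h scale(1,2) scale_tendsto T b] approx_area_converges[OF h scale(1,2) conv T b]
      by simp
  next
    case False
    have "path_version good \<omega> = (\<lambda>_. 0)" "area_version \<delta> good \<omega> = (\<lambda>_ _. 0)"
      using False by (simp_all add: path_version_def area_version_def fun_eq_iff)
    moreover have "(\<lambda>_. 0 :: (real, 'm) vec) \<in> hoelder_space \<beta> T" by (rule hoelder_spaceI[where C=0]) auto
    moreover have "(\<lambda>_ _. 0 :: ((real, 'm) vec, 'm) vec) \<in> hoelder_space2 (2 * \<beta>) T" by (rule hoelder_space2I[where C=0]) auto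
    moreover have "hoelder_seminorm \<beta> T (\<lambda>_. 0 :: (real, 'm) vec) = 0"
      using hoelder_seminorm_le[of T "\<lambda>_. 0 :: (real, 'm) vec" 0 \<beta>] by simp
    moreover have "hoelder_seminorm2 (2 * \<beta>) T (\<lambda>_ _. 0 :: ((real, 'm) vec, 'm) vec) = 0"
      using hoelder_seminorm2_le[of T "\<lambda>_ _. 0 :: ((real, 'm) vec, 'm) vec" 0 "2 * \<beta>"] by simp
    ultimately show ?thesis
      by (simp add: approx_zero hoelder_tendsto_def hoelder_tendsto2_def)
  qed
  then show "hoelder_tendsto \<beta> T (\<lambda>i. approx_path (\<delta> i) (path_version good \<omega>)) (path_version good \<omega>)"
    "hoelder_tendsto2 (2 * \<beta>) T (\<lambda>i. approx_area (\<delta> i) (path_version good \<omega>)) (area_version \<delta> good \<omega>)" by blast+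
qed

end

theorem theorem14:
  fixes W :: "('m::{finite,linorder}) path measure"
    and \<Omega> :: "'m path set"
    and P :: "'m path measure"
    and \<delta> :: "nat \<Rightarrow> real"
  assumes "two_sided_wiener_measure W"
    and "canonical_path_set W \<Omega>"
    and "P = restrict_space W \<Omega>"
    and "\<And>i. 0 < \<delta> i \<and> \<delta> i \<le> 1"
    and "sufficiently_fast \<delta>"
  shows "\<exists>\<Omega>'. \<Omega>' \<subseteq> \<Omega> \<and> \<Omega>' \<in> sets P \<and> measure P \<Omega>' = 1 \<and> shift_invariant \<Omega>' \<and>
           indistinguishable_area P (area_version \<delta> \<Omega>') \<and>
           (\<forall>T>0. \<forall>\<omega>\<in>\<Omega>. \<forall>\<beta>. 0 < \<beta> \<and> \<beta> < 1/2 \<longrightarrow>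
              hoelder_tendsto \<beta> T
                (\<lambda>i. approx_path (\<delta> i) (path_version \<Omega>' \<omega>)) (path_version \<Omega>' \<omega>) \<and>
              hoelder_tendsto2 (2 * \<beta>) T
                (\<lambda>i. approx_area (\<delta> i) (path_version \<Omega>' \<omega>)) (area_version \<delta> \<Omega>' \<omega>))"
proof -
  interpret converging_areas W \<Omega> P \<delta>
    by unfold_locales (use assms in auto)
  have sub: "good \<subseteq> \<Omega>" by (auto simp: good_def)
  have "good \<in> sets P"
    unfolding P_def sets_restrict_space_iff[OF path_set_sets(2)] using sub good_sets by blast
  moreover have "measure P good = 1"
    \<comment> \<open>The measure of a subset of \<open>\<Omega>\<close> is unchanged by the
      restriction, so almost sure membership under \<open>W\<close> gives measure 1 under
      \<open>P\<close>.\<close>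
    unfolding P_def using measure_restrict_space[OF path_set_sets(2) sub] prob_eq_1[OF good_sets] AE_good by simp
  moreover have "shift_invariant good"
    unfolding good_def by (rule shift_invariant_converging) (use path_set scale in \<open>auto simp: canonical_path_set_def\<close>)
  ultimately show ?thesis
    using sub indistinguishable_area_version converges by (intro exI[of _ good]) blast
qed

end
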